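(* Let $A\in\mathbb{Q}^{d\times d}$ be such that all eigenvalues of $A$ have distinct modulus up to complex conjugate pairs (i.e. two distinct eigenvalues have the same modulus only if they are complex conjugates of each other), let $x\in\mathbb{Q}^d$, and let $U\subseteq\mathbb{Q}^d$ be a subspace, given by rational basis vectors, of dimension at most one. Then it is decidable whether there exists $n\in\mathbb{N}$ such that $A^nx\in U$. *)

theory Defs
  imports Complex_Main "HOL-Library.Nat_Bijection"
    "Jordan_Normal_Form.VS_Connect" "Jordan_Normal_Form.Char_Poly"
begin

text \<open>
  Kleene's partial recursive functions. A program carries no arity; for each fixed length of the
  argument list it denotes one partial recursive function of that many arguments.
\<close>

datatype recf =
    Zero
  | Succ
  | Proj nat
  | Comp recf "recf list"
  | PrimRec recf recf
  | Mu recf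

text \<open>
  The result \<open>None\<close> means divergence (or an argument list that is too short). Composition is strict,
  and minimisation requires all values before the first zero to be defined.
\<close>

fun eval_recf :: "recf \<Rightarrow> nat list \<Rightarrow> nat option" where
  "eval_recf Zero xs = Some 0"
| "eval_recf Succ xs = (case xs of [] \<Rightarrow> None | x # _ \<Rightarrow> Some (Suc x))"
| "eval_recf (Proj i) xs = (if i < length xs then Some (xs ! i) else None)"
| "eval_recf (Comp f gs) xs =
     (let ys = map (\<lambda>g. eval_recf g xs) gs
      in if None \<in> set ys then None else eval_recf f (map the ys))"
| "eval_recf (PrimRec f g) xs =
     (case xs of
        [] \<Rightarrow> None
      | n # ys \<Rightarrow>
          rec_nat (eval_recf f ys)
            (\<lambda>m r. case r of None \<Rightarrow> None | Some y \<Rightarrow> eval_recf g (m # y # ys)) n)"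
| "eval_recf (Mu f) xs =
     (if \<exists>n. eval_recf f (n # xs) = Some 0 \<and> (\<forall>m<n. eval_recf f (m # xs) \<noteq> None)
      then Some (LEAST n. eval_recf f (n # xs) = Some 0)
      else None)"

text \<open>
  The set \<open>D\<close> collects the admissible instances and \<open>rep a c\<close> says that the number \<open>c\<close> is a code of
  the instance \<open>a\<close>. An instance may have several codes (a subspace has many bases), and the
  algorithm has to halt with the correct answer on each of them. One program serves all instances.
  Nothing is required on numbers that do not encode an admissible instance.
\<close>

definition decidable_on :: "('a \<Rightarrow> nat \<Rightarrow> bool) \<Rightarrow> 'a set \<Rightarrow> ('a \<Rightarrow> bool) \<Rightarrow> bool" where
  "decidable_on rep D P \<longleftrightarrow>
     (\<exists>f. \<forall>a\<in>D. \<forall>c. rep a c \<longrightarrow> eval_recf f [c] = Some (if P a then 1 else 0))"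

definition rat_code :: "rat \<Rightarrow> nat" where
  "rat_code q = (case quotient_of q of (a, b) \<Rightarrow> prod_encode (int_encode a, nat b))"

definition vec_code :: "rat vec \<Rightarrow> nat" where
  "vec_code v = list_encode (map rat_code (list_of_vec v))"

definition mat_code :: "rat mat \<Rightarrow> nat" where
  "mat_code A = list_encode (map (\<lambda>r. list_encode (map rat_code r)) (mat_to_list A))"

abbreviation rat_space :: "nat \<Rightarrow> (rat, rat vec) module" where
  "rat_space d \<equiv> module_vec TYPE(rat) d"

abbreviation rat_subspace :: "nat \<Rightarrow> rat vec set \<Rightarrow> bool" where
  "rat_subspace d U \<equiv> VectorSpace.subspace class_ring U (rat_space d)"

abbreviation subspace_dim :: "nat \<Rightarrow> rat vec set \<Rightarrow> nat" where
  "subspace_dim d U \<equiv> vectorspace.dim class_ring (rat_space d\<lparr>carrier := U\<rparr>)"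

abbreviation subspace_basis :: "nat \<Rightarrow> rat vec set \<Rightarrow> rat vec set \<Rightarrow> bool" where
  "subspace_basis d U B \<equiv> vectorspace.basis class_ring (rat_space d\<lparr>carrier := U\<rparr>) B"

definition distinct_moduli_up_to_cnj :: "rat mat \<Rightarrow> bool" where
  "distinct_moduli_up_to_cnj A \<longleftrightarrow>
     (\<forall>a b :: complex.
        eigenvalue (map_mat of_rat A) a \<longrightarrow> eigenvalue (map_mat of_rat A) b \<longrightarrow>
        a \<noteq> b \<longrightarrow> cmod a = cmod b \<longrightarrow> b = cnj a)"

definition orbit_instance_code :: "nat \<times> rat mat \<times> rat vec \<times> rat vec set \<Rightarrow> nat \<Rightarrow> bool" where
  "orbit_instance_code = (\<lambda>(d, A, x, U) c.
     \<exists>us. distinct us \<and> subspace_basis d U (set us) \<and>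
       c = list_encode [d, mat_code A, vec_code x, list_encode (map vec_code us)])"

end

theory Submission
  imports Defs "Jordan_Normal_Form.Schur_Decomposition"
begin

text \<open>
  There is a primitive recursive function of the code that bounds the least \<open>n\<close> with \<open>A\<^sup>n x \<in> U\<close>
  whenever such an \<open>n\<close> exists, so it suffices to test the finitely many \<open>n\<close> below the bound.

  Clearing denominators makes \<open>A\<close>, \<open>x\<close> and the basis vector \<open>u\<close> of \<open>U\<close> integral. Let \<open>p\<close> be the monic
  complex polynomial of least degree with \<open>p(A) x = 0\<close>. If \<open>A\<^sup>n x = c u\<close>, then for every root \<open>\<lambda>\<close> of
  \<open>p\<close> and \<open>g = p / (t - \<lambda>)\<close> the eigenvector \<open>g(A) x\<close> satisfies \<open>\<lambda>\<^sup>n g(A) x = c g(A) u\<close>. The coordinates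
  that occur here are polynomials in the eigenvalues of \<open>A\<close>, hence algebraic integers of bounded degree
  and height, and such numbers are bounded away from \<open>0\<close> unless they vanish. Comparing the equations
  for two nonzero roots of different moduli, or the equation for a multiple nonzero root with the one one
  step higher in its Jordan chain, therefore bounds \<open>n\<close>.

  By the hypothesis on the moduli, in the remaining case the nonzero roots are simple and there are at
  most two of them, which are then complex conjugates. This leaves the zeros of a rational binary
  recurrence with negative discriminant. After normalisation its characteristic polynomial is
  \<open>t\<^sup>2 - \<sigma> t + 1\<close> with \<open>\<bar>\<sigma>\<bar> < 2\<close>: if \<open>\<sigma>\<close> is an integer, the recurrence is periodic, and otherwise the
  denominator of \<open>\<sigma>\<close> yields a divisibility condition that bounds \<open>n\<close>.
\<close>

section \<open>Computable functions on encodable types\<close>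

text \<open>Eigenvalues never enter the program, which computes with exact rationals; they occur
  only in the proof that its bound is large enough. The bound must therefore be explicit in the code
  and uniform in the eigenvalues. The obstacle is to keep expressions in several eigenvalues away
  from 0 without computing in number fields. The device: the relevant eigenvalues and their
  conjugates all act on one tensor product of eigenvectors, through integer matrices with bounded
  entries. Sums and products then act as well. A nonzero number z acting through an n by n integer
  matrix satisfies |z| B^n >= 1 when B >= 1 bounds all eigenvalues of the matrix, because its
  nonzero eigenvalues multiply to a nonzero integer. Conjugates are included so that |l|^2 - |k|^2 =
  l cnj(l) - k cnj(k) is such a number too.

  In the binary recurrence, dividing by powers of the square root of the product of the roots would
  leave the rationals. Taking every second term squares the roots, and the normalisation becomes
  rational; this is why even and odd indices are treated separately.\<close>

definition rec_fn :: "nat \<Rightarrow> (nat list \<Rightarrow> nat) \<Rightarrow> bool" where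
  "rec_fn k F \<longleftrightarrow> (\<exists>p. \<forall>xs. length xs = k \<longrightarrow> eval_recf p xs = Some (F xs))"

lemma rec_fn_cong:
  assumes "rec_fn k F" "\<And>xs. length xs = k \<Longrightarrow> F xs = G xs"
  shows "rec_fn k G"
  using assms unfolding rec_fn_def by metis

lemma rec_fn_zero: "rec_fn k (\<lambda>_. 0)"
  unfolding rec_fn_def by (rule exI[of _ Zero]) simp

lemma rec_fn_proj: "i < k \<Longrightarrow> rec_fn k (\<lambda>xs. xs ! i)"
  unfolding rec_fn_def by (rule exI[of _ "Proj i"]) simp

lemma rec_fn_comp:
  assumes F: "rec_fn (length Gs) F" and G: "\<And>G. G \<in> set Gs \<Longrightarrow> rec_fn k G"
  shows "rec_fn k (\<lambda>xs. F (map (\<lambda>G. G xs) Gs))"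
proof -
  obtain p where p: "\<And>xs. length xs = length Gs \<Longrightarrow> eval_recf p xs = Some (F xs)"
    using F unfolding rec_fn_def by auto
  from G obtain q where
    q: "\<And>G xs. G \<in> set Gs \<Longrightarrow> length xs = k \<Longrightarrow> eval_recf (q G) xs = Some (G xs)"
    unfolding rec_fn_def by metis
  have "eval_recf (Comp p (map q Gs)) xs = Some (F (map (\<lambda>G. G xs) Gs))" if "length xs = k" for xs
  proof -
    have "map (\<lambda>g. eval_recf g xs) (map q Gs) = map (\<lambda>G. Some (G xs)) Gs"
      using q that by simp
    moreover have "map the (map (\<lambda>G. Some (G xs)) Gs) = map (\<lambda>G. G xs) Gs" by simp
    ultimately show ?thesis using p[of "map (\<lambda>G. G xs) Gs"]
      by (auto simp: Let_def simp del: map_map)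
  qed
  then show ?thesis unfolding rec_fn_def by blast
qed

lemma rec_fn_comp1:
  assumes "rec_fn 1 (\<lambda>xs. f (xs ! 0))" "rec_fn k G"
  shows "rec_fn k (\<lambda>xs. f (G xs))"
  using rec_fn_comp[of "[G]" "\<lambda>xs. f (xs ! 0)" k] assms by simp

lemma rec_fn_comp2:
  assumes "rec_fn 2 (\<lambda>xs. f (xs ! 0) (xs ! 1))" "rec_fn k G" "rec_fn k H"
  shows "rec_fn k (\<lambda>xs. f (G xs) (H xs))"
  using rec_fn_comp[of "[G, H]" "\<lambda>xs. f (xs ! 0) (xs ! 1)" k] assms
  by (auto simp: numeral_2_eq_2)

lemma rec_fn_Suc: "rec_fn k G \<Longrightarrow> rec_fn k (\<lambda>xs. Suc (G xs))"
proof (rule rec_fn_comp1[of "Suc"])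
  show "rec_fn 1 (\<lambda>xs. Suc (xs ! 0))" unfolding rec_fn_def
    by (rule exI[of _ Succ]) (auto simp: length_Suc_conv)
qed

lemma rec_fn_const: "rec_fn k (\<lambda>_. c)"
  by (induction c) (auto intro: rec_fn_zero rec_fn_Suc)

lemma rec_fn_primrec:
  assumes F: "rec_fn k F" and G: "rec_fn (Suc (Suc k)) G"
  shows "rec_fn (Suc k) (\<lambda>xs. rec_nat (F (tl xs)) (\<lambda>m r. G (m # r # tl xs)) (hd xs))"
proof -
  obtain p where p: "\<And>xs. length xs = k \<Longrightarrow> eval_recf p xs = Some (F xs)"
    using F unfolding rec_fn_def by auto
  obtain q where q: "\<And>xs. length xs = Suc (Suc k) \<Longrightarrow> eval_recf q xs = Some (G xs)"
    using G unfolding rec_fn_def by auto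
  have *: "rec_nat (eval_recf p ys)
      (\<lambda>m r. case r of None \<Rightarrow> None | Some y \<Rightarrow> eval_recf q (m # y # ys)) n =
      Some (rec_nat (F ys) (\<lambda>m r. G (m # r # ys)) n)" if "length ys = k" for ys n
    using that by (induction n) (simp_all add: p q)
  have "eval_recf (PrimRec p q) xs =
      Some (rec_nat (F (tl xs)) (\<lambda>m r. G (m # r # tl xs)) (hd xs))" if "length xs = Suc k" for xs
    using that * by (cases xs) auto
  then show ?thesis unfolding rec_fn_def by blast
qed

text \<open>\<open>PrimRec\<close> recurses on the head of its argument list. Composition with
  \<open>N\<close> followed by all projections makes that head an arbitrary function of the
  arguments and passes the arguments on as parameters.\<close>

lemma rec_fn_rec_nat:
  assumes N: "rec_fn k N" and F: "rec_fn k F"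
    and G: "rec_fn (Suc (Suc k)) (\<lambda>xs. G (xs ! 0) (xs ! 1) (tl (tl xs)))"
  shows "rec_fn k (\<lambda>xs. rec_nat (F xs) (\<lambda>m r. G m r xs) (N xs))"
proof -
  let ?Gs = "N # map (\<lambda>i xs. xs ! i) [0..<k]"
  have Gs: "map (\<lambda>G. G xs) ?Gs = N xs # xs" if "length xs = k" for xs
    using that by (auto simp: comp_def intro!: map_nth)
  have "rec_fn k (\<lambda>xs. (\<lambda>xs. rec_nat (F (tl xs)) (\<lambda>m r. G ((m # r # tl xs) ! 0)
      ((m # r # tl xs) ! 1) (tl (tl (m # r # tl xs)))) (hd xs)) (map (\<lambda>G. G xs) ?Gs))"
    by (rule rec_fn_comp) (use rec_fn_primrec[OF F G] N in \<open>auto intro: rec_fn_proj\<close>)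
  then show ?thesis by (rule rec_fn_cong) (simp add: Gs del: list.map map_map)
qed

text \<open>Minimisation serves to invert the Cantor pairing; every other loop is a primitive
  recursion.\<close>

lemma rec_fn_least:
  assumes F: "rec_fn (Suc k) F" and ex: "\<And>xs. length xs = k \<Longrightarrow> \<exists>n. F (n # xs) = 0"
  shows "rec_fn k (\<lambda>xs. LEAST n. F (n # xs) = 0)"
proof -
  obtain p where p: "\<And>xs. length xs = Suc k \<Longrightarrow> eval_recf p xs = Some (F xs)"
    using F unfolding rec_fn_def by auto
  have "eval_recf (Mu p) xs = Some (LEAST n. F (n # xs) = 0)" if "length xs = k" for xs
    using ex[OF that] that by (auto simp: p)
  then show ?thesis unfolding rec_fn_def by blast
qed

section \<open>Recursive arithmetic and the Cantor pairing\<close>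

lemma rec_fn_add: "rec_fn k F \<Longrightarrow> rec_fn k G \<Longrightarrow> rec_fn k (\<lambda>xs. F xs + G xs)"
proof (rule rec_fn_comp2[of "(+)"])
  have "rec_fn 2 (\<lambda>xs. rec_nat (xs ! 0) (\<lambda>m r. Suc r) (xs ! 1))"
    by (rule rec_fn_rec_nat) (auto intro!: rec_fn_proj rec_fn_Suc)
  moreover have "rec_nat a (\<lambda>m r. Suc r) b = a + b" for a b by (induction b) auto
  ultimately show "rec_fn 2 (\<lambda>xs. xs ! 0 + xs ! 1)" by simp
qed

lemma rec_fn_pred: "rec_fn k F \<Longrightarrow> rec_fn k (\<lambda>xs. F xs - 1)"
proof (rule rec_fn_comp1[of "\<lambda>x. x - 1"])
  have "rec_fn 1 (\<lambda>xs. rec_nat 0 (\<lambda>m r. m) (xs ! 0))"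
    by (rule rec_fn_rec_nat) (auto intro!: rec_fn_proj rec_fn_zero)
  moreover have "rec_nat 0 (\<lambda>m r. m) b = b - 1" for b by (cases b) auto
  ultimately show "rec_fn 1 (\<lambda>xs. xs ! 0 - 1)" by simp
qed

lemma rec_fn_diff: "rec_fn k F \<Longrightarrow> rec_fn k G \<Longrightarrow> rec_fn k (\<lambda>xs. F xs - G xs)"
proof (rule rec_fn_comp2[of "(-)"])
  have "rec_fn 2 (\<lambda>xs. rec_nat (xs ! 0) (\<lambda>m r. r - 1) (xs ! 1))"
    by (rule rec_fn_rec_nat) (auto intro!: rec_fn_proj rec_fn_pred simp del: One_nat_def)
  moreover have "rec_nat a (\<lambda>m r. r - 1) b = a - b" for a b by (induction b) auto
  ultimately show "rec_fn 2 (\<lambda>xs. xs ! 0 - xs ! 1)" by simp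
qed

lemma rec_fn_mult: "rec_fn k F \<Longrightarrow> rec_fn k G \<Longrightarrow> rec_fn k (\<lambda>xs. F xs * G xs)"
proof (rule rec_fn_comp2[of "(*)"])
  have "rec_fn 2 (\<lambda>xs. rec_nat 0 (\<lambda>m r. r + xs ! 0) (xs ! 1))"
  proof (rule rec_fn_rec_nat)
    have "rec_fn (Suc (Suc 2)) (\<lambda>xs. xs ! 1 + xs ! 2)"
      by (intro rec_fn_add rec_fn_proj) auto
    then show "rec_fn (Suc (Suc 2)) (\<lambda>xs. xs ! 1 + tl (tl xs) ! 0)"
      by (rule rec_fn_cong) (auto simp: length_Suc_conv numeral_2_eq_2)
  qed (auto intro!: rec_fn_proj rec_fn_zero)
  moreover have "rec_nat 0 (\<lambda>m r. r + a) b = a * b" for a b :: nat by (induction b) auto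
  ultimately show "rec_fn 2 (\<lambda>xs. xs ! 0 * xs ! 1)" by simp
qed

lemma rec_fn_triangle: "rec_fn k F \<Longrightarrow> rec_fn k (\<lambda>xs. triangle (F xs))"
proof (rule rec_fn_comp1[of "triangle"])
  have "rec_fn 1 (\<lambda>xs. rec_nat 0 (\<lambda>m r. r + Suc m) (xs ! 0))"
    by (rule rec_fn_rec_nat) (auto intro!: rec_fn_proj rec_fn_zero rec_fn_add rec_fn_Suc
        simp del: add_Suc_right)
  moreover have "rec_nat 0 (\<lambda>m r. r + Suc m) b = triangle b" for b by (induction b) auto
  ultimately show "rec_fn 1 (\<lambda>xs. triangle (xs ! 0))" by simp
qed

lemma rec_fn_prod_encode:
  "rec_fn k F \<Longrightarrow> rec_fn k G \<Longrightarrow> rec_fn k (\<lambda>xs. prod_encode (F xs, G xs))"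
  unfolding prod_encode_def by (auto intro!: rec_fn_add rec_fn_triangle)

text \<open>The index of the diagonal of the Cantor pairing on which \<open>n\<close> lies.\<close>

definition diag_sum :: "nat \<Rightarrow> nat" where
  "diag_sum n = fst (prod_decode n) + snd (prod_decode n)"

text \<open>Truncated subtraction turns \<open>n < triangle (Suc s)\<close> into a zero test, the
  form that \<open>Mu\<close> accepts. Diagonal \<open>s\<close> starts at
  \<open>triangle s\<close>, so the first \<open>s\<close> that passes is the diagonal of
  \<open>n\<close>.\<close>

lemma diag_sum_eq_Least: "diag_sum n = (LEAST s. Suc n - triangle (Suc s) = 0)"
proof -
  obtain a b where ab: "prod_decode n = (a, b)" by fastforce
  then have n: "n = triangle (a + b) + a"
    using prod_decode_inverse[of n] by (simp add: prod_encode_def)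
  have mono: "triangle i \<le> triangle j" if "i \<le> j" for i j
    using that by (induction j) (auto simp: le_Suc_eq)
  have "(LEAST s. Suc n - triangle (Suc s) = 0) = a + b"
  proof (rule Least_equality)
    show "Suc n - triangle (Suc (a + b)) = 0" using n by simp
    fix s assume "Suc n - triangle (Suc s) = 0"
    then show "a + b \<le> s" using n mono[of "Suc s" "a + b"] by (cases "a + b \<le> s") auto
  qed
  then show ?thesis using ab by (simp add: diag_sum_def)
qed

lemma rec_fn_diag_sum: "rec_fn k F \<Longrightarrow> rec_fn k (\<lambda>xs. diag_sum (F xs))"
proof (rule rec_fn_comp1[of "diag_sum"])
  have "rec_fn 1 (\<lambda>xs. LEAST s. (\<lambda>xs. Suc (xs ! 1) - triangle (Suc (xs ! 0))) (s # xs) = 0)"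
  proof (rule rec_fn_least)
    show "rec_fn (Suc 1) (\<lambda>xs. Suc (xs ! 1) - triangle (Suc (xs ! 0)))"
      by (intro rec_fn_diff rec_fn_Suc rec_fn_triangle rec_fn_proj) auto
    have "n \<le> triangle n" for n by (induction n) auto
    then show "\<exists>n. Suc ((n # xs) ! 1) - triangle (Suc ((n # xs) ! 0)) = 0" for xs :: "nat list"
      by (intro exI[of _ "xs ! 0"]) (simp add: le_SucI trans_le_add1)
  qed
  then show "rec_fn 1 (\<lambda>xs. diag_sum (xs ! 0))" by (simp add: diag_sum_eq_Least)
qed

lemma fst_prod_decode: "fst (prod_decode n) = n - triangle (diag_sum n)"
proof -
  obtain a b where ab: "prod_decode n = (a, b)" by fastforce
  then have "n = triangle (a + b) + a"
    using prod_decode_inverse[of n] by (simp add: prod_encode_def)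
  then show ?thesis using ab by (simp add: diag_sum_def)
qed

lemma snd_prod_decode: "snd (prod_decode n) = diag_sum n - fst (prod_decode n)"
  by (simp add: diag_sum_def)

lemma rec_fn_fst: "rec_fn k F \<Longrightarrow> rec_fn k (\<lambda>xs. fst (prod_decode (F xs)))"
  unfolding fst_prod_decode by (intro rec_fn_diff rec_fn_triangle rec_fn_diag_sum)

lemma rec_fn_snd: "rec_fn k F \<Longrightarrow> rec_fn k (\<lambda>xs. snd (prod_decode (F xs)))"
  unfolding snd_prod_decode by (intro rec_fn_diff rec_fn_diag_sum rec_fn_fst)

text \<open>Neither decoding nor injectivity is required: a program only has to agree with a
  function on codes. The pair and list instances use \<open>prod_encode\<close> and
  \<open>list_encode\<close>, so the codes of the problem instances are values of
  \<open>enc\<close>.\<close>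

class enc =
  fixes enc :: "'a \<Rightarrow> nat"

instantiation nat :: enc
begin
definition "enc_nat = (\<lambda>n::nat. n)"
instance ..
end

instantiation bool :: enc
begin
definition "enc_bool b = (if b then 1 else 0 :: nat)"
instance ..
end

instantiation prod :: (enc, enc) enc
begin
definition "enc_prod = (\<lambda>(a, b). prod_encode (enc a, enc b))"
instance ..
end

instantiation list :: (enc) enc
begin
definition "enc_list xs = list_encode (map enc xs)"
instance ..
end

lemma enc_nat [simp]: "enc (n::nat) = n" by (simp add: enc_nat_def)
lemma enc_pair [simp]: "enc (a, b) = prod_encode (enc a, enc b)" by (simp add: enc_prod_def)
lemma enc_Nil [simp]: "enc [] = 0" by (simp add: enc_list_def)
lemma enc_Cons [simp]: "enc (x # xs) = Suc (prod_encode (enc x, enc xs))"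
  by (simp add: enc_list_def)
lemma enc_bool [simp]: "enc True = 1" "enc False = 0" by (auto simp: enc_bool_def)
lemma fst_prod_decode_enc [simp]: "fst (prod_decode (enc p)) = enc (fst p)" by (cases p) simp
lemma snd_prod_decode_enc [simp]: "snd (prod_decode (enc p)) = enc (snd p)" by (cases p) simp

text \<open>The witness is total on all numbers, not only on codes: a primitive recursion runs its step
  function also on numbers that do not encode anything.\<close>

definition computable :: "('a::enc \<Rightarrow> 'b::enc) \<Rightarrow> bool" where
  "computable f \<longleftrightarrow> (\<exists>F. rec_fn 1 (\<lambda>xs. F (xs ! 0)) \<and> (\<forall>a. F (enc a) = enc (f a)))"

lemma computableI: "rec_fn 1 (\<lambda>xs. F (xs ! 0)) \<Longrightarrow> (\<And>a. F (enc a) = enc (f a)) \<Longrightarrow> computable f"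
  unfolding computable_def by blast

lemma computableD:
  "computable f \<Longrightarrow> \<exists>F. (\<forall>k G. rec_fn k G \<longrightarrow> rec_fn k (\<lambda>xs. F (G xs))) \<and> (\<forall>a. F (enc a) = enc (f a))"
  unfolding computable_def using rec_fn_comp1 by blast

named_theorems comp_intros

lemma computable_id [comp_intros]: "computable (\<lambda>x. x)"
  by (rule computableI[of "\<lambda>x. x"]) (auto intro: rec_fn_proj)

lemma computable_const [comp_intros]: "computable (\<lambda>x. c)"
  by (rule computableI[of "\<lambda>_. enc c"]) (auto intro: rec_fn_const)

lemma computable_comp:
  assumes "computable f" "computable g"
  shows "computable (\<lambda>x. f (g x))"
proof -
  obtain F where F: "\<And>k G. rec_fn k G \<Longrightarrow> rec_fn k (\<lambda>xs. F (G xs))" "\<And>a. F (enc a) = enc (f a)"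
    using computableD[OF assms(1)] by blast
  obtain G where G: "\<And>k H. rec_fn k H \<Longrightarrow> rec_fn k (\<lambda>xs. G (H xs))" "\<And>a. G (enc a) = enc (g a)"
    using computableD[OF assms(2)] by blast
  show ?thesis
    by (rule computableI[of "\<lambda>n. F (G n)"]) (auto simp: F(2) G(2) intro!: F G rec_fn_proj)
qed

lemma computable_pair [comp_intros]:
  assumes "computable f" "computable g"
  shows "computable (\<lambda>x. (f x, g x))"
proof -
  obtain F where F: "\<And>k G. rec_fn k G \<Longrightarrow> rec_fn k (\<lambda>xs. F (G xs))" "\<And>a. F (enc a) = enc (f a)"
    using computableD[OF assms(1)] by blast
  obtain G where G: "\<And>k H. rec_fn k H \<Longrightarrow> rec_fn k (\<lambda>xs. G (H xs))" "\<And>a. G (enc a) = enc (g a)"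
    using computableD[OF assms(2)] by blast
  show ?thesis
    by (rule computableI[of "\<lambda>n. prod_encode (F n, G n)"])
      (auto simp: F(2) G(2) intro!: F G rec_fn_proj rec_fn_prod_encode)
qed

lemma computable_fst [comp_intros]: "computable f \<Longrightarrow> computable (\<lambda>x. fst (f x))"
proof (rule computable_comp[of fst])
  show "computable fst"
    by (rule computableI[of "\<lambda>n. fst (prod_decode n)"]) (auto intro!: rec_fn_fst rec_fn_proj)
qed

lemma computable_snd [comp_intros]: "computable f \<Longrightarrow> computable (\<lambda>x. snd (f x))"
proof (rule computable_comp[of snd])
  show "computable snd"
    by (rule computableI[of "\<lambda>n. snd (prod_decode n)"]) (auto intro!: rec_fn_snd rec_fn_proj)
qed

lemma computable_comp2:
  assumes "computable (\<lambda>z. f (fst z) (snd z))" "computable g" "computable h"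
  shows "computable (\<lambda>x. f (g x) (h x))"
  using computable_comp[OF assms(1) computable_pair[OF assms(2,3)]] by simp

lemma computable_Suc [comp_intros]: "computable f \<Longrightarrow> computable (\<lambda>x. Suc (f x))"
  by (rule computable_comp, rule computableI[of Suc]) (auto intro!: rec_fn_Suc rec_fn_proj)

lemma computable_nat2:
  assumes "\<And>k F G. rec_fn k F \<Longrightarrow> rec_fn k G \<Longrightarrow> rec_fn k (\<lambda>xs. op (F xs) (G xs))"
  shows "computable f \<Longrightarrow> computable g \<Longrightarrow> computable (\<lambda>x. (op (f x) (g x) :: nat))"
  by (rule computable_comp2,
      rule computableI[of "\<lambda>n. op (fst (prod_decode n)) (snd (prod_decode n))"])
    (auto intro!: assms rec_fn_fst rec_fn_snd rec_fn_proj simp: enc_prod_def split: prod.splits)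

lemma computable_add [comp_intros]:
  "computable f \<Longrightarrow> computable g \<Longrightarrow> computable (\<lambda>x. f x + g x :: nat)"
  by (rule computable_nat2[of "(+)"]) (rule rec_fn_add)

lemma computable_diff [comp_intros]:
  "computable f \<Longrightarrow> computable g \<Longrightarrow> computable (\<lambda>x. f x - g x :: nat)"
  by (rule computable_nat2[of "(-)"]) (rule rec_fn_diff)

lemma computable_mult [comp_intros]:
  "computable f \<Longrightarrow> computable g \<Longrightarrow> computable (\<lambda>x. f x * g x :: nat)"
  by (rule computable_nat2[of "(*)"]) (rule rec_fn_mult)


lemma computable_rec_nat [comp_intros]:
  assumes N: "computable n" and Z: "computable z"
    and S: "computable (\<lambda>t. s (fst t) (fst (snd t)) (snd (snd t)))"
  shows "computable (\<lambda>x. rec_nat (z x) (s x) (n x))"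
proof -
  obtain N' where N: "\<And>k G. rec_fn k G \<Longrightarrow> rec_fn k (\<lambda>xs. N' (G xs))" "\<And>a. N' (enc a) = enc (n a)"
    using computableD[OF N] by blast
  obtain Z' where Z: "\<And>k G. rec_fn k G \<Longrightarrow> rec_fn k (\<lambda>xs. Z' (G xs))" "\<And>a. Z' (enc a) = enc (z a)"
    using computableD[OF Z] by blast
  obtain S' where S: "\<And>k G. rec_fn k G \<Longrightarrow> rec_fn k (\<lambda>xs. S' (G xs))"
    "\<And>a. S' (enc a) = enc (s (fst a) (fst (snd a)) (snd (snd a)))"
    using computableD[OF S] by blast
  let ?F = "\<lambda>x. rec_nat (Z' x) (\<lambda>m r. S' (prod_encode (x, prod_encode (m, r)))) (N' x)"
  show ?thesis
  proof (rule computableI[of ?F])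
    show "rec_fn 1 (\<lambda>xs. ?F (xs ! 0))"
    proof (rule rec_fn_rec_nat)
      have "rec_fn (Suc (Suc 1)) (\<lambda>xs. S' (prod_encode (xs ! 2, prod_encode (xs ! 0, xs ! 1))))"
        by (intro S rec_fn_prod_encode rec_fn_proj) auto
      then show "rec_fn (Suc (Suc 1))
          (\<lambda>xs. S' (prod_encode (tl (tl xs) ! 0, prod_encode (xs ! 0, xs ! 1))))"
        by (rule rec_fn_cong) (auto simp: length_Suc_conv numeral_2_eq_2)
    qed (auto intro!: N Z rec_fn_proj)
    have "rec_nat (enc (z a)) (\<lambda>m r. S' (prod_encode (enc a, prod_encode (m, r)))) k =
        enc (rec_nat (z a) (s a) k)" for a k
      by (induction k) (use S(2)[of "(a, _, _)"] in auto)
    then show "?F (enc a) = enc (rec_nat (z a) (s a) (n a))" for a by (simp add: N Z)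
  qed
qed

text \<open>Both branches are evaluated, which is harmless since the witnesses are total; the code 0
  or 1 of the test selects one of them.\<close>

lemma computable_If [comp_intros]:
  assumes B: "computable b" and T: "computable t" and E: "computable e"
  shows "computable (\<lambda>x. if b x then t x else e x)"
proof -
  obtain B' where B: "\<And>k G. rec_fn k G \<Longrightarrow> rec_fn k (\<lambda>xs. B' (G xs))" "\<And>a. B' (enc a) = enc (b a)"
    using computableD[OF B] by blast
  obtain T' where T: "\<And>k G. rec_fn k G \<Longrightarrow> rec_fn k (\<lambda>xs. T' (G xs))" "\<And>a. T' (enc a) = enc (t a)"
    using computableD[OF T] by blast
  obtain E' where E: "\<And>k G. rec_fn k G \<Longrightarrow> rec_fn k (\<lambda>xs. E' (G xs))" "\<And>a. E' (enc a) = enc (e a)"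
    using computableD[OF E] by blast
  show ?thesis
    by (rule computableI[of "\<lambda>x. B' x * T' x + (1 - B' x) * E' x"])
      (auto intro!: rec_fn_add rec_fn_mult rec_fn_diff rec_fn_const B(1) T(1) E(1) rec_fn_proj
        simp: B(2) T(2) E(2) simp del: One_nat_def)
qed

lemma computable_case_list [comp_intros]:
  assumes L: "computable l" and Z: "computable z"
    and S: "computable (\<lambda>t. s (fst t) (fst (snd t)) (snd (snd t)))"
  shows "computable (\<lambda>x. case l x of [] \<Rightarrow> z x | y # ys \<Rightarrow> s x y ys)"
proof -
  obtain L' where L: "\<And>k G. rec_fn k G \<Longrightarrow> rec_fn k (\<lambda>xs. L' (G xs))" "\<And>a. L' (enc a) = enc (l a)"
    using computableD[OF L] by blast
  obtain Z' where Z: "\<And>k G. rec_fn k G \<Longrightarrow> rec_fn k (\<lambda>xs. Z' (G xs))" "\<And>a. Z' (enc a) = enc (z a)"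
    using computableD[OF Z] by blast
  obtain S' where S: "\<And>k G. rec_fn k G \<Longrightarrow> rec_fn k (\<lambda>xs. S' (G xs))"
    "\<And>a. S' (enc a) = enc (s (fst a) (fst (snd a)) (snd (snd a)))"
    using computableD[OF S] by blast
  \<comment> \<open>\<open>?c\<close> is 0 on the code of the empty list and 1 otherwise. The
    predecessor of a nonempty list's code is the code of the pair of its head and tail.\<close>
  let ?c = "\<lambda>x. 1 - (1 - L' x)"
  show ?thesis
  proof (rule computableI[of
        "\<lambda>x. ?c x * S' (prod_encode (x, L' x - 1)) + (1 - ?c x) * Z' x"])
    show "rec_fn 1 (\<lambda>xs. ?c (xs ! 0) * S' (prod_encode (xs ! 0, L' (xs ! 0) - 1)) +
        (1 - ?c (xs ! 0)) * Z' (xs ! 0))"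
      by (intro rec_fn_add rec_fn_mult rec_fn_diff rec_fn_const L(1) S(1) Z(1) rec_fn_proj
          rec_fn_prod_encode) auto
    show "?c (enc a) * S' (prod_encode (enc a, L' (enc a) - 1)) + (1 - ?c (enc a)) * Z' (enc a) =
        enc (case l a of [] \<Rightarrow> z a | y # ys \<Rightarrow> s a y ys)" for a
      using S(2)[of "(a, _, _)"] by (cases "l a") (auto simp: L(2) Z(2))
  qed
qed

lemma computable_Cons [comp_intros]:
  assumes F: "computable f" and G: "computable g"
  shows "computable (\<lambda>x. f x # g x)"
proof -
  obtain F' where F: "\<And>k G. rec_fn k G \<Longrightarrow> rec_fn k (\<lambda>xs. F' (G xs))" "\<And>a. F' (enc a) = enc (f a)"
    using computableD[OF F] by blast
  obtain G' where G: "\<And>k G. rec_fn k G \<Longrightarrow> rec_fn k (\<lambda>xs. G' (G xs))" "\<And>a. G' (enc a) = enc (g a)"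
    using computableD[OF G] by blast
  show ?thesis
    by (rule computableI[of "\<lambda>x. Suc (prod_encode (F' x, G' x))"])
      (auto intro!: rec_fn_Suc rec_fn_prod_encode F(1) G(1) rec_fn_proj simp: F(2) G(2))
qed

text \<open>This makes the code of a list a valid loop count for a fold, before any length function
  is available.\<close>

lemma length_le_enc: "length xs \<le> enc xs"
proof (induction xs)
  case (Cons x xs)
  then show ?case using le_prod_encode_2[of "enc xs" "enc x"] by auto
qed simp

text \<open>The state of the recursion is the accumulator with the unread rest of the list. The loop
  runs \<open>enc (l x)\<close> times, and the surplus rounds change nothing because the rest is
  empty by then.\<close>

lemma computable_foldl [comp_intros]:
  assumes L: "computable l" and Z: "computable z"
    and S: "computable (\<lambda>t. s (fst t) (fst (snd t)) (snd (snd t)))"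
  shows "computable (\<lambda>x. foldl (s x) (z x) (l x))"
proof -
  define step where
    "step x r = (case snd r of [] \<Rightarrow> r | y # ys \<Rightarrow> (s x (fst r) y, ys))" for x and r
  have len: "computable (\<lambda>x. enc (l x))"
  proof -
    obtain L' where L: "\<And>k G. rec_fn k G \<Longrightarrow> rec_fn k (\<lambda>xs. L' (G xs))" "\<And>a. L' (enc a) = enc (l a)"
      using computableD[OF L] by blast
    show ?thesis by (rule computableI[of L']) (auto intro!: L(1) rec_fn_proj simp: L(2))
  qed
  have "computable (\<lambda>t::('a \<times> nat \<times> 'c \<times> 'b list) \<times> 'b \<times> 'b list.
      (fst (fst t), fst (snd (snd (fst t))), fst (snd t)))"
    by (intro comp_intros)
  from computable_comp[OF S this]
  have S': "computable (\<lambda>t::('a \<times> nat \<times> 'c \<times> 'b list) \<times> 'b \<times> 'b list.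
      s (fst (fst t)) (fst (snd (snd (fst t)))) (fst (snd t)))"
    by simp
  have "computable (\<lambda>x. fst (rec_nat (z x, l x) (\<lambda>_. step x) (enc (l x))))"
    unfolding step_def by (intro comp_intros L Z len S')
  moreover have "fst (rec_nat (a, ys) (\<lambda>_. step x) n) = foldl (s x) a ys"
    if "length ys \<le> n" for x a ys n
  proof -
    have "rec_nat (a, ys) (\<lambda>_. step x) n = (foldl (s x) a (take n ys), drop n ys)" for n
    proof (induction n)
      case (Suc n)
      then have *: "rec_nat (a, ys) (\<lambda>_. step x) (Suc n) =
          step x (foldl (s x) a (take n ys), drop n ys)"
        by simp
      show ?case
      proof (cases "n < length ys")
        case True
        then have "drop n ys = ys ! n # drop (Suc n) ys" by (simp add: Cons_nth_drop_Suc)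
        with True show ?thesis unfolding * by (simp add: step_def take_Suc_conv_app_nth)
      next
        case False
        then show ?thesis unfolding * by (simp add: step_def)
      qed
    qed simp
    then show ?thesis using that by simp
  qed
  ultimately show ?thesis by (simp add: length_le_enc)
qed


section \<open>Logical, arithmetical and list operations derived from the combinators\<close>

lemma computable_conj [comp_intros]:
  "computable f \<Longrightarrow> computable g \<Longrightarrow> computable (\<lambda>x. f x \<and> g x)"
  by (rule back_subst[of computable, OF computable_If[of f g "\<lambda>_. False"]])
    (auto intro: computable_const)

lemma computable_disj [comp_intros]:
  "computable f \<Longrightarrow> computable g \<Longrightarrow> computable (\<lambda>x. f x \<or> g x)"
  by (rule back_subst[of computable, OF computable_If[of f "\<lambda>_. True" g]])
    (auto intro: computable_const)

lemma computable_le [comp_intros]: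
  assumes "computable f" "computable g"
  shows "computable (\<lambda>x. f x \<le> (g x :: nat))"
proof -
  have "computable (\<lambda>n::nat. n = 0)"
    by (rule computableI[of "\<lambda>n. 1 - n"])
      (auto intro!: rec_fn_diff rec_fn_const rec_fn_proj simp: enc_bool_def simp del: One_nat_def)
  from computable_comp[OF this computable_diff[OF assms]] show ?thesis by simp
qed

lemma computable_eq [comp_intros]:
  "computable f \<Longrightarrow> computable g \<Longrightarrow> computable (\<lambda>x. f x = (g x :: nat))"
  using computable_conj[OF computable_le computable_le, of f g g f] by (simp add: eq_iff)

lemma computable_power [comp_intros]:
  assumes "computable f" "computable g"
  shows "computable (\<lambda>x. f x ^ g x :: nat)"
proof -
  have "computable (\<lambda>x. rec_nat 1 (\<lambda>_ r. f x * r) (g x))"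
    by (intro comp_intros assms computable_comp[OF assms(1)])
  moreover have "rec_nat 1 (\<lambda>_ r. a * r) n = a ^ n" for a n :: nat by (induction n) auto
  ultimately show ?thesis by simp
qed

lemma computable_fact [comp_intros]:
  assumes "computable f"
  shows "computable (\<lambda>x. fact (f x) :: nat)"
proof -
  have "computable (\<lambda>x. rec_nat 1 (\<lambda>n r. Suc n * r) (f x))"
    by (intro comp_intros assms)
  moreover have "rec_nat 1 (\<lambda>n r. Suc n * r) n = (fact n :: nat)" for n by (induction n) auto
  ultimately show ?thesis by simp
qed

lemma computable_rev [comp_intros]:
  assumes "computable f"
  shows "computable (\<lambda>x. rev (f x))"
proof -
  have "computable (\<lambda>x. foldl (\<lambda>a y. y # a) [] (f x))"
    by (intro comp_intros assms)
  moreover have "foldl (\<lambda>a y. y # a) ys zs = rev zs @ ys" for zs ys :: "'b list"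
    by (induction zs arbitrary: ys) auto
  ultimately show ?thesis by simp
qed

lemma computable_map [comp_intros]:
  assumes S: "computable (\<lambda>t. s (fst t) (snd t))" and L: "computable l"
  shows "computable (\<lambda>x. map (s x) (l x))"
proof -
  have "computable (\<lambda>x. rev (foldl (\<lambda>a y. s x y # a) [] (l x)))"
    using computable_comp[OF S, of "\<lambda>t. (fst t, snd (snd t))"]
    by (intro comp_intros L) (simp add: comp_intros)
  moreover have "foldl (\<lambda>a y. f y # a) ys zs = rev (map f zs) @ ys" for f :: "'b \<Rightarrow> 'c" and zs ys
    by (induction zs arbitrary: ys) auto
  ultimately show ?thesis by simp
qed

lemma computable_list_all [comp_intros]:
  assumes S: "computable (\<lambda>t. s (fst t) (snd t))" and L: "computable l"
  shows "computable (\<lambda>x. list_all (s x) (l x))"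
proof -
  have "computable (\<lambda>x. foldl (\<lambda>a y. a \<and> s x y) True (l x))"
    using computable_comp[OF S, of "\<lambda>t. (fst t, snd (snd t))"]
    by (intro comp_intros L) (simp add: comp_intros)
  moreover have "foldl (\<lambda>a y. a \<and> p y) b zs \<longleftrightarrow> b \<and> list_all p zs" for p :: "'b \<Rightarrow> bool" and zs b
    by (induction zs arbitrary: b) auto
  ultimately show ?thesis by simp
qed

lemma computable_zip [comp_intros]:
  assumes F: "computable f" and G: "computable g"
  shows "computable (\<lambda>x. zip (f x) (g x))"
proof -
  define step where "step a y = (case snd a of [] \<Rightarrow> a | z # zs \<Rightarrow> ((y, z) # fst a, zs))"
    for a :: "('b \<times> 'c) list \<times> 'c list" and y :: 'b
  have "computable (\<lambda>x. rev (fst (foldl step ([], g x) (f x))))"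
    unfolding step_def by (intro comp_intros F G)
  moreover have "fst (foldl step (a, zs) ys) = rev (zip ys zs) @ a" for a ys zs
  proof (induction ys arbitrary: a zs)
    case (Cons y ys)
    have "foldl step (a, []) ys = (a, [])" for ys a by (induction ys) (auto simp: step_def)
    then show ?case using Cons by (cases zs) (auto simp: step_def)
  qed simp
  ultimately show ?thesis by simp
qed

section \<open>Arithmetic on fractions\<close>

text \<open>\<open>int_encode\<close> keeps the sign in the parity. Half and parity are counted up
  together because no division is among the combinators.\<close>

definition half_parity :: "nat \<Rightarrow> nat \<times> bool" where
  "half_parity n = rec_nat (0, False)
     (\<lambda>_ s. if snd s then (Suc (fst s), False) else (fst s, True)) n"

lemma half_parity_eq: "half_parity n = (n div 2, odd n)"
  by (induction n) (auto simp: half_parity_def)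

definition diff_of_int_code :: "nat \<Rightarrow> nat \<times> nat" where
  "diff_of_int_code n =
     (if snd (half_parity n) then (0, Suc (fst (half_parity n))) else (fst (half_parity n), 0))"

lemma diff_of_int_code:
  "int (fst (diff_of_int_code (int_encode a))) - int (snd (diff_of_int_code (int_encode a))) = a"
  by (auto simp: diff_of_int_code_def half_parity_eq int_encode_def sum_encode_def)

lemma computable_diff_of_int_code [comp_intros]:
  "computable f \<Longrightarrow> computable (\<lambda>x. diff_of_int_code (f x))"
  unfolding diff_of_int_code_def half_parity_def by (intro comp_intros)

text \<open>The triple \<open>((p, q), b)\<close> stands for the rational number \<open>(p - q) / b\<close>; working with differences
  of natural numbers and without cancelling keeps the arithmetic polynomial in natural numbers.\<close>

type_synonym frac = "(nat \<times> nat) \<times> nat"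

definition frac_val :: "frac \<Rightarrow> rat" where
  "frac_val x = (of_nat (fst (fst x)) - of_nat (snd (fst x))) / of_nat (snd x)"

definition frac_rep :: "frac \<Rightarrow> rat \<Rightarrow> bool" where
  "frac_rep x r \<longleftrightarrow> snd x > 0 \<and> frac_val x = r"

definition frac_of_code :: "nat \<times> nat \<Rightarrow> frac" where
  "frac_of_code c = (diff_of_int_code (fst c), snd c)"

definition frac_add :: "frac \<Rightarrow> frac \<Rightarrow> frac" where
  "frac_add x y = ((fst (fst x) * snd y + fst (fst y) * snd x,
     snd (fst x) * snd y + snd (fst y) * snd x), snd x * snd y)"

definition frac_mult :: "frac \<Rightarrow> frac \<Rightarrow> frac" where
  "frac_mult x y = ((fst (fst x) * fst (fst y) + snd (fst x) * snd (fst y),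
     fst (fst x) * snd (fst y) + snd (fst x) * fst (fst y)), snd x * snd y)"

text \<open>Cross multiplication, with the negative terms moved to the other side.\<close>

definition frac_eq :: "frac \<Rightarrow> frac \<Rightarrow> bool" where
  "frac_eq x y \<longleftrightarrow> fst (fst x) * snd y + snd (fst y) * snd x = fst (fst y) * snd x + snd (fst x) * snd y"

definition code_of_rat :: "rat \<Rightarrow> nat \<times> nat" where
  "code_of_rat q = (int_encode (fst (quotient_of q)), nat (snd (quotient_of q)))"

lemma frac_rep_of_code: "frac_rep (frac_of_code (code_of_rat q)) q"
proof -
  obtain a b where q: "quotient_of q = (a, b)" by fastforce
  have "b > 0" using quotient_of_denom_pos[OF q] .
  moreover have "of_int a / of_int b = q" using quotient_of_div[OF q] by simp
  moreover have "of_nat (fst (diff_of_int_code (int_encode a))) -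
      of_nat (snd (diff_of_int_code (int_encode a))) = (of_int a :: rat)"
    using arg_cong[OF diff_of_int_code[of a], of "of_int :: int \<Rightarrow> rat"] by simp
  ultimately show ?thesis
    by (simp add: frac_rep_def frac_val_def frac_of_code_def code_of_rat_def q)
qed

lemma frac_rep_zero: "frac_rep ((0, 0), 1) 0"
  by (simp add: frac_rep_def frac_val_def)

lemma frac_rep_add: "frac_rep x r \<Longrightarrow> frac_rep y s \<Longrightarrow> frac_rep (frac_add x y) (r + s)"
  by (auto simp: frac_rep_def frac_val_def frac_add_def field_simps)

lemma frac_rep_mult: "frac_rep x r \<Longrightarrow> frac_rep y s \<Longrightarrow> frac_rep (frac_mult x y) (r * s)"
  by (auto simp: frac_rep_def frac_val_def frac_mult_def field_simps)

lemma frac_eq_iff: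
  assumes "frac_rep x r" "frac_rep y s"
  shows "frac_eq x y \<longleftrightarrow> r = s"
proof -
  have "frac_eq x y \<longleftrightarrow> (of_nat (fst (fst x) * snd y + snd (fst y) * snd x) :: rat) =
      of_nat (fst (fst y) * snd x + snd (fst x) * snd y)"
    unfolding frac_eq_def of_nat_eq_iff ..
  also have "\<dots> \<longleftrightarrow> r = s"
    using assms by (auto simp: frac_rep_def frac_val_def field_simps)
  finally show ?thesis .
qed

definition frac_dot :: "frac list \<Rightarrow> frac list \<Rightarrow> frac" where
  "frac_dot xs ys = foldl (\<lambda>a z. frac_add a (frac_mult (fst z) (snd z))) ((0, 0), 1) (zip xs ys)"

definition frac_mat_vec :: "frac list list \<Rightarrow> frac list \<Rightarrow> frac list" where
  "frac_mat_vec A v = map (\<lambda>row. frac_dot row v) A"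

text \<open>All 2 by 2 minors vanish. For nonzero \<open>u\<close> this is membership in the line
  through \<open>u\<close>, tested without division and without looking for a pivot.\<close>

definition frac_parallel :: "frac list \<Rightarrow> frac list \<Rightarrow> bool" where
  "frac_parallel v u \<longleftrightarrow> list_all (\<lambda>a. list_all (\<lambda>b.
     frac_eq (frac_mult (fst a) (snd b)) (frac_mult (fst b) (snd a))) (zip v u)) (zip v u)"

text \<open>Only the first vector is inspected: admissible subspaces have at most one basis
  vector.\<close>

definition frac_in_span :: "frac list \<Rightarrow> frac list list \<Rightarrow> bool" where
  "frac_in_span v us \<longleftrightarrow> (case us of [] \<Rightarrow> list_all (\<lambda>a. frac_eq a ((0, 0), 1)) v
     | u # _ \<Rightarrow> frac_parallel v u)"

definition orbit_search :: "nat \<Rightarrow> frac list list \<Rightarrow> frac list \<Rightarrow> frac list list \<Rightarrow> bool" where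
  "orbit_search N A x us = snd (rec_nat (x, frac_in_span x us)
     (\<lambda>_ s. (frac_mat_vec A (fst s), snd s \<or> frac_in_span (frac_mat_vec A (fst s)) us)) N)"

lemma orbit_search_iff:
  "orbit_search N A x us \<longleftrightarrow> (\<exists>n\<le>N. frac_in_span ((frac_mat_vec A ^^ n) x) us)"
proof -
  have "rec_nat (x, frac_in_span x us)
     (\<lambda>_ s. (frac_mat_vec A (fst s), snd s \<or> frac_in_span (frac_mat_vec A (fst s)) us)) N =
     ((frac_mat_vec A ^^ N) x, \<exists>n\<le>N. frac_in_span ((frac_mat_vec A ^^ n) x) us)"
    by (induction N) (auto simp: le_Suc_eq)
  then show ?thesis by (simp add: orbit_search_def)
qed

lemma computable_frac_of_code [comp_intros]:
  "computable f \<Longrightarrow> computable (\<lambda>x. frac_of_code (f x))"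
  unfolding frac_of_code_def by (intro comp_intros)

lemma computable_frac_mult [comp_intros]:
  "computable f \<Longrightarrow> computable g \<Longrightarrow> computable (\<lambda>x. frac_mult (f x) (g x))"
  unfolding frac_mult_def by (intro comp_intros)

lemma computable_frac_add [comp_intros]:
  "computable f \<Longrightarrow> computable g \<Longrightarrow> computable (\<lambda>x. frac_add (f x) (g x))"
  unfolding frac_add_def by (intro comp_intros)

lemma computable_frac_eq [comp_intros]:
  "computable f \<Longrightarrow> computable g \<Longrightarrow> computable (\<lambda>x. frac_eq (f x) (g x))"
  unfolding frac_eq_def by (intro comp_intros)

lemma computable_frac_mat_vec [comp_intros]:
  "computable f \<Longrightarrow> computable g \<Longrightarrow> computable (\<lambda>x. frac_mat_vec (f x) (g x))"
proof (rule computable_comp2[of frac_mat_vec])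
  show "computable (\<lambda>z. frac_mat_vec (fst z) (snd z))"
    unfolding frac_mat_vec_def frac_dot_def by (intro comp_intros)
qed

lemma computable_frac_in_span [comp_intros]:
  "computable f \<Longrightarrow> computable g \<Longrightarrow> computable (\<lambda>x. frac_in_span (f x) (g x))"
proof (rule computable_comp2[of frac_in_span])
  show "computable (\<lambda>z. frac_in_span (fst z) (snd z))"
    unfolding frac_in_span_def frac_parallel_def by (intro comp_intros)
qed

lemma computable_orbit_search [comp_intros]:
  assumes "computable N" "computable A" "computable v" "computable us"
  shows "computable (\<lambda>x. orbit_search (N x) (A x) (v x) (us x))"
proof -
  have "computable (\<lambda>t. orbit_search (fst t) (fst (snd t)) (fst (snd (snd t))) (snd (snd (snd t))))"
    unfolding orbit_search_def by (intro comp_intros)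
  from computable_comp[OF this, of "\<lambda>x. (N x, A x, v x, us x)"] assms
  show ?thesis by (simp add: comp_intros)
qed

abbreviation frac_vec_rep :: "frac list \<Rightarrow> rat vec \<Rightarrow> bool" where
  "frac_vec_rep xs v \<equiv> list_all2 frac_rep xs (list_of_vec v)"

lemma frac_dot_rep:
  assumes "frac_vec_rep xs v" "frac_vec_rep ys w" "dim_vec v = dim_vec w"
  shows "frac_rep (frac_dot xs ys) (v \<bullet> w)"
proof -
  have "frac_rep (foldl (\<lambda>a z. frac_add a (frac_mult (fst z) (snd z))) a (zip xs ys))
      (s + sum_list (map2 (*) vs ws))"
    if "list_all2 frac_rep xs vs" "list_all2 frac_rep ys ws" "frac_rep a s" for a s vs ws xs ys
    using that
  proof (induction xs vs arbitrary: a s ys ws rule: list_all2_induct)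
    case (Cons x xs v vs)
    show ?case
    proof (cases ys)
      case (Cons y ys')
      then obtain w ws' where w: "ws = w # ws'" "frac_rep y w" "list_all2 frac_rep ys' ws'"
        using Cons.prems(1) by (auto simp: list_all2_Cons1)
      have "frac_rep (foldl (\<lambda>a z. frac_add a (frac_mult (fst z) (snd z)))
          (frac_add a (frac_mult x y)) (zip xs ys')) (s + v * w + sum_list (map2 (*) vs ws'))"
        using Cons.IH Cons.hyps Cons.prems w by (intro Cons.IH frac_rep_add frac_rep_mult) auto
      then show ?thesis by (simp add: Cons w add.assoc)
    qed (use Cons.prems in auto)
  qed simp
  from this[OF assms(1,2) frac_rep_zero]
  have "frac_rep (frac_dot xs ys) (sum_list (map2 (*) (list_of_vec v) (list_of_vec w)))"
    by (simp add: frac_dot_def)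
  also have "sum_list (map2 (*) (list_of_vec v) (list_of_vec w)) = v \<bullet> w"
    using assms(3) by (simp add: scalar_prod_def sum_list_sum_nth atLeast0LessThan list_of_vec_index)
  finally show ?thesis .
qed

lemma frac_mat_vec_rep:
  assumes A: "A \<in> carrier_mat d d" and v: "v \<in> carrier_vec d"
    and As: "list_all2 (list_all2 frac_rep) As (mat_to_list A)" and xs: "frac_vec_rep xs v"
  shows "frac_vec_rep (frac_mat_vec As xs) (A *\<^sub>v v)"
proof (rule list_all2_all_nthI)
  show len: "length (frac_mat_vec As xs) = length (list_of_vec (A *\<^sub>v v))"
    using list_all2_lengthD[OF As] A by (simp add: frac_mat_vec_def mat_to_list_def)
  fix i assume i: "i < length (frac_mat_vec As xs)"
  then have id: "i < d" using len A by simp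
  have "mat_to_list A ! i = list_of_vec (row A i)"
    using A id by (auto simp: mat_to_list_def list_eq_iff_nth_eq list_of_vec_index)
  then have "frac_vec_rep (As ! i) (row A i)"
    using list_all2_nthD[OF As, of i] i by (simp add: frac_mat_vec_def)
  then have "frac_rep (frac_dot (As ! i) xs) (row A i \<bullet> v)"
    using frac_dot_rep xs A v by simp
  then show "frac_rep (frac_mat_vec As xs ! i) (list_of_vec (A *\<^sub>v v) ! i)"
    using i id A by (simp add: frac_mat_vec_def list_of_vec_index)
qed

text \<open>\<open>pow_mat\<close> appends the new factor on the right, whereas the orbit applies it
  on the left; \<open>A\<close> commutes with its powers.\<close>

lemma pow_mat_Suc_mult_vec:
  assumes A: "A \<in> carrier_mat d d" and v: "v \<in> carrier_vec d"
  shows "(A ^\<^sub>m Suc n) *\<^sub>v v = A *\<^sub>v ((A ^\<^sub>m n) *\<^sub>v (v :: 'a :: comm_semiring_1 vec))"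
proof -
  have "A ^\<^sub>m n * A = A * A ^\<^sub>m n"
  proof (induction n)
    case (Suc n)
    then show ?case using assoc_mult_mat[OF A pow_carrier_mat[OF A] A] by simp
  qed (use A in simp)
  then show ?thesis using A v by (simp add: assoc_mult_mat_vec[of _ d d _ d])
qed

lemma frac_mat_vec_funpow_rep:
  assumes A: "A \<in> carrier_mat d d" and v: "v \<in> carrier_vec d"
    and As: "list_all2 (list_all2 frac_rep) As (mat_to_list A)" and xs: "frac_vec_rep xs v"
  shows "frac_vec_rep ((frac_mat_vec As ^^ n) xs) ((A ^\<^sub>m n) *\<^sub>v v)"
proof (induction n)
  case 0
  then show ?case using A v xs by simp
next
  case (Suc n)
  have "(A ^\<^sub>m Suc n) *\<^sub>v v = A *\<^sub>v ((A ^\<^sub>m n) *\<^sub>v v)"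
    using A v by (rule pow_mat_Suc_mult_vec)
  then show ?case
    using frac_mat_vec_rep[OF A mult_mat_vec_carrier[OF pow_carrier_mat[OF A] v] As Suc]
    by (simp del: pow_mat.simps)
qed

lemma frac_in_span_Nil_iff:
  assumes "frac_vec_rep xs v" "v \<in> carrier_vec d"
  shows "frac_in_span xs [] \<longleftrightarrow> v = 0\<^sub>v d"
proof -
  have len: "length xs = d" using list_all2_lengthD[OF assms(1)] assms(2) by simp
  have "frac_rep (xs ! i) (v $ i)" if "i < d" for i
    using list_all2_nthD[OF assms(1), of i] that len assms(2) by (auto simp: list_of_vec_index)
  from frac_eq_iff[OF this frac_rep_zero] have "frac_in_span xs [] \<longleftrightarrow> (\<forall>i<d. v $ i = 0)"
    by (auto simp: frac_in_span_def list_all_length len)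
  also have "\<dots> \<longleftrightarrow> v = 0\<^sub>v d" using assms(2) by auto
  finally show ?thesis .
qed

lemma frac_in_span_Cons_iff:
  assumes "frac_vec_rep xs v" "v \<in> carrier_vec d" "frac_vec_rep ys u" "u \<in> carrier_vec d"
  shows "frac_in_span xs (ys # yss) \<longleftrightarrow> (\<forall>i<d. \<forall>j<d. v $ i * u $ j = v $ j * u $ i)"
proof -
  have len: "length xs = d" "length ys = d"
    using assms list_all2_lengthD[OF assms(1)] list_all2_lengthD[OF assms(3)] by auto
  have x: "frac_rep (xs ! i) (v $ i)" and y: "frac_rep (ys ! i) (u $ i)" if "i < d" for i
    using list_all2_nthD[OF assms(1), of i] list_all2_nthD[OF assms(3), of i] that len assms
    by (auto simp: list_of_vec_index)
  have "frac_eq (frac_mult (xs ! i) (ys ! j)) (frac_mult (xs ! j) (ys ! i)) \<longleftrightarrow>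
      v $ i * u $ j = v $ j * u $ i" if "i < d" "j < d" for i j
    using that by (intro frac_eq_iff frac_rep_mult x y)
  then show ?thesis
    by (auto simp: frac_in_span_def frac_parallel_def list_all_length len)
qed

section \<open>Algebraic integers of bounded height\<close>

text \<open>Multiplication by \<open>z\<close> maps the span of the numbers \<open>w i\<close> to itself, with an integer matrix of
  entries at most \<open>R\<close>. For fixed \<open>w\<close> such numbers \<open>z\<close> are closed under ring operations, and each of them
  is an algebraic integer whose conjugates are bounded in terms of \<open>card I\<close> and \<open>R\<close>.\<close>

definition acts :: "'i set \<Rightarrow> ('i \<Rightarrow> complex) \<Rightarrow> real \<Rightarrow> complex \<Rightarrow> bool" where
  "acts I w R z \<longleftrightarrow> (\<exists>m :: 'i \<Rightarrow> 'i \<Rightarrow> int.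
     (\<forall>i\<in>I. z * w i = (\<Sum>j\<in>I. of_int (m i j) * w j)) \<and>
     (\<forall>i\<in>I. \<forall>j\<in>I. real_of_int \<bar>m i j\<bar> \<le> R))"

lemma acts_mono: "acts I w R z \<Longrightarrow> R \<le> S \<Longrightarrow> acts I w S z"
  unfolding acts_def by (meson order_trans)

lemma acts_of_int:
  assumes "finite I"
  shows "acts I w \<bar>real_of_int c\<bar> (of_int c)"
proof -
  have "(\<Sum>j\<in>I. of_int (if i = j then c else 0) * w j) = of_int c * w i" if "i \<in> I" for i
  proof -
    have "(\<Sum>j\<in>I. of_int (if i = j then c else 0) * w j) = (\<Sum>j\<in>I. if i = j then of_int c * w j else 0)"
      by (intro sum.cong) auto
    then show ?thesis using that assms by simp
  qed
  then show ?thesis unfolding acts_def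
    by (intro exI[of _ "\<lambda>i j. if i = j then c else 0"]) auto
qed

lemma acts_add:
  assumes "acts I w R z" "acts I w S y"
  shows "acts I w (R + S) (z + y)"
proof -
  obtain m where m: "\<forall>i\<in>I. z * w i = (\<Sum>j\<in>I. of_int (m i j) * w j)"
    "\<forall>i\<in>I. \<forall>j\<in>I. real_of_int \<bar>m i j\<bar> \<le> R" using assms(1) unfolding acts_def by blast
  obtain k where k: "\<forall>i\<in>I. y * w i = (\<Sum>j\<in>I. of_int (k i j) * w j)"
    "\<forall>i\<in>I. \<forall>j\<in>I. real_of_int \<bar>k i j\<bar> \<le> S" using assms(2) unfolding acts_def by blast
  have "real_of_int \<bar>m i j + k i j\<bar> \<le> R + S" if "i \<in> I" "j \<in> I" for i j
    using m(2)[rule_format, OF that] k(2)[rule_format, OF that] by linarith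
  then show ?thesis unfolding acts_def
    by (intro exI[of _ "\<lambda>i j. m i j + k i j"]) (auto simp: m(1) k(1) algebra_simps sum.distrib)
qed

lemma acts_uminus:
  assumes "acts I w R z"
  shows "acts I w R (- z)"
proof -
  obtain m where m: "\<forall>i\<in>I. z * w i = (\<Sum>j\<in>I. of_int (m i j) * w j)"
    "\<forall>i\<in>I. \<forall>j\<in>I. real_of_int \<bar>m i j\<bar> \<le> R" using assms(1) unfolding acts_def by blast
  then show ?thesis unfolding acts_def
    by (intro exI[of _ "\<lambda>i j. - m i j"]) (auto simp: sum_negf)
qed

lemma acts_diff: "acts I w R z \<Longrightarrow> acts I w S y \<Longrightarrow> acts I w (R + S) (z - y)"
  using acts_add[OF _ acts_uminus, of I w R z S y] by simp

text \<open>Multiplication of numbers becomes multiplication of matrices; each entry of the product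
  is a sum of \<open>card I\<close> terms.\<close>

lemma acts_mult:
  fixes R S :: real
  assumes "acts I w R z" "acts I w S y" "finite I" "0 \<le> R" "0 \<le> S"
  shows "acts I w (card I * R * S) (z * y)"
proof -
  obtain m where m: "\<forall>i\<in>I. z * w i = (\<Sum>j\<in>I. of_int (m i j) * w j)"
    "\<forall>i\<in>I. \<forall>j\<in>I. real_of_int \<bar>m i j\<bar> \<le> R" using assms(1) unfolding acts_def by blast
  obtain k where k: "\<forall>i\<in>I. y * w i = (\<Sum>j\<in>I. of_int (k i j) * w j)"
    "\<forall>i\<in>I. \<forall>j\<in>I. real_of_int \<bar>k i j\<bar> \<le> S" using assms(2) unfolding acts_def by blast
  define p where "p i j = (\<Sum>l\<in>I. k i l * m l j)" for i j
  have "z * y * w i = (\<Sum>j\<in>I. of_int (p i j) * w j)" if "i \<in> I" for i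
  proof -
    have "z * y * w i = (\<Sum>l\<in>I. of_int (k i l) * (z * w l))"
    proof -
      have "z * y * w i = z * (\<Sum>l\<in>I. of_int (k i l) * w l)"
        using k(1)[rule_format, OF that] by (simp only: mult.assoc)
      then show ?thesis by (simp add: sum_distrib_left mult_ac)
    qed
    also have "\<dots> = (\<Sum>l\<in>I. \<Sum>j\<in>I. of_int (k i l * m l j) * w j)"
      using m(1) by (intro sum.cong) (simp_all add: sum_distrib_left mult_ac)
    also have "\<dots> = (\<Sum>j\<in>I. \<Sum>l\<in>I. of_int (k i l * m l j) * w j)" by (rule sum.swap)
    also have "\<dots> = (\<Sum>j\<in>I. of_int (p i j) * w j)" by (simp add: p_def sum_distrib_right)
    finally show ?thesis .
  qed
  moreover have "real_of_int \<bar>p i j\<bar> \<le> card I * R * S" if "i \<in> I" "j \<in> I" for i j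
  proof -
    have "real_of_int \<bar>p i j\<bar> \<le> (\<Sum>l\<in>I. \<bar>real_of_int (k i l * m l j)\<bar>)"
      unfolding p_def by (simp del: of_int_mult of_int_abs flip: of_int_abs of_int_sum)
    also have "\<dots> \<le> (\<Sum>l\<in>I. R * S)"
      using m(2) k(2) that assms(4,5)
      by (intro sum_mono) (auto simp: abs_mult mult.commute[of R] intro!: mult_mono)
    finally show ?thesis by simp
  qed
  ultimately show ?thesis unfolding acts_def by blast
qed

lemma acts_sum:
  fixes R :: real
  assumes "finite J" "\<And>j. j \<in> J \<Longrightarrow> acts I w R (f j)" "finite I"
  shows "acts I w (card J * R) (\<Sum>j\<in>J. f j)"
  using assms(1,2)
proof (induction J rule: finite_induct)
  case empty
  then show ?case using acts_of_int[OF assms(3), of w 0] by simp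
next
  case (insert j J)
  have "acts I w (R + card J * R) (f j + (\<Sum>j\<in>J. f j))"
    using insert by (intro acts_add) auto
  then show ?case using insert by (simp add: algebra_simps)
qed

text \<open>Compare both sides at an index where the norm of \<open>w\<close> is largest, as for
  Gershgorin discs.\<close>

lemma acts_norm_le:
  fixes R :: real
  assumes "acts I w R z" "finite I" "\<exists>i\<in>I. w i \<noteq> 0"
  shows "norm z \<le> card I * R"
proof -
  obtain m where m: "\<forall>i\<in>I. z * w i = (\<Sum>j\<in>I. of_int (m i j) * w j)"
    "\<forall>i\<in>I. \<forall>j\<in>I. real_of_int \<bar>m i j\<bar> \<le> R" using assms(1) unfolding acts_def by blast
  define N where "N = Max ((\<lambda>i. norm (w i)) ` I)"
  have ne: "I \<noteq> {}" using assms(3) by auto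
  then obtain i where i: "i \<in> I" "norm (w i) = N"
    using Max_in[of "(\<lambda>i. norm (w i)) ` I"] assms(2) unfolding N_def by fastforce
  have le: "norm (w j) \<le> N" if "j \<in> I" for j using that assms(2) unfolding N_def by auto
  have "N > 0" using assms(3) le by (metis norm_le_zero_iff not_le order_trans)
  have R: "R \<ge> 0" using m(2) i(1) by (meson abs_ge_zero of_int_0_le_iff order_trans)
  have "norm z * N = norm (\<Sum>j\<in>I. of_int (m i j) * w j)"
    using m(1) i by (metis norm_mult)
  also have "\<dots> \<le> (\<Sum>j\<in>I. R * N)"
    using m(2) i le R by (intro sum_norm_le) (auto simp: norm_mult intro!: mult_mono)
  also have "\<dots> = card I * R * N" by simp
  finally show ?thesis using \<open>N > 0\<close> by simp
qed

text \<open>Up to sign this product is the coefficient of \<open>p\<close> at the multiplicity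
  \<open>k\<close> of the root 0, the constant term after division by the \<open>k\<close>-th power
  of the variable.\<close>

lemma prod_list_nonzero_roots_int:
  fixes p :: "int poly"
  assumes "map_poly of_int p = (\<Prod>a\<leftarrow>as. [:- a, 1:] :: complex poly)"
  shows "prod_list (filter (\<lambda>a. a \<noteq> 0) as) \<in> \<int>"
proof -
  let ?nz = "filter (\<lambda>a. a \<noteq> 0) as"
  define k where "k = length (filter (\<lambda>a. a = 0) as)"
  have "(\<Prod>a\<leftarrow>as. [:- a, 1:]) =
      monom 1 (length (filter (\<lambda>a. a = 0) as)) * (\<Prod>a\<leftarrow>filter (\<lambda>a. a \<noteq> 0) as. [:- a, 1:])"
  proof (induction as)
    case (Cons a as)
    show ?case
    proof (cases "a = 0")
      case False
      then show ?thesis by (simp only: list.map prod_list.Cons Cons filter.simps if_False not_False_eq_True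
            if_True mult.left_commute)
    qed (simp add: Cons monom_Suc)
  qed simp
  then have "coeff (map_poly of_int p) k = coeff (\<Prod>a\<leftarrow>?nz. [:- a, 1:]) 0"
    unfolding assms by (simp add: coeff_monom_mult k_def)
  also have "\<dots> = (-1) ^ length ?nz * prod_list ?nz"
    by (induction as) (auto simp: coeff_mult)
  finally have "prod_list ?nz = (-1) ^ length ?nz * of_int (coeff p k)"
    by (simp add: coeff_map_poly flip: power_mult_distrib mult.assoc)
  then show ?thesis by simp
qed

lemma prod_list_remove1:
  "x \<in> set xs \<Longrightarrow> prod_list xs = (x :: 'a :: comm_monoid_mult) * prod_list (remove1 x xs)"
  by (induction xs) (auto simp: mult.left_commute)

lemma norm_prod_list_le:
  fixes xs :: "complex list"
  assumes "\<And>x. x \<in> set xs \<Longrightarrow> norm x \<le> B" "1 \<le> B"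
  shows "norm (prod_list xs) \<le> B ^ length xs"
  using assms
proof (induction xs)
  case (Cons x xs)
  then have "norm x * norm (prod_list xs) \<le> B * B ^ length xs" by (intro mult_mono) auto
  then show ?case by (simp add: norm_mult)
qed simp

text \<open>A Liouville bound: \<open>z\<close> is one of the nonzero eigenvalues of an integer
  matrix, their product is a nonzero integer, and the other factors are at most \<open>B\<close>.
  All eigenvalues of the matrix stand in for the conjugates of \<open>z\<close>, so no minimal
  polynomial is needed.\<close>

lemma acts_norm_ge:
  fixes R :: real
  assumes z: "acts I w R z" and I: "finite I" "\<exists>i\<in>I. w i \<noteq> 0" and "z \<noteq> 0"
    and B: "card I * R \<le> B" "1 \<le> B"
  shows "1 \<le> norm z * B ^ card I"
proof -
  obtain m where m: "\<forall>i\<in>I. z * w i = (\<Sum>j\<in>I. of_int (m i j) * w j)"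
    "\<forall>i\<in>I. \<forall>j\<in>I. real_of_int \<bar>m i j\<bar> \<le> R" using z unfolding acts_def by blast
  define n where "n = card I"
  obtain e where e: "bij_betw e {..<n} I"
    using ex_bij_betw_nat_finite[OF I(1)] unfolding n_def atLeast0LessThan by blast
  have eI: "e i \<in> I" if "i < n" for i using e that unfolding bij_betw_def by auto
  define M where "M = mat n n (\<lambda>(i, j). m (e i) (e j))"
  define M' :: "complex mat" where "M' = map_mat of_int M"
  have M: "M \<in> carrier_mat n n" "M' \<in> carrier_mat n n" by (auto simp: M_def M'_def)
  have "eigenvector M' (vec n (\<lambda>i. w (e i))) z" unfolding eigenvector_def
  proof (intro conjI)
    show "vec n (\<lambda>i. w (e i)) \<in> carrier_vec (dim_row M')" using M by simp
    obtain i where "i \<in> I" "w i \<noteq> 0" using I(2) by auto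
    then obtain a where "a < n" "w (e a) \<noteq> 0" using e unfolding bij_betw_def by force
    then show "vec n (\<lambda>i. w (e i)) \<noteq> 0\<^sub>v (dim_row M')"
      using M by (metis carrier_matD(1) index_vec index_zero_vec(1))
    show "M' *\<^sub>v vec n (\<lambda>i. w (e i)) = z \<cdot>\<^sub>v vec n (\<lambda>i. w (e i))"
    proof (rule eq_vecI)
      fix i assume "i < dim_vec (z \<cdot>\<^sub>v vec n (\<lambda>i. w (e i)))"
      then have i: "i < n" by simp
      have "z * w (e i) = (\<Sum>j\<in>I. of_int (m (e i) j) * w j)" using m(1) eI[OF i] by blast
      also have "\<dots> = (\<Sum>j<n. of_int (m (e i) (e j)) * w (e j))"
        by (rule sum.reindex_bij_betw[OF e, symmetric])
      finally show "(M' *\<^sub>v vec n (\<lambda>i. w (e i))) $ i = (z \<cdot>\<^sub>v vec n (\<lambda>i. w (e i))) $ i"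
        using i by (simp add: M'_def M_def scalar_prod_def atLeast0LessThan)
    qed (use M in auto)
  qed
  then have ev: "eigenvalue M' z" unfolding eigenvalue_def by blast
  obtain as where as: "char_poly M' = (\<Prod>a\<leftarrow>as. [:- a, 1:])" "length as = n"
    using char_poly_factorized[OF M(2)] by blast
  have root: "a \<in> set as \<longleftrightarrow> eigenvalue M' a" for a
    unfolding eigenvalue_root_char_poly[OF M(2)] as(1) by (auto simp: poly_prod_list o_def prod_list_zero_iff)
  have bound: "norm a \<le> B" if mem: "a \<in> set as" for a
  proof -
    obtain v where v: "eigenvector M' v a" using mem root[of a] unfolding eigenvalue_def by blast
    then have v': "v \<in> carrier_vec n" "v \<noteq> 0\<^sub>v n" "M' *\<^sub>v v = a \<cdot>\<^sub>v v"
      using M unfolding eigenvector_def by auto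
    \<comment> \<open>Every eigenvalue acts on its own eigenvector through the same matrix, so the
      upper bound for \<open>z\<close> holds for all of them.\<close>
    have "acts {..<n} (\<lambda>i. v $ i) R a" unfolding acts_def
    proof (intro exI conjI ballI)
      fix i assume i: "i \<in> {..<n}"
      then have "(M' *\<^sub>v v) $ i = (\<Sum>j\<in>{..<n}. of_int (m (e i) (e j)) * v $ j)"
        using v'(1) by (simp add: M'_def M_def scalar_prod_def atLeast0LessThan)
      then show "a * v $ i = (\<Sum>j\<in>{..<n}. of_int (m (e i) (e j)) * v $ j)"
        using i v'(1) unfolding v'(3) by simp
      show "real_of_int \<bar>m (e i) (e j)\<bar> \<le> R" if "j \<in> {..<n}" for j
        using m(2) i that eI by auto
    qed
    moreover have "\<exists>i\<in>{..<n}. v $ i \<noteq> 0" using v'(1,2) by (metis eq_vecI carrier_vecD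
          index_zero_vec lessThan_iff)
    ultimately have "norm a \<le> card {..<n} * R" by (intro acts_norm_le) auto
    then show ?thesis using B(1) by (simp add: n_def)
  qed
  let ?nz = "filter (\<lambda>a. a \<noteq> 0) as"
  have "map_poly of_int (char_poly M) = (\<Prod>a\<leftarrow>as. [:- a, 1:] :: complex poly)"
    using of_int_hom.char_poly_hom[OF M(1), where 'a = complex] as(1) by (simp add: M'_def)
  then obtain k where k: "prod_list ?nz = of_int k"
    using prod_list_nonzero_roots_int Ints_cases by blast
  have "prod_list ?nz \<noteq> 0" by (simp add: prod_list_zero_iff)
  then have "1 \<le> norm (prod_list ?nz)" unfolding k by auto
  also have zin: "z \<in> set ?nz" using ev root \<open>z \<noteq> 0\<close> by auto
  have "norm (prod_list ?nz) = norm z * norm (prod_list (remove1 z ?nz))"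
    using zin by (metis norm_mult prod_list_remove1)
  also have "\<dots> \<le> norm z * B ^ length (remove1 z ?nz)"
    using bound B(2) set_remove1_subset[of z ?nz]
    by (intro mult_left_mono norm_prod_list_le) auto
  also have "\<dots> \<le> norm z * B ^ card I"
  proof (intro mult_left_mono power_increasing B(2) norm_ge_zero)
    have "length (remove1 z ?nz) \<le> length ?nz" by (simp add: length_remove1)
    also have "\<dots> \<le> card I" using length_filter_le[of "\<lambda>a. a \<noteq> 0" as] as(2) by (simp add: n_def)
    finally show "length (remove1 z ?nz) \<le> card I" .
  qed
  finally show ?thesis .
qed

definition eig :: "nat \<Rightarrow> (nat \<Rightarrow> nat \<Rightarrow> int) \<Rightarrow> complex \<Rightarrow> bool" where
  "eig d A l \<longleftrightarrow> (\<exists>v. (\<exists>i<d. v i \<noteq> 0) \<and> (\<forall>i<d. l * v i = (\<Sum>j<d. of_int (A i j) * v j)))"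

text \<open>Finitely many eigenvalues act on the tensor product of their eigenvectors, each of them
  through its own factor.\<close>

lemma eig_common_acts:
  assumes M: "\<And>i j. i < d \<Longrightarrow> j < d \<Longrightarrow> real_of_int \<bar>A i j\<bar> \<le> M" "0 \<le> M"
    and ls: "\<And>l. l \<in> set ls \<Longrightarrow> eig d A l"
  shows "\<exists>(I :: nat list set) w. finite I \<and> card I = d ^ length ls \<and> (\<exists>i\<in>I. w i \<noteq> 0) \<and>
           (\<forall>l\<in>set ls. acts I w M l)"
  using ls
proof (induction ls)
  case Nil
  show ?case by (rule exI[of _ "{[]}"], rule exI[of _ "\<lambda>_. 1"]) simp
next
  case (Cons l ls)
  obtain I w where Iw: "finite (I :: nat list set)" "card I = d ^ length ls" "\<exists>i\<in>I. w i \<noteq> 0"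
    "\<forall>l\<in>set ls. acts I w M l" using Cons by auto
  obtain v where v: "\<exists>i<d. v i \<noteq> 0" "\<forall>i<d. l * v i = (\<Sum>j<d. of_int (A i j) * v j)"
    using Cons.prems[of l] unfolding eig_def by auto
  \<comment> \<open>Lists index the tensor product: the head belongs to the eigenvector of
    \<open>l\<close>, the tail to those of \<open>ls\<close>. Each eigenvalue acts by its matrix on
    its own part and by the identity on the other.\<close>
  define c where "c = (\<lambda>(i::nat, is). i # is)"
  define J where "J = c ` ({..<d} \<times> I)"
  define u where "u is = v (hd is) * w (tl is)" for "is"
  have inj: "inj_on c X" for X by (auto simp: inj_on_def c_def)
  have sumJ: "(\<Sum>j\<in>J. f j) = (\<Sum>i<d. \<Sum>is\<in>I. f (i # is))" for f :: "nat list \<Rightarrow> complex"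
    unfolding J_def sum.reindex[OF inj] sum.cartesian_product by (simp add: c_def o_def case_prod_beta)
  have "acts J u M y" if y: "y \<in> set ls" for y
  proof -
    obtain m where m: "\<forall>i\<in>I. y * w i = (\<Sum>j\<in>I. of_int (m i j) * w j)"
      "\<forall>i\<in>I. \<forall>j\<in>I. real_of_int \<bar>m i j\<bar> \<le> M" using Iw(4) y unfolding acts_def by blast
    show ?thesis unfolding acts_def
    proof (intro exI conjI ballI)
      let ?m = "\<lambda>is js. if hd is = hd js then m (tl is) (tl js) else 0"
      fix p assume "p \<in> J"
      then obtain i "is" where p: "p = i # is" "i < d" "is \<in> I" by (auto simp: J_def c_def)
      have "(\<Sum>j\<in>J. of_int (?m p j) * u j) =
          (\<Sum>j<d. if i = j then v i * (\<Sum>js\<in>I. of_int (m is js) * w js) else 0)"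
        unfolding sumJ by (intro sum.cong) (auto simp: p u_def sum_distrib_left mult_ac)
      also have "\<dots> = y * u p" using p m(1) by (auto simp: u_def mult_ac)
      finally show "y * u p = (\<Sum>j\<in>J. of_int (?m p j) * u j)" ..
      show "real_of_int \<bar>?m p q\<bar> \<le> M" if "q \<in> J" for q
        using that p m(2) M(2) by (auto simp: J_def c_def)
    qed
  qed
  moreover have "acts J u M l" unfolding acts_def
  proof (intro exI conjI ballI)
    let ?m = "\<lambda>is js. if tl is = tl js then A (hd is) (hd js) else 0"
    fix p assume "p \<in> J"
    then obtain i "is" where p: "p = i # is" "i < d" "is \<in> I" by (auto simp: J_def c_def)
    have "(\<Sum>js\<in>I. of_int (?m p (j # js)) * u (j # js)) = of_int (A i j) * v j * w is" for j
    proof -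
      have "(\<Sum>js\<in>I. of_int (?m p (j # js)) * u (j # js)) =
          (\<Sum>js\<in>I. if is = js then of_int (A i j) * v j * w js else 0)"
        by (intro sum.cong) (auto simp: p u_def)
      then show ?thesis using p Iw(1) by simp
    qed
    then have "(\<Sum>j\<in>J. of_int (?m p j) * u j) = (\<Sum>j<d. of_int (A i j) * v j * w is)"
      unfolding sumJ by simp
    also have "\<dots> = l * u p" using p v(2) by (simp add: u_def sum_distrib_right flip: mult.assoc)
    finally show "l * u p = (\<Sum>j\<in>J. of_int (?m p j) * u j)" ..
    show "real_of_int \<bar>?m p q\<bar> \<le> M" if "q \<in> J" for q
      using that p M by (auto simp: J_def c_def)
  qed
  moreover have "finite J" "card J = d ^ length (l # ls)"
    using Iw by (auto simp: J_def card_image[OF inj] card_cartesian_product)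
  moreover have "\<exists>i\<in>J. u i \<noteq> 0"
  proof -
    obtain i "is" where "i < d" "v i \<noteq> 0" "is \<in> I" "w is \<noteq> 0" using v(1) Iw(3) by auto
    then show ?thesis by (intro bexI[of _ "i # is"]) (auto simp: u_def J_def c_def)
  qed
  ultimately show ?case by (intro exI[of _ J] exI[of _ u]) auto
qed

section \<open>Binary recurrences\<close>

text \<open>If \<open>h k = 0\<close> then the initial value \<open>h 0\<close> is \<open>h (k - 1)\<close> times an integer prime to the
  denominator \<open>b\<close> of \<open>\<sigma>\<close> divided by \<open>b ^ (k - 1)\<close>, whereas \<open>h (k - 1)\<^sup>2\<close> is the value of an
  invariant quadratic form. Hence \<open>b ^ (2 * (k - 1))\<close> divides a fixed integer.\<close>

lemma chebyshev_zero_bound: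
  fixes h :: "nat \<Rightarrow> rat"
  assumes rec: "\<And>l. h (l + 2) = \<sigma> * h (l + 1) - h l"
    and \<sigma>: "-2 < \<sigma>" "\<sigma> < 2" and "h k = 0"
    and h0: "h 0 = of_int z"
    and I: "of_int e * ((h 1)\<^sup>2 - \<sigma> * h 0 * h 1 + (h 0)\<^sup>2) = of_int i" "e \<noteq> 0"
  shows "\<exists>k' \<le> 12 + nat \<bar>i\<bar>. h k' = 0"
proof -
  obtain a b where q: "quotient_of \<sigma> = (a, b)" by fastforce
  have b: "b > 0" and cop: "coprime a b" and ab: "\<sigma> = of_int a / of_int b"
    using quotient_of_denom_pos[OF q] quotient_of_coprime[OF q] quotient_of_div[OF q] by auto
  have rec': "h (Suc (Suc l)) = \<sigma> * h (Suc l) - h l" for l using rec[of l] by simp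
  show ?thesis
  proof (cases "b = 1")
    case True
    have "(of_int (-2) :: rat) < of_int a" "(of_int a :: rat) < of_int 2"
      using \<sigma> ab True by simp_all
    then have "a = -1 \<or> a = 0 \<or> a = 1" by linarith
    then have "\<sigma> = -1 \<or> \<sigma> = 0 \<or> \<sigma> = 1" using ab True by auto
    \<comment> \<open>The roots are roots of unity of order 3, 4 or 6, with least common multiple
      12.\<close>
    then have per: "h (l + 12) = h l" for l
    proof (elim disjE)
      assume "\<sigma> = -1"
      then have "h (j + 3) = h j" for j by (simp add: numeral_3_eq_3 rec')
      from this[of l] this[of "l + 3"] this[of "l + 6"] this[of "l + 9"] show ?thesis
        by (simp add: add.commute)
    next
      assume "\<sigma> = 0"
      then have "h (j + 4) = h j" for j by (simp add: eval_nat_numeral rec')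
      from this[of l] this[of "l + 4"] this[of "l + 8"] show ?thesis by (simp add: add.commute)
    next
      assume "\<sigma> = 1"
      then have "h (j + 3) = - h j" for j by (simp add: numeral_3_eq_3 rec')
      from this[of l] this[of "l + 3"] this[of "l + 6"] this[of "l + 9"] show ?thesis
        by (simp add: add.commute)
    qed
    have "h (j + 12 * t) = h j" for j t
    proof (induction t)
      case (Suc t)
      then show ?case using per[of "j + 12 * t"] by (simp add: algebra_simps)
    qed simp
    from this[of "k mod 12" "k div 12"] have "h (k mod 12) = 0" using \<open>h k = 0\<close> by simp
    moreover have "k mod 12 \<le> 12 + nat \<bar>i\<bar>" using mod_less_divisor[of 12 k] by linarith
    ultimately show ?thesis by blast
  next
    case False
    with b have b2: "2 \<le> b" by simp
    have inv: "(h (l + 1))\<^sup>2 - \<sigma> * h l * h (l + 1) + (h l)\<^sup>2 = (h 1)\<^sup>2 - \<sigma> * h 0 * h 1 + (h 0)\<^sup>2" for l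
    proof (induction l)
      case (Suc l)
      have "(h (Suc l + 1))\<^sup>2 - \<sigma> * h (Suc l) * h (Suc l + 1) + (h (Suc l))\<^sup>2 =
          (h (l + 1))\<^sup>2 - \<sigma> * h l * h (l + 1) + (h l)\<^sup>2"
        by (simp add: rec' power2_eq_square algebra_simps)
      then show ?case using Suc by simp
    qed simp
    show ?thesis
    proof (cases "i = 0")
      case True
      then have "(h 1)\<^sup>2 - \<sigma> * h 0 * h 1 + (h 0)\<^sup>2 = 0" using I by simp
      \<comment> \<open>Completing the square: for \<open>\<bar>\<sigma>\<bar> < 2\<close> the form
        is positive definite, so the value 0 forces \<open>h 0 = 0\<close>.\<close>
      moreover have "4 * ((h 1)\<^sup>2 - \<sigma> * h 0 * h 1 + (h 0)\<^sup>2) =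
          (2 * h 1 - \<sigma> * h 0)\<^sup>2 + (2 - \<sigma>) * (2 + \<sigma>) * (h 0)\<^sup>2"
        by (simp add: power2_eq_square algebra_simps)
      ultimately have "(2 - \<sigma>) * (2 + \<sigma>) * (h 0)\<^sup>2 = - ((2 * h 1 - \<sigma> * h 0)\<^sup>2)"
        by simp
      then have "(2 - \<sigma>) * (2 + \<sigma>) * (h 0)\<^sup>2 \<le> 0" by (simp only: neg_le_0_iff_le zero_le_power2)
      moreover have "0 < (2 - \<sigma>) * (2 + \<sigma>)" using \<sigma> by (intro mult_pos_pos) auto
      ultimately have "(h 0)\<^sup>2 \<le> 0" using mult_pos_pos not_le by blast
      then have "h 0 = 0" by simp
      then show ?thesis by blast
    next
      case False
      show ?thesis
      proof (cases k)
        case 0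
        then show ?thesis using \<open>h k = 0\<close> by blast
      next
        case (Suc k')
        \<comment> \<open>Run the recurrence backwards from the zero at \<open>Suc k'\<close>.
          Modulo \<open>b\<close> each step multiplies the numerator \<open>N\<close> by
          \<open>a\<close>, so it stays prime to \<open>b\<close>.\<close>
        have "j \<le> k' \<Longrightarrow> \<exists>N N'. coprime N b \<and>
            h (k' - j) * of_int b ^ j = h k' * of_int N \<and>
            h (Suc k' - j) * of_int b ^ j = h k' * of_int N' \<and> b dvd N'" for j
        proof (induction j)
          case 0
          show ?case using \<open>h k = 0\<close> Suc by (intro exI[of _ 1] exI[of _ 0]) simp
        next
          case (Suc j)
          then obtain N N' where N: "coprime N b" "h (k' - j) * of_int b ^ j = h k' * of_int N"
            "h (Suc k' - j) * of_int b ^ j = h k' * of_int N'" "b dvd N'" by auto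
          have e1: "Suc k' - j = (k' - Suc j) + 2" and e2: "k' - j = (k' - Suc j) + 1"
            and e3: "Suc k' - Suc j = k' - j"
            using Suc.prems by auto
          have "h (k' - Suc j) = \<sigma> * h (k' - j) - h (Suc k' - j)"
            using rec[of "k' - Suc j"] unfolding e1[symmetric] e2[symmetric] by simp
          moreover have "w * of_int b ^ Suc j =
              of_int a * (u * of_int b ^ j) - of_int b * (v * of_int b ^ j)"
            if "w = \<sigma> * u - v" for u v w
            using b by (simp add: that ab field_simps)
          ultimately have "h (k' - Suc j) * of_int b ^ Suc j =
              of_int a * (h (k' - j) * of_int b ^ j) - of_int b * (h (Suc k' - j) * of_int b ^ j)"
            by blast
          also have "\<dots> = of_int a * (h k' * of_int N) - of_int b * (h k' * of_int N')"
            by (simp only: N(2,3))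
          also have "\<dots> = h k' * of_int (a * N - b * N')" by (simp add: algebra_simps)
          finally have "h (k' - Suc j) * of_int b ^ Suc j = h k' * of_int (a * N - b * N')" .
          moreover have "h (Suc k' - Suc j) * of_int b ^ Suc j = h k' * of_int (b * N)"
          proof -
            have "h (Suc k' - Suc j) * of_int b ^ Suc j = of_int b * (h (k' - j) * of_int b ^ j)"
              unfolding e3 by simp
            also have "\<dots> = of_int b * (h k' * of_int N)" by (simp only: N(2))
            finally show ?thesis by simp
          qed
          moreover have "coprime (a * N - b * N') b"
          proof -
            have "coprime (a * N) b" using cop N(1) by simp
            moreover have "gcd (a * N - b * N') b = gcd (a * N) b"
              using gcd_add_mult[of b "- N'" "a * N"] by (simp add: gcd.commute algebra_simps)
            ultimately show ?thesis by (simp add: coprime_iff_gcd_eq_1)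
          qed
          ultimately show ?case by (intro exI[of _ "a * N - b * N'"] exI[of _ "b * N"]) simp
        qed
        from this[of k'] obtain N where N: "coprime N b" "h 0 * of_int b ^ k' = h k' * of_int N"
          by auto
        \<comment> \<open>The form is evaluated where the next term vanishes; this allows
          \<open>h k'\<close> to be eliminated from the relation between \<open>h 0\<close> and
          \<open>h k'\<close>.\<close>
        have "(h 1)\<^sup>2 - \<sigma> * h 0 * h 1 + (h 0)\<^sup>2 = (h k')\<^sup>2"
          using inv[of k'] \<open>h k = 0\<close> Suc by simp
        then have "of_int e * (h k')\<^sup>2 = of_int i" using I(1) by simp
        then have "of_int e * (h 0 * of_int b ^ k')\<^sup>2 = of_int i * (of_int N)\<^sup>2"
          unfolding N(2) by (simp add: power_mult_distrib)
        then have "of_int (e * (z * b ^ k')\<^sup>2) = (of_int (i * N\<^sup>2) :: rat)" by (simp add: h0)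
        then have eq: "e * (z * b ^ k')\<^sup>2 = i * N\<^sup>2" by (simp only: of_int_eq_iff)
        \<comment> \<open>A single factor \<open>b ^ k'\<close> suffices, since
          \<open>2 ^ k' \<le> \<bar>i\<bar>\<close> already bounds \<open>k'\<close>.\<close>
        have "b ^ k' dvd e * (z * b ^ k')\<^sup>2" by (simp add: power2_eq_square)
        then have "b ^ k' dvd i * N\<^sup>2" unfolding eq .
        moreover have "coprime (b ^ k') (N\<^sup>2)" using N(1) by (simp add: coprime_commute)
        ultimately have "b ^ k' dvd i" by (simp add: coprime_dvd_mult_left_iff)
        then have "b ^ k' \<le> \<bar>i\<bar>" using False by (simp add: zdvd_imp_le)
        moreover have "2 ^ k' \<le> b ^ k'" using b2 by (intro power_mono) auto
        moreover have "int k' < 2 ^ k'" using of_nat_less_two_power[of k'] by simp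
        ultimately have "k \<le> 12 + nat \<bar>i\<bar>" using Suc by linarith
        then show ?thesis using \<open>h k = 0\<close> by blast
      qed
    qed
  qed
qed

text \<open>If the roots have sum \<open>\<tau>\<close> and product \<open>\<rho>\<close>, the even
  terms belong to the squared roots, whose product is \<open>\<rho>\<^sup>2\<close>. Dividing by
  \<open>\<rho> ^ l\<close> makes the product 1 and the sum
  \<open>\<tau>\<^sup>2 / \<rho> - 2\<close>. This number exceeds -2 because
  \<open>s \<noteq> 0\<close> and is below 2 by the discriminant condition.\<close>

lemma binary_recurrence_even_zero_bound:
  fixes z :: "nat \<Rightarrow> int" and D s r W :: int
  assumes rec: "\<And>l. D * z (l + 2) = s * z (l + 1) - r * z l"
    and disc: "s\<^sup>2 < 4 * r * D" and "s \<noteq> 0" and zero: "z (2 * k) = 0"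
    and W: "\<bar>D\<bar> \<le> W" "\<bar>s\<bar> \<le> W" "\<bar>r\<bar> \<le> W" "\<bar>z 0\<bar> \<le> W" "\<bar>z 2\<bar> \<le> W"
  shows "\<exists>k' \<le> 12 + nat (5 * W ^ 4). z (2 * k') = 0"
proof -
  define \<rho> :: rat where "\<rho> = of_int r / of_int D"
  define \<tau> :: rat where "\<tau> = of_int s / of_int D"
  have rD: "0 < r * D" using disc zero_le_power2[of s] by linarith
  then have ne: "r \<noteq> 0" "D \<noteq> 0" by auto
  have "\<rho> \<noteq> 0" using ne by (simp add: \<rho>_def)
  define zz :: "nat \<Rightarrow> rat" where "zz l = of_int (z l)" for l
  have zz: "zz (l + 2) = \<tau> * zz (l + 1) - \<rho> * zz l" for l
    using arg_cong[OF rec[of l], of "of_int :: int \<Rightarrow> rat"] ne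
    by (simp add: zz_def \<tau>_def \<rho>_def field_simps)
  define h where "h l = zz (2 * l) / \<rho> ^ l" for l
  define \<sigma> where "\<sigma> = \<tau>\<^sup>2 / \<rho> - 2"
  have h_rec: "h (l + 2) = \<sigma> * h (l + 1) - h l" for l
  proof -
    have "zz (2 * l + 4) = \<tau> * zz (2 * l + 3) - \<rho> * zz (2 * l + 2)"
      using zz[of "2 * l + 2"] by (simp add: eval_nat_numeral)
    moreover have "zz (2 * l + 3) = \<tau> * zz (2 * l + 2) - \<rho> * zz (2 * l + 1)"
      using zz[of "2 * l + 1"] by (simp add: eval_nat_numeral)
    moreover have "\<tau> * (\<tau> * c - \<rho> * b) - \<rho> * c = (\<tau>\<^sup>2 - 2 * \<rho>) * c - \<rho>\<^sup>2 * a"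
      if "c = \<tau> * b - \<rho> * a" for a b c
      by (simp add: that power2_eq_square algebra_simps)
    from this[OF zz[of "2 * l"]]
    have "\<tau> * (\<tau> * zz (2 * l + 2) - \<rho> * zz (2 * l + 1)) - \<rho> * zz (2 * l + 2) =
      (\<tau>\<^sup>2 - 2 * \<rho>) * zz (2 * l + 2) - \<rho>\<^sup>2 * zz (2 * l)" .
    ultimately have "zz (2 * l + 4) = (\<tau>\<^sup>2 - 2 * \<rho>) * zz (2 * l + 2) - \<rho>\<^sup>2 * zz (2 * l)"
      by simp
    moreover have "2 * (l + 2) = 2 * l + 4" "2 * (l + 1) = 2 * l + 2" by simp_all
    then have "h (l + 2) = zz (2 * l + 4) / (\<rho> ^ l * \<rho>\<^sup>2)" "h (l + 1) = zz (2 * l + 2) / (\<rho> ^ l * \<rho>)"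
      by (simp_all only: h_def power_add power_one_right)
    moreover have "a / (\<rho> ^ l * \<rho>\<^sup>2) = \<sigma> * (b / (\<rho> ^ l * \<rho>)) - c / \<rho> ^ l"
      if "a = (\<tau>\<^sup>2 - 2 * \<rho>) * b - \<rho>\<^sup>2 * c" for a b c
      using \<open>\<rho> \<noteq> 0\<close> by (simp add: that \<sigma>_def field_simps power2_eq_square)
    ultimately show ?thesis by (simp add: h_def)
  qed
  have \<sigma>_eq: "\<sigma> = of_int (s\<^sup>2) / of_int (r * D) - 2"
    using ne by (simp add: \<sigma>_def \<tau>_def \<rho>_def field_simps power2_eq_square)
  have "0 < s\<^sup>2" using \<open>s \<noteq> 0\<close> by simp
  then have "0 < (of_int (s\<^sup>2) :: rat)" by (simp only: of_int_0_less_iff)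
  moreover have "(of_int (s\<^sup>2) :: rat) < of_int (4 * (r * D))"
    unfolding of_int_less_iff using disc by (simp add: mult.assoc)
  moreover have "0 < (of_int (r * D) :: rat)" using rD by (simp only: of_int_0_less_iff)
  ultimately have \<sigma>: "-2 < \<sigma>" "\<sigma> < 2" unfolding \<sigma>_eq by (simp_all add: field_simps)
  \<comment> \<open>\<open>i\<close> is the invariant form at \<open>h 0\<close> and
    \<open>h 1\<close>, multiplied by \<open>r\<^sup>2\<close> to clear denominators.\<close>
  define i where "i = (z 2 * D)\<^sup>2 - (s\<^sup>2 - 2 * (r * D)) * z 0 * z 2 + (r * z 0)\<^sup>2"
  have h01: "h 0 = of_int (z 0)" "h 1 = of_int (z 2) * of_int D / of_int r"
    by (simp_all add: h_def zz_def \<rho>_def)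
  have "\<exists>k' \<le> 12 + nat \<bar>i\<bar>. h k' = 0"
  proof (rule chebyshev_zero_bound[OF h_rec \<sigma>, of k])
    show "h k = 0" using zero by (simp add: h_def zz_def)
    show "h 0 = of_int (z 0)" by (rule h01)
    show "of_int (r\<^sup>2) * ((h 1)\<^sup>2 - \<sigma> * h 0 * h 1 + (h 0)\<^sup>2) = of_int i"
      unfolding h01 \<sigma>_eq i_def using ne by (simp add: field_simps power2_eq_square)
  qed (use ne in auto)
  then obtain k' where k': "k' \<le> 12 + nat \<bar>i\<bar>" "h k' = 0" by blast
  have W0: "0 \<le> W" using W(1) by linarith
  have m2: "\<bar>x * y\<bar> \<le> W * W" if "\<bar>x\<bar> \<le> W" "\<bar>y\<bar> \<le> W" for x y :: int
    using that W0 by (simp add: abs_mult mult_mono)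
  have m4: "\<bar>x * y\<bar> \<le> W ^ 4" if "\<bar>x\<bar> \<le> W * W" "\<bar>y\<bar> \<le> W * W" for x y :: int
  proof -
    have "\<bar>x * y\<bar> \<le> (W * W) * (W * W)" using that W0 unfolding abs_mult by (intro mult_mono) auto
    then show ?thesis by (simp add: eval_nat_numeral mult.assoc)
  qed
  \<comment> \<open>Four products of four factors each, one of them with coefficient 2: hence
    \<open>5 * W ^ 4\<close>.\<close>
  have "i = (z 2 * D) * (z 2 * D) - (s * s) * (z 0 * z 2) + 2 * ((r * D) * (z 0 * z 2)) + (r * z 0) * (r * z 0)"
    by (simp add: i_def power2_eq_square algebra_simps)
  moreover have "\<bar>a - b + 2 * c + e\<bar> \<le> \<bar>a\<bar> + \<bar>b\<bar> + 2 * \<bar>c\<bar> + \<bar>e\<bar>" for a b c e :: int by linarith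
  ultimately have "\<bar>i\<bar> \<le> \<bar>(z 2 * D) * (z 2 * D)\<bar> + \<bar>(s * s) * (z 0 * z 2)\<bar> +
      2 * \<bar>(r * D) * (z 0 * z 2)\<bar> + \<bar>(r * z 0) * (r * z 0)\<bar>" by (simp only:)
  also have "\<dots> \<le> W ^ 4 + W ^ 4 + 2 * W ^ 4 + W ^ 4"
    by (intro add_mono mult_left_mono m4 m2 W) simp
  finally have "\<bar>i\<bar> \<le> 5 * W ^ 4" by simp
  moreover have "z (2 * k') = 0" using k'(2) \<open>\<rho> \<noteq> 0\<close> by (simp add: h_def zz_def)
  moreover have "nat \<bar>i\<bar> \<le> nat (5 * W ^ 4)" using calculation(1) by (rule nat_mono)
  then have "k' \<le> 12 + nat (5 * W ^ 4)" using k'(1) by simp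
  ultimately show ?thesis by blast
qed

text \<open>The even case is applied to \<open>z\<close> or to its shift, which explains the four
  initial values and \<open>25 = 2 * 12 + 1\<close>. For \<open>s = 0\<close> a zero descends in
  steps of two to index 0 or 1.\<close>

lemma binary_recurrence_zero_bound:
  fixes z :: "nat \<Rightarrow> int" and D s r W :: int
  assumes rec: "\<And>l. D * z (l + 2) = s * z (l + 1) - r * z l"
    and disc: "s\<^sup>2 < 4 * r * D" and zero: "z n = 0"
    and W: "\<bar>D\<bar> \<le> W" "\<bar>s\<bar> \<le> W" "\<bar>r\<bar> \<le> W" "\<And>l. l \<le> 3 \<Longrightarrow> \<bar>z l\<bar> \<le> W"
  shows "\<exists>n' \<le> 25 + nat (10 * W ^ 4). z n' = 0"
proof -
  have nat10: "nat (10 * W ^ 4) = 2 * nat (5 * W ^ 4)"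
    by (simp add: nat_mult_distrib)
  show ?thesis
  proof (cases "s = 0")
    case True
    have rD: "0 < r * D" using disc zero_le_power2[of s] by linarith
    then have ne: "r \<noteq> 0" "D \<noteq> 0" by auto
    have step: "z (l + 2) = 0 \<longleftrightarrow> z l = 0" for l using rec[of l] ne True by auto
    have "z (l + 2 * t) = 0 \<longleftrightarrow> z l = 0" for l t
    proof (induction t)
      case (Suc t)
      then show ?case using step[of "l + 2 * t"] by (simp add: algebra_simps)
    qed simp
    from this[of "n mod 2" "n div 2"] have "z (n mod 2) = 0" using zero by simp
    then show ?thesis by (intro exI[of _ "n mod 2"]) simp
  next
    case False
    show ?thesis
    proof (cases "even n")
      case True
      then obtain k where k: "n = 2 * k" by (rule evenE)
      have "\<exists>k' \<le> 12 + nat (5 * W ^ 4). z (2 * k') = 0"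
        using zero unfolding k
        by (rule binary_recurrence_even_zero_bound[OF rec disc False _ W(1-3)]) (simp_all add: W(4))
      then obtain k' where "k' \<le> 12 + nat (5 * W ^ 4)" "z (2 * k') = 0" by blast
      then show ?thesis unfolding nat10 by (intro exI[of _ "2 * k'"]) simp
    next
      case odd: False
      then obtain k where k: "n = 2 * k + 1" by (rule oddE)
      have "\<exists>k' \<le> 12 + nat (5 * W ^ 4). z (Suc (2 * k')) = 0"
      proof (rule binary_recurrence_even_zero_bound[where z = "\<lambda>l. z (Suc l)", OF _ disc False])
        show "D * z (Suc (l + 2)) = s * z (Suc (l + 1)) - r * z (Suc l)" for l
          using rec[of "Suc l"] by simp
        show "\<bar>z (Suc 2)\<bar> \<le> W" using W(4)[of 3] by (simp add: eval_nat_numeral)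
        show "\<bar>z (Suc 0)\<bar> \<le> W" using W(4)[of 1] by simp
        show "z (Suc (2 * k)) = 0" using zero k by simp
      qed (fact W(1-3))+
      then obtain k' where "k' \<le> 12 + nat (5 * W ^ 4)" "z (Suc (2 * k')) = 0" by blast
      then show ?thesis unfolding nat10 by (intro exI[of _ "Suc (2 * k')"]) simp
    qed
  qed
qed

section \<open>Orbits of integer matrices\<close>

definition app :: "nat \<Rightarrow> (nat \<Rightarrow> nat \<Rightarrow> 'a :: comm_ring_1) \<Rightarrow> (nat \<Rightarrow> 'a) \<Rightarrow> nat \<Rightarrow> 'a" where
  "app d A v i = (if i < d then \<Sum>j<d. A i j * v j else 0)"

definition shift :: "nat \<Rightarrow> (nat \<Rightarrow> nat \<Rightarrow> 'a :: comm_ring_1) \<Rightarrow> 'a \<Rightarrow> (nat \<Rightarrow> 'a) \<Rightarrow> nat \<Rightarrow> 'a" where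
  "shift d A l v i = app d A v i - l * v i"

text \<open>This is the polynomial with root list \<open>ls\<close>, evaluated at \<open>A\<close>
  and applied to a vector. Multiplicity is the number of occurrences, and division by a linear
  factor is \<open>remove1\<close>.\<close>

abbreviation shifts :: "nat \<Rightarrow> (nat \<Rightarrow> nat \<Rightarrow> 'a :: comm_ring_1) \<Rightarrow> 'a list \<Rightarrow> (nat \<Rightarrow> 'a) \<Rightarrow> nat \<Rightarrow> 'a" where
  "shifts d A \<equiv> foldr (shift d A)"

definition supported :: "nat \<Rightarrow> (nat \<Rightarrow> 'a :: zero) \<Rightarrow> bool" where
  "supported d v \<longleftrightarrow> (\<forall>i\<ge>d. v i = 0)"

lemma supported_app [simp]: "supported d (app d A v)"
  by (simp add: supported_def app_def)

lemma supported_shift: "supported d v \<Longrightarrow> supported d (shift d A l v)"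
  by (simp add: supported_def app_def shift_def)

lemma supported_shifts: "supported d v \<Longrightarrow> supported d (shifts d A ls v)"
  by (induction ls) (auto intro: supported_shift)

lemma supported_app_funpow: "supported d v \<Longrightarrow> supported d ((app d A ^^ n) v)"
  by (cases n) auto

lemma app_scale: "app d A (\<lambda>i. c * v i) = (\<lambda>i. c * app d A v i)"
  by (rule ext) (simp add: app_def sum_distrib_left mult.left_commute)

lemma app_funpow_scale: "(app d A ^^ n) (\<lambda>i. c * v i) = (\<lambda>i. c * (app d A ^^ n) v i)"
  by (induction n) (simp_all add: app_scale)

lemma app_diff: "app d A (\<lambda>i. v i - w i) = (\<lambda>i. app d A v i - app d A w i)"
  by (rule ext) (simp add: app_def sum_subtractf right_diff_distrib)

lemma app_shift: "app d A (shift d A l v) = shift d A l (app d A v)"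
proof -
  have "app d A (shift d A l v) = app d A (\<lambda>i. app d A v i - l * v i)"
    by (simp add: shift_def[abs_def])
  also have "\<dots> = shift d A l (app d A v)"
    unfolding app_diff app_scale by (simp add: shift_def[abs_def])
  finally show ?thesis .
qed

lemma shift_commute: "shift d A l (shift d A k v) = shift d A k (shift d A l v)"
  unfolding shift_def[abs_def] app_diff app_scale by (simp add: algebra_simps)

lemma app_shifts: "app d A (shifts d A ls v) = shifts d A ls (app d A v)"
  by (induction ls) (simp_all add: app_shift)

lemma app_funpow_shifts: "(app d A ^^ n) (shifts d A ls v) = shifts d A ls ((app d A ^^ n) v)"
  by (induction n) (simp_all add: app_shifts)

lemma shift_scale: "shift d A l (\<lambda>i. c * v i) = (\<lambda>i. c * shift d A l v i)"
  by (rule ext) (simp add: shift_def app_scale algebra_simps)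

lemma shifts_scale: "shifts d A ls (\<lambda>i. c * v i) = (\<lambda>i. c * shifts d A ls v i)"
  by (induction ls) (simp_all add: shift_scale)

lemma shifts_zero: "shifts d A ls (\<lambda>i. 0) = (\<lambda>i. 0)"
  using shifts_scale[of d A ls 0 "\<lambda>i. 0"] by simp

lemma shifts_remove1:
  "l \<in> set ls \<Longrightarrow> shifts d A ls v = shift d A l (shifts d A (remove1 l ls) v)"
  by (induction ls) (auto simp: shift_commute[of d A l])

lemma shift_eq_zeroD: "shift d A l v = (\<lambda>i. 0) \<Longrightarrow> app d A v = (\<lambda>i. l * v i)"
  by (auto simp: shift_def fun_eq_iff)

lemma app_funpow_eigen:
  assumes "app d A v = (\<lambda>i. l * v i)"
  shows "(app d A ^^ n) v = (\<lambda>i. l ^ n * v i)"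
proof (induction n)
  case (Suc n)
  then show ?case using assms app_scale[of d A "l ^ n" v] by (simp add: mult_ac)
qed simp

lemma app_app:
  "app d A (app d B v) = app d (\<lambda>i j. \<Sum>k<d. A i k * B k j) v"
proof (rule ext)
  fix i
  show "app d A (app d B v) i = app d (\<lambda>i j. \<Sum>k<d. A i k * B k j) v i"
  proof (cases "i < d")
    case True
    have "app d A (app d B v) i = (\<Sum>k<d. \<Sum>j<d. A i k * B k j * v j)"
      using True by (simp add: app_def sum_distrib_left mult.assoc)
    also have "\<dots> = (\<Sum>j<d. \<Sum>k<d. A i k * B k j * v j)" by (rule sum.swap)
    finally show ?thesis using True by (simp add: app_def sum_distrib_right)
  qed (simp add: app_def)
qed

text \<open>The factor for index \<open>t\<close> takes vectors supported below \<open>Suc t\<close>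
  to vectors supported below \<open>t\<close>. The factors act from the last diagonal entry to the
  first and leave nothing.\<close>

lemma upper_triangular_shifts_zero:
  assumes B: "\<And>i j. j < i \<Longrightarrow> i < d \<Longrightarrow> B i j = 0" and v: "supported d v"
  shows "shifts d B (map (\<lambda>k. B k k) [0..<d]) v = (\<lambda>i. 0)"
proof -
  have "t \<le> d \<Longrightarrow> supported t (shifts d B (map (\<lambda>k. B k k) [t..<d]) v)" for t
  proof (induction "d - t" arbitrary: t)
    case 0
    then show ?case using v by simp
  next
    case (Suc k)
    then have t: "t < d" by simp
    define w where "w = shifts d B (map (\<lambda>k. B k k) [Suc t..<d]) v"
    have "supported (Suc t) w" unfolding w_def by (rule Suc.hyps(1)) (use Suc t in auto)
    then have w: "w j = 0" if "j > t" for j using that by (simp add: supported_def)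
    have "shift d B (B t t) w i = 0" if "t \<le> i" for i
    proof (cases "i < d")
      case True
      have "(\<Sum>j<d. B i j * w j) = (\<Sum>j<d. if j = t then B i t * w t else 0)"
      proof (rule sum.cong)
        fix j assume "j \<in> {..<d}"
        show "B i j * w j = (if j = t then B i t * w t else 0)"
          using w[of j] B[of j i] that True by (cases j t rule: linorder_cases) auto
      qed simp
      then have "app d B w i = B i t * w t" using True t by (simp add: app_def)
      then show ?thesis using that w[of i] B[of t i] True
        by (cases "i = t") (auto simp: shift_def)
    qed (use w t in \<open>auto simp: shift_def app_def\<close>)
    then show ?case using t by (simp add: upt_conv_Cons supported_def w_def)
  qed
  from this[of 0] show ?thesis by (auto simp: supported_def)
qed

text \<open>A Schur form \<open>B\<close> of the matrix satisfies \<open>Q * M = B * Q\<close> with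
  invertible \<open>Q\<close>, which carries the triangular case back. The list found here
  guarantees that a shortest one exists and has length at most \<open>d\<close>.\<close>

lemma annihilating_shifts_exist:
  fixes A :: "nat \<Rightarrow> nat \<Rightarrow> complex"
  assumes v: "supported d v"
  shows "\<exists>ls. length ls = d \<and> shifts d A ls v = (\<lambda>i. 0)"
proof -
  define M where "M = mat d d (\<lambda>(i, j). A i j)"
  have M: "M \<in> carrier_mat d d" by (simp add: M_def)
  obtain as where "char_poly M = (\<Prod>a\<leftarrow>as. [:- a, 1:])"
    using char_poly_factorized[OF M] by blast
  from schur_decomposition_exists[OF M this] obtain B where
    B: "B \<in> carrier_mat d d" "upper_triangular B" "similar_mat M B" by blast
  from B(3) obtain P Q where wit: "similar_mat_wit M B P Q" unfolding similar_mat_def by blast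
  note PQ = similar_mat_witD2[OF M wit]
  have P: "P \<in> carrier_mat d d" and Q: "Q \<in> carrier_mat d d" using PQ by auto
  have "Q * M = Q * (P * B * Q)" using PQ(3) by simp
  also have "\<dots> = Q * P * B * Q"
    using P Q B(1) by (simp add: assoc_mult_mat[of _ d d _ d _ d])
  also have "\<dots> = B * Q" using PQ(2) B(1) by simp
  finally have QM: "Q * M = B * Q" .
  define Qf where "Qf i j = Q $$ (i, j)" for i j
  define Pf where "Pf i j = P $$ (i, j)" for i j
  define Bf where "Bf i j = B $$ (i, j)" for i j
  have "(Q * M) $$ (i, j) = (\<Sum>k<d. Qf i k * A k j)" if "i < d" "j < d" for i j
    using that Q M by (simp add: scalar_prod_def Qf_def M_def atLeast0LessThan)
  moreover have "(B * Q) $$ (i, j) = (\<Sum>k<d. Bf i k * Qf k j)" if "i < d" "j < d" for i j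
    using that Q B(1) by (simp add: scalar_prod_def Qf_def Bf_def atLeast0LessThan)
  ultimately have QA: "(\<Sum>k<d. Qf i k * A k j) = (\<Sum>k<d. Bf i k * Qf k j)" if "i < d" "j < d" for i j
    using that QM by metis
  have intertwine: "app d Qf (app d A w) = app d Bf (app d Qf w)" for w
    unfolding app_app by (rule ext) (auto simp: app_def QA intro!: sum.cong)
  have shift: "app d Qf (shift d A l w) = shift d Bf l (app d Qf w)" for l w
    unfolding shift_def[abs_def] app_diff app_scale intertwine ..
  have shifts: "app d Qf (shifts d A ls w) = shifts d Bf ls (app d Qf w)" for ls w
    by (induction ls) (simp_all add: shift)
  have PQf: "(\<Sum>k<d. Pf i k * Qf k j) = (if i = j then 1 else 0)" if "i < d" "j < d" for i j
  proof -
    have "(P * Q) $$ (i, j) = (\<Sum>k<d. Pf i k * Qf k j)"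
      using that P Q by (simp add: scalar_prod_def Qf_def Pf_def atLeast0LessThan)
    then show ?thesis using PQ(1) that by simp
  qed
  have inv: "app d Pf (app d Qf w) = w" if "supported d w" for w
  proof (rule ext)
    fix i
    have "(\<Sum>j<d. (\<Sum>k<d. Pf i k * Qf k j) * w j) = (\<Sum>j<d. if i = j then w j else 0)" if "i < d"
      by (intro sum.cong) (auto simp: PQf that)
    then show "app d Pf (app d Qf w) i = w i"
      using that unfolding app_app by (auto simp: app_def supported_def)
  qed
  define ls where "ls = map (\<lambda>k. Bf k k) [0..<d]"
  have "shifts d Bf ls (app d Qf v) = (\<lambda>i. 0)" unfolding ls_def
    using B(1,2) by (intro upper_triangular_shifts_zero) (auto simp: Bf_def)
  then have "app d Qf (shifts d A ls v) = (\<lambda>i. 0)" by (simp add: shifts)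
  then have "app d Pf (\<lambda>i. 0) = shifts d A ls v"
    using inv[OF supported_shifts[OF v, of A ls]] by simp
  moreover have "app d Pf (\<lambda>i. 0) = (\<lambda>i. 0)" by (rule ext) (simp add: app_def)
  ultimately show ?thesis by (intro exI[of _ ls]) (simp add: ls_def)
qed

section \<open>Explicit bounds for expressions in the eigenvalues\<close>

definition dim_bound :: "nat \<Rightarrow> nat" where "dim_bound d = d ^ (2 * d)"

text \<open>\<open>dim_bound d\<close> bounds the dimension of the tensor product for up to
  \<open>d\<close> eigenvalues and their conjugates. Each of up to \<open>d\<close> shifts
  multiplies matrix entries by at most \<open>(d + dim_bound d) * M\<close>; the two further powers
  and the summand 2 absorb the initial entries and differences of squared moduli. The leading factor
  passes from entries to norms.\<close>

definition upper_bound :: "nat \<Rightarrow> nat \<Rightarrow> nat" where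
  "upper_bound d M = dim_bound d * ((d + dim_bound d + 2) * M) ^ (d + 2)"

text \<open>The power in \<open>acts_norm_ge\<close>, with \<open>upper_bound d M\<close> for
  \<open>B\<close> and \<open>dim_bound d\<close> for the exponent.\<close>

definition lower_bound :: "nat \<Rightarrow> nat \<Rightarrow> nat" where
  "lower_bound d M = upper_bound d M ^ dim_bound d"

definition tame :: "nat \<Rightarrow> nat \<Rightarrow> complex \<Rightarrow> bool" where
  "tame T H z \<longleftrightarrow> norm z \<le> T \<and> (z \<noteq> 0 \<longrightarrow> 1 \<le> norm z * H)"

lemma real_of_int_abs_le: "\<bar>x\<bar> \<le> int M \<Longrightarrow> real_of_int \<bar>x\<bar> \<le> real M"
  using of_int_le_iff[of "\<bar>x\<bar>" "int M", where ?'a = real] by (simp only: of_int_of_nat_eq)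

lemma acts_shifts:
  assumes I: "finite I" and A: "\<And>i j. i < d \<Longrightarrow> j < d \<Longrightarrow> \<bar>A i j\<bar> \<le> int M"
    and ls: "\<And>l. l \<in> set ls \<Longrightarrow> acts I w (real M) l"
    and u: "\<And>i. acts I w (real M) (u i)"
  shows "acts I w (real (M * ((d + card I) * M) ^ length ls)) (shifts d (\<lambda>i j. of_int (A i j)) ls u i)"
  using ls
proof (induction ls arbitrary: i)
  case Nil
  then show ?case using u by simp
next
  case (Cons l ls)
  let ?R = "real (M * ((d + card I) * M) ^ length ls)"
  let ?v = "shifts d (\<lambda>i j. of_int (A i j)) ls u"
  have IH: "acts I w ?R (?v j)" for j using Cons by simp
  \<comment> \<open>An integer coefficient scales the matrix directly and costs \<open>M\<close>;
    \<open>acts_mult\<close> would cost \<open>card I * M\<close>.\<close>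
  have entry: "acts I w (real M * ?R) (of_int (A i j) * ?v j)" if "i < d" "j < d" for j
  proof -
    obtain m where m: "\<forall>i\<in>I. ?v j * w i = (\<Sum>j\<in>I. of_int (m i j) * w j)"
      "\<forall>i\<in>I. \<forall>j\<in>I. real_of_int \<bar>m i j\<bar> \<le> ?R" using IH[of j] unfolding acts_def by blast
    have "real_of_int \<bar>A i j * m a b\<bar> \<le> real M * ?R" if "a \<in> I" "b \<in> I" for a b
    proof -
      have "real_of_int \<bar>A i j\<bar> * real_of_int \<bar>m a b\<bar> \<le> real M * ?R"
        using real_of_int_abs_le[OF A[OF \<open>i < d\<close> \<open>j < d\<close>]] m(2) that
        by (intro mult_mono) auto
      then show ?thesis by (simp only: abs_mult of_int_mult)
    qed
    then show ?thesis unfolding acts_def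
      by (intro exI[of _ "\<lambda>a b. A i j * m a b"]) (auto simp: m(1) sum_distrib_left mult.assoc)
  qed
  have "acts I w (d * (real M * ?R)) (app d (\<lambda>i j. of_int (A i j)) ?v i)"
  proof (cases "i < d")
    case True
    then show ?thesis using acts_sum[of "{..<d}" I w "real M * ?R" "\<lambda>j. of_int (A i j) * ?v j"] entry I
      by (simp add: app_def)
  next
    case False
    then show ?thesis using acts_mono[OF acts_of_int[OF I, of w 0]] by (simp add: app_def)
  qed
  moreover have "acts I w (card I * real M * ?R) (l * ?v i)"
    using Cons.prems I by (intro acts_mult IH) auto
  ultimately have "acts I w (d * (real M * ?R) + card I * real M * ?R)
      (shift d (\<lambda>i j. of_int (A i j)) l ?v i)"
    unfolding shift_def by (rule acts_diff)
  then show ?case by (simp add: algebra_simps)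
qed

text \<open>One module serves all three claims. It is built for \<open>ls\<close> together with the
  conjugates, which are eigenvalues too because \<open>A\<close> is real, so that squared moduli act
  on it.\<close>

lemma tame_bounds:
  assumes A: "\<And>i j. i < d \<Longrightarrow> j < d \<Longrightarrow> \<bar>A i j\<bar> \<le> int M" and "1 \<le> M" "1 \<le> d"
    and ls: "\<And>l. l \<in> set ls \<Longrightarrow> eig d A l" "length ls \<le> d"
  defines "T \<equiv> upper_bound d M" and "H \<equiv> lower_bound d M"
  shows "\<And>l. l \<in> set ls \<Longrightarrow> tame T H l"
    and "\<And>l k. l \<in> set ls \<Longrightarrow> k \<in> set ls \<Longrightarrow> tame T H (l * cnj l - k * cnj k)"
    and "\<And>G u i. set G \<subseteq> set ls \<Longrightarrow> length G \<le> d \<Longrightarrow> (\<And>i. \<bar>u i\<bar> \<le> int M) \<Longrightarrow>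
           tame T H (shifts d (\<lambda>i j. of_int (A i j)) G (\<lambda>i. of_int (u i)) i)"
proof -
  have cnj: "eig d A (cnj l)" if "eig d A l" for l
  proof -
    obtain v where v: "\<exists>i<d. v i \<noteq> 0" "\<forall>i<d. l * v i = (\<Sum>j<d. of_int (A i j) * v j)"
      using \<open>eig d A l\<close> unfolding eig_def by blast
    have "cnj l * cnj (v i) = (\<Sum>j<d. of_int (A i j) * cnj (v j))" if "i < d" for i
      using arg_cong[OF v(2)[rule_format, OF that], of cnj] by simp
    then show ?thesis using v(1) unfolding eig_def by (intro exI[of _ "\<lambda>i. cnj (v i)"]) auto
  qed
  obtain I :: "nat list set" and w where I: "finite I" "card I = d ^ length (ls @ map cnj ls)"
    "\<exists>i\<in>I. w i \<noteq> 0" "\<forall>l\<in>set (ls @ map cnj ls). acts I w (real M) l"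
  proof -
    have "\<And>l. l \<in> set (ls @ map cnj ls) \<Longrightarrow> eig d A l" using ls(1) cnj by auto
    from eig_common_acts[of d A "real M", OF real_of_int_abs_le[OF A] of_nat_0_le_iff this] that
    show ?thesis by blast
  qed
  define K where "K = dim_bound d"
  have cardI: "card I \<le> K" unfolding K_def dim_bound_def I(2)
    using ls(2) \<open>1 \<le> d\<close> by (intro power_increasing) auto
  have K1: "1 \<le> K" using \<open>1 \<le> d\<close> unfolding K_def dim_bound_def by simp
  define q where "q = (d + K + 2) * M"
  define Q where "Q = q ^ (d + 2)"
  have T: "T = K * Q" and H: "H = T ^ K"
    by (simp_all add: T_def H_def upper_bound_def lower_bound_def K_def Q_def q_def)
  have q1: "1 \<le> q" using \<open>1 \<le> M\<close> by (simp add: q_def)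
  then have Q1: "1 \<le> Q" by (simp add: Q_def)
  have T1: "1 \<le> T" using K1 Q1 by (simp add: T)
  have tame: "tame T H z" if z: "acts I w (real R) z" and R: "R \<le> Q" for z R
  proof -
    have KR: "real (card I * R) \<le> real T"
      unfolding T of_nat_le_iff by (intro mult_le_mono cardI R)
    have "norm z \<le> real T" using acts_norm_le[OF z I(1,3)] KR by simp
    moreover have "1 \<le> norm z * real H" if "z \<noteq> 0"
    proof -
      have "1 \<le> norm z * real T ^ card I"
        using KR T1 by (intro acts_norm_ge[OF z I(1,3) that]) auto
      also have "\<dots> \<le> norm z * real T ^ K"
        using T1 cardI by (intro mult_left_mono power_increasing) auto
      finally show ?thesis by (simp add: H)
    qed
    ultimately show ?thesis by (simp add: tame_def)
  qed
  have MQ: "M \<le> Q"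
  proof -
    have "M \<le> q" by (simp add: q_def)
    also have "\<dots> \<le> Q" unfolding Q_def using q1 by (intro self_le_power) auto
    finally show ?thesis .
  qed
  show "tame T H l" if "l \<in> set ls" for l
    using I(4) that MQ by (intro tame[of M]) auto
  show "tame T H (l * cnj l - k * cnj k)" if "l \<in> set ls" "k \<in> set ls" for l k
  proof (rule tame)
    have "acts I w (card I * real M * real M + card I * real M * real M) (l * cnj l - k * cnj k)"
      using I(1,4) that by (intro acts_diff acts_mult) auto
    then show "acts I w (real (2 * card I * M * M)) (l * cnj l - k * cnj k)"
      by (simp add: mult_ac)
    have "2 * card I * M * M \<le> q * q"
    proof -
      have "2 * card I * M * M = (2 * M) * (card I * M)" by simp
      also have "\<dots> \<le> q * q" unfolding q_def using cardI by (intro mult_le_mono) auto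
      finally show ?thesis .
    qed
    also have "\<dots> = q ^ 2" by (simp add: power2_eq_square)
    also have "\<dots> \<le> Q" unfolding Q_def using q1 by (intro power_increasing) auto
    finally show "2 * card I * M * M \<le> Q" .
  qed
  show "tame T H (shifts d (\<lambda>i j. of_int (A i j)) G (\<lambda>i. of_int (u i)) i)"
    if G: "set G \<subseteq> set ls" "length G \<le> d" and u: "\<And>i. \<bar>u i\<bar> \<le> int M" for G u i
  proof (rule tame)
    show "acts I w (real (M * ((d + card I) * M) ^ length G))
        (shifts d (\<lambda>i j. of_int (A i j)) G (\<lambda>i. of_int (u i)) i)"
    proof (rule acts_shifts[OF I(1) A])
      show "acts I w (real M) l" if "l \<in> set G" for l using I(4) G(1) that by auto
      show "acts I w (real M) (of_int (u i))" for i
        using real_of_int_abs_le[OF u] by (intro acts_mono[OF acts_of_int[OF I(1)]]) simp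
    qed
    have "M * ((d + card I) * M) ^ length G \<le> q * q ^ length G"
      unfolding q_def using cardI by (intro mult_le_mono power_mono) auto
    also have "\<dots> = q ^ Suc (length G)" by simp
    also have "\<dots> \<le> Q" unfolding Q_def using q1 G(2) by (intro power_increasing) auto
    finally show "M * ((d + card I) * M) ^ length G \<le> Q" .
  qed
qed

section \<open>Bounds in the separate cases: conjugate pair, different moduli, Jordan chain\<close>

definition par :: "nat \<Rightarrow> (nat \<Rightarrow> 'a :: comm_ring_1) \<Rightarrow> (nat \<Rightarrow> 'a) \<Rightarrow> bool" where
  "par d v u \<longleftrightarrow> (\<forall>i<d. \<forall>j<d. v i * u j = v j * u i)"

lemma par_imp_multiple:
  fixes u v :: "nat \<Rightarrow> 'a :: field"
  assumes "par d v u" "supported d v" "supported d u" "i < d" "u i \<noteq> 0"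
  shows "v = (\<lambda>j. (v i / u i) * u j)"
proof (rule ext)
  fix j
  show "v j = (v i / u i) * u j"
  proof (cases "j < d")
    case True
    then have "v j * u i = v i * u j" using assms(1,4) by (simp add: par_def)
    then show ?thesis using assms(5) by (simp add: field_simps)
  qed (use assms in \<open>simp add: supported_def\<close>)
qed

text \<open>All \<open>Y l\<close> lie in the plane of \<open>Y 0\<close> and \<open>Y 1\<close>,
  and so does \<open>u\<close>, a multiple of \<open>Y n\<close>. In a plane a single minor decides
  parallelism, and this minor is a scalar binary recurrence in \<open>l\<close>.\<close>

lemma quadratic_orbit_bound:
  fixes Y :: "nat \<Rightarrow> nat \<Rightarrow> int" and s r :: real
  assumes rec: "\<And>l i. i < d \<Longrightarrow> real_of_int (Y (l + 2) i) = s * Y (l + 1) i - r * Y l i"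
    and disc: "s\<^sup>2 < 4 * r"
    and ij: "i < d" "j < d" "Y 1 i * Y 0 j \<noteq> Y 1 j * Y 0 i"
    and W: "\<And>l i. l \<le> 3 \<Longrightarrow> i < d \<Longrightarrow> \<bar>Y l i\<bar> \<le> W" "\<And>i. i < d \<Longrightarrow> \<bar>u i\<bar> \<le> W"
    and sol: "par d (Y n) u" "a < d" "Y n a \<noteq> 0"
  shows "\<exists>n' \<le> 25 + nat (10 * (2 * W\<^sup>2) ^ 4). par d (Y n') u"
proof -
  define det where "det v w = v i * w j - v j * w i" for v w :: "nat \<Rightarrow> int"
  have "\<exists>(b :: real) (c :: real). \<forall>k<d. Y l k = b * Y 0 k + c * Y 1 k" for l
  proof (induction l rule: induct_nat_012)
    case 0
    show ?case by (rule exI[of _ 1], rule exI[of _ 0]) simp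
  next
    case 1
    show ?case by (rule exI[of _ 0], rule exI[of _ 1]) simp
  next
    case (ge2 l)
    then obtain b c b' c' where
      *: "\<forall>k<d. real_of_int (Y l k) = b * real_of_int (Y 0 k) + c * real_of_int (Y 1 k)"
        "\<forall>k<d. real_of_int (Y (Suc l) k) = b' * real_of_int (Y 0 k) + c' * real_of_int (Y 1 k)"
      by blast
    show ?case
    proof (intro exI allI impI)
      fix k assume "k < d"
      then have "real_of_int (Y (Suc (Suc l)) k) = s * Y (Suc l) k - r * Y l k"
        using rec[of k l] by simp
      then show "real_of_int (Y (Suc (Suc l)) k) = (s * b' - r * b) * Y 0 k + (s * c' - r * c) * Y 1 k"
        using *[rule_format, OF \<open>k < d\<close>] by (simp add: algebra_simps)
    qed
  qed
  then obtain b c where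
    span: "\<And>l k. k < d \<Longrightarrow> real_of_int (Y l k) = b l * real_of_int (Y 0 k) + c l * real_of_int (Y 1 k)" by metis
  define t where "t = real_of_int (u a) / Y n a"
  have u: "real_of_int (u k) = t * b n * Y 0 k + t * c n * Y 1 k" if "k < d" for k
  proof -
    have "Y n k * u a = Y n a * u k" using sol that by (simp add: par_def)
    then have "real_of_int (Y n k) * u a = real_of_int (Y n a) * u k"
      by (simp only: flip: of_int_mult)
    then have "real_of_int (u k) = t * Y n k" using sol(3) by (simp add: t_def field_simps)
    then show ?thesis using span[OF that, of n] by (simp add: algebra_simps)
  qed
  have par: "par d (Y l) u" if z: "det (Y l) u = 0" for l
  proof -
    \<comment> \<open>The determinant of the coordinates of \<open>Y l\<close> and \<open>u\<close>
      in terms of \<open>Y 0\<close> and \<open>Y 1\<close>. Every minor of the pair is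
      \<open>e\<close> times the corresponding minor of \<open>Y 0\<close> and
      \<open>Y 1\<close>.\<close>
    define e where "e = b l * (t * c n) - c l * (t * b n)"
    have minor: "real_of_int (Y l p) * u q - real_of_int (Y l q) * u p =
        e * (real_of_int (Y 0 p) * Y 1 q - real_of_int (Y 0 q) * Y 1 p)" if "p < d" "q < d" for p q
      unfolding u[OF that(1)] u[OF that(2)] span[OF that(1), of l] span[OF that(2), of l] e_def
      by (simp add: algebra_simps)
    have "real_of_int (Y l i) * u j - real_of_int (Y l j) * u i = 0"
      using z unfolding det_def by (simp flip: of_int_mult of_int_diff)
    moreover have "real_of_int (Y 0 i * Y 1 j - Y 0 j * Y 1 i) \<noteq> 0"
      using ij(3) unfolding of_int_eq_0_iff by (simp add: mult.commute)
    ultimately have "e = 0" using minor[OF ij(1,2)] by simp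
    then have "real_of_int (Y l p) * u q - real_of_int (Y l q) * u p = 0" if "p < d" "q < d" for p q
      using minor[OF that] by simp
    then have "real_of_int (Y l p * u q) = real_of_int (Y l q * u p)" if "p < d" "q < d" for p q
      using that by simp
    then show ?thesis unfolding par_def of_int_eq_iff by blast
  qed
  \<comment> \<open>Cramer's rule: the real coefficients \<open>s\<close> and \<open>r\<close>
    become ratios of integers with denominator \<open>D\<close>.\<close>
  define D where "D = det (Y 1) (Y 0)"
  define s' where "s' = det (Y 2) (Y 0)"
  define r' where "r' = det (Y 2) (Y 1)"
  have det_rec: "real_of_int (det (Y (l + 2)) w) = s * det (Y (l + 1)) w - r * det (Y l) w" for l w
    unfolding det_def of_int_diff of_int_mult rec[OF ij(1)] rec[OF ij(2)]
    by (simp add: algebra_simps)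
  have D0: "D \<noteq> 0" using ij(3) by (simp add: D_def det_def)
  have sD: "real_of_int s' = s * D"
    using det_rec[of 0 "Y 0"] by (simp add: s'_def D_def det_def mult.commute numeral_2_eq_2)
  have rD: "real_of_int r' = r * D"
    using det_rec[of 0 "Y 1"] by (simp add: r'_def D_def det_def algebra_simps numeral_2_eq_2)
  have "\<exists>n' \<le> 25 + nat (10 * (2 * W\<^sup>2) ^ 4). det (Y n') u = 0"
  proof (rule binary_recurrence_zero_bound[where D = D and s = s' and r = r'])
    show "D * det (Y (l + 2)) u = s' * det (Y (l + 1)) u - r' * det (Y l) u" for l
    proof -
      have "real_of_int (D * det (Y (l + 2)) u) =
          real_of_int (s' * det (Y (l + 1)) u - r' * det (Y l) u)"
        unfolding of_int_mult of_int_diff det_rec sD rD by (simp add: algebra_simps)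
      then show ?thesis by (simp only: of_int_eq_iff)
    qed
    have "s\<^sup>2 * (real_of_int D)\<^sup>2 < 4 * r * (real_of_int D)\<^sup>2"
      using disc D0 by (intro mult_strict_right_mono) auto
    then have "real_of_int (s'\<^sup>2) < real_of_int (4 * r' * D)"
      by (simp add: sD rD power2_eq_square algebra_simps)
    then show "s'\<^sup>2 < 4 * r' * D" by (simp only: of_int_less_iff)
    show "det (Y n) u = 0" using sol ij by (simp add: par_def det_def)
    have bound: "\<bar>det v w\<bar> \<le> 2 * W\<^sup>2"
      if "\<And>i. i < d \<Longrightarrow> \<bar>v i\<bar> \<le> W" "\<And>i. i < d \<Longrightarrow> \<bar>w i\<bar> \<le> W" for v w
    proof -
      have "\<bar>v k * w l\<bar> \<le> W\<^sup>2" if "k < d" "l < d" for k l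
      proof -
        have "\<bar>v k\<bar> * \<bar>w l\<bar> \<le> W * W"
          using \<open>\<And>i. i < d \<Longrightarrow> \<bar>v i\<bar> \<le> W\<close>[OF that(1)] \<open>\<And>i. i < d \<Longrightarrow> \<bar>w i\<bar> \<le> W\<close>[OF that(2)]
          by (intro mult_mono) auto
        then show ?thesis by (simp add: abs_mult power2_eq_square)
      qed
      from this[OF ij(1,2)] this[OF ij(2,1)] show ?thesis unfolding det_def by linarith
    qed
    show "\<bar>D\<bar> \<le> 2 * W\<^sup>2" "\<bar>s'\<bar> \<le> 2 * W\<^sup>2" "\<bar>r'\<bar> \<le> 2 * W\<^sup>2"
      unfolding D_def s'_def r'_def using W(1) by (auto intro!: bound)
    show "\<bar>det (Y l) u\<bar> \<le> 2 * W\<^sup>2" if "l \<le> 3" for l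
      using W that by (intro bound) auto
  qed
  then show ?thesis using par by blast
qed

text \<open>Eliminating \<open>c\<close> bounds \<open>(norm l / norm k) ^ n\<close> by
  \<open>T\<^sup>2 * H\<^sup>2\<close>. The gap is measured between squared moduli, because their
  difference \<open>l * cnj l - k * cnj k\<close> is tame and hence at least
  \<open>1 / H\<close>.\<close>

lemma distinct_modulus_bound:
  fixes l k c e e' q q' :: complex
  assumes eq: "l ^ n * e = c * q" "k ^ n * e' = c * q'"
    and nz: "c \<noteq> 0" "e \<noteq> 0" "e' \<noteq> 0" "k \<noteq> 0" and less: "norm k < norm l"
    and tame: "tame T H k" "tame T H (l * cnj l - k * cnj k)" "tame T H e" "tame T H e'"
      "tame T H q" "tame T H q'"
  shows "n \<le> T ^ 6 * H ^ 5"
proof -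
  have "c * (l ^ n * e * q') = c * (k ^ n * e' * q)" using eq by (simp add: algebra_simps)
  then have cross: "l ^ n * e * q' = k ^ n * e' * q" using nz(1) by simp
  have "q' \<noteq> 0" using eq(2) nz by auto
  have T0: "0 \<le> real T" and H0: "0 \<le> real H" by simp_all
  have "norm l ^ n * 1 * 1 \<le> norm l ^ n * (norm e * H) * (norm q' * H)"
    using tame(3,6) nz(2) \<open>q' \<noteq> 0\<close> unfolding tame_def
    by (intro mult_mono order_refl mult_nonneg_nonneg zero_le_power norm_ge_zero) auto
  also have "\<dots> = norm (l ^ n * e * q') * H\<^sup>2"
    by (simp add: norm_mult norm_power power2_eq_square)
  also have "\<dots> = norm k ^ n * (norm e' * norm q) * H\<^sup>2"
    unfolding cross by (simp add: norm_mult norm_power)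
  also have "\<dots> \<le> norm k ^ n * (T * T) * H\<^sup>2"
  proof -
    have "norm e' * norm q \<le> real T * real T"
      using tame(4,5) unfolding tame_def by (intro mult_mono) auto
    then show ?thesis by (simp add: mult_left_mono mult_right_mono)
  qed
  finally have le: "norm l ^ n \<le> norm k ^ n * ((real T)\<^sup>2 * (real H)\<^sup>2)"
    by (simp add: power2_eq_square)
  have k0: "0 < (norm k)\<^sup>2" using nz(4) by simp
  define \<delta> where "\<delta> = (norm l)\<^sup>2 - (norm k)\<^sup>2"
  have dpos: "0 < \<delta>" using less by (simp add: \<delta>_def power_strict_mono)
  have "l * cnj l - k * cnj k = complex_of_real \<delta>"
    by (simp add: \<delta>_def complex_norm_square[symmetric])
  then have d: "1 \<le> \<delta> * H" using tame(2) dpos unfolding tame_def by simp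
  have "(norm l ^ n)\<^sup>2 \<le> (norm k ^ n * ((real T)\<^sup>2 * (real H)\<^sup>2))\<^sup>2"
    using le by (intro power_mono) auto
  then have "((norm l)\<^sup>2) ^ n \<le> ((norm k)\<^sup>2) ^ n * (real T ^ 4 * real H ^ 4)"
    by (simp add: power_mult_distrib flip: power_mult) (simp add: mult.commute)
  then have "((norm l)\<^sup>2 / (norm k)\<^sup>2) ^ n \<le> real T ^ 4 * real H ^ 4"
    using k0 by (simp add: power_divide divide_le_eq mult.commute)
  moreover have "(norm l)\<^sup>2 / (norm k)\<^sup>2 = 1 + \<delta> / (norm k)\<^sup>2"
    using k0 by (simp add: \<delta>_def field_simps)
  \<comment> \<open>Bernoulli's inequality avoids logarithms and keeps the bound polynomial in
    \<open>T\<close> and \<open>H\<close>.\<close>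
  moreover have "1 + n * (\<delta> / (norm k)\<^sup>2) \<le> (1 + \<delta> / (norm k)\<^sup>2) ^ n"
    using dpos k0 by (intro Bernoulli_inequality) (simp add: order_trans[OF _ divide_nonneg_pos])
  ultimately have "1 + n * (\<delta> / (norm k)\<^sup>2) \<le> real T ^ 4 * real H ^ 4" by simp
  then have "n * (\<delta> / (norm k)\<^sup>2) \<le> real T ^ 4 * real H ^ 4" by simp
  then have "n * \<delta> \<le> real T ^ 4 * real H ^ 4 * (norm k)\<^sup>2"
    using k0 by (simp add: field_simps)
  also have "\<dots> \<le> real T ^ 4 * real H ^ 4 * real T ^ 2"
    using tame(1) unfolding tame_def by (intro mult_left_mono power_mono) auto
  finally have nd: "n * \<delta> \<le> real T ^ 6 * real H ^ 4" by (simp add: eval_nat_numeral mult_ac)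
  have "real n * 1 \<le> n * (\<delta> * H)" using d by (intro mult_left_mono) auto
  also have "\<dots> \<le> real T ^ 6 * real H ^ 4 * H" using mult_right_mono[OF nd H0] by simp
  also have "\<dots> = real (T ^ 6 * H ^ 5)" by (simp add: eval_nat_numeral)
  finally show ?thesis by (simp only: mult_1_right of_nat_le_iff)
qed

text \<open>Cancelling \<open>l ^ n\<close> between the two equations leaves
  \<open>n * (e * q) = l * (p * e - a * q)\<close>: the right side is bounded, and
  \<open>e * q\<close> stays away from 0.\<close>

lemma jordan_block_bound:
  fixes l c a e p q :: complex
  assumes eq: "l ^ n * e = c * q" "l ^ n * (l * a + of_nat n * e) = l * (c * p)"
    and nz: "l \<noteq> 0" "e \<noteq> 0"
    and tame: "tame T H l" "tame T H a" "tame T H e" "tame T H p" "tame T H q"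
  shows "n \<le> 2 * T ^ 3 * H\<^sup>2"
proof -
  have "q \<noteq> 0" using eq(1) nz by auto
  have "l ^ n * ((l * a + of_nat n * e) * q) = l ^ n * (l * p * e)"
  proof -
    have "l ^ n * ((l * a + of_nat n * e) * q) = l * p * (c * q)" using eq(2) by (simp flip: mult.assoc)
    also have "\<dots> = l ^ n * (l * p * e)" unfolding eq(1)[symmetric] by simp
    finally show ?thesis .
  qed
  then have "(l * a + of_nat n * e) * q = l * p * e" using nz(1) by simp
  then have "of_nat n * (e * q) = l * (p * e - a * q)" by (simp add: algebra_simps)
  then have "norm (of_nat n * (e * q)) = norm l * norm (p * e - a * q)" by (simp only: norm_mult)
  also have "\<dots> \<le> real T * (real T * real T + real T * real T)"
  proof (intro mult_mono order_trans[OF norm_triangle_ineq4] add_mono)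
    show "norm (p * e) \<le> real T * real T" "norm (a * q) \<le> real T * real T"
      using tame unfolding tame_def norm_mult by (auto intro!: mult_mono)
  qed (use tame in \<open>auto simp: tame_def\<close>)
  finally have le: "real n * (norm e * norm q) \<le> 2 * real T ^ 3"
    by (simp add: norm_mult eval_nat_numeral algebra_simps)
  have "real n * (1 * 1) \<le> real n * ((norm e * H) * (norm q * H))"
    using tame(3,5) nz(2) \<open>q \<noteq> 0\<close> unfolding tame_def by (intro mult_left_mono mult_mono) auto
  also have "\<dots> = real n * (norm e * norm q) * (real H)\<^sup>2" by (simp add: power2_eq_square)
  also have "\<dots> \<le> 2 * real T ^ 3 * (real H)\<^sup>2" using le by (intro mult_right_mono) auto
  finally have "real n \<le> real (2 * T ^ 3 * H\<^sup>2)" by simp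
  then show ?thesis by (simp only: of_nat_le_iff)
qed

text \<open>A shortest root list stands for the polynomial of least degree that kills
  \<open>v\<close>.\<close>

lemma minimal_shifts_exist:
  fixes A :: "nat \<Rightarrow> nat \<Rightarrow> complex"
  assumes "supported d v"
  obtains ls where "length ls \<le> d" "shifts d A ls v = (\<lambda>i. 0)"
    "\<And>ks. length ks < length ls \<Longrightarrow> shifts d A ks v \<noteq> (\<lambda>i. 0)"
proof -
  let ?P = "\<lambda>ls. shifts d A ls v = (\<lambda>i. 0)"
  obtain as where as: "length as = d" "?P as"
    using annihilating_shifts_exist[OF assms] by blast
  define ls where "ls = arg_min length ?P"
  have "?P ls" unfolding ls_def using as(2) by (rule arg_min_natI)
  moreover have min: "length ls \<le> length ks" if "?P ks" for ks
    unfolding ls_def using that by (rule arg_min_nat_le)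
  moreover have "length ls \<le> d" using min[OF as(2)] as(1) by simp
  ultimately show ?thesis by (intro that[of ls]) (auto simp: not_less[symmetric])
qed

lemma shift_shifts: "shift d A l (shifts d A ls v) = shifts d A ls (shift d A l v)"
  by (induction ls) (simp_all add: shift_commute[of d A l])

lemma shifts_filter:
  "shifts d A ls v = shifts d A (filter P ls) (shifts d A (filter (\<lambda>l. \<not> P l) ls) v)"
  by (induction ls) (simp_all add: shift_shifts)

lemma shifts_replicate_zero: "shifts d A (replicate n 0) v = (app d A ^^ n) v"
proof (induction n)
  case (Suc n)
  then show ?case by (simp add: shift_def[abs_def])
qed simp

lemma of_int_app_funpow:
  "(app d (\<lambda>i j. of_int (A i j)) ^^ n) (\<lambda>i. of_int (v i)) = (\<lambda>i. of_int ((app d A ^^ n) v i))"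
proof (induction n)
  case (Suc n)
  then show ?case by (auto simp: app_def fun_eq_iff)
qed simp

lemma app_funpow_bound:
  fixes A :: "nat \<Rightarrow> nat \<Rightarrow> int"
  assumes A: "\<And>i j. i < d \<Longrightarrow> j < d \<Longrightarrow> \<bar>A i j\<bar> \<le> int M" and v: "\<And>i. \<bar>v i\<bar> \<le> int M"
  shows "\<bar>(app d A ^^ n) v i\<bar> \<le> int (M * (d * M) ^ n)"
proof (induction n arbitrary: i)
  case (Suc n)
  let ?w = "(app d A ^^ n) v"
  have "\<bar>app d A ?w i\<bar> \<le> int d * (int M * int (M * (d * M) ^ n))"
  proof (cases "i < d")
    case True
    have "\<bar>\<Sum>j<d. A i j * ?w j\<bar> \<le> (\<Sum>j<d. \<bar>A i j * ?w j\<bar>)" by (rule sum_abs)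
    also have "\<dots> \<le> (\<Sum>j<d. int M * int (M * (d * M) ^ n))"
      using A True Suc unfolding abs_mult by (intro sum_mono mult_mono) auto
    finally show ?thesis using True by (simp add: app_def)
  qed (simp add: app_def)
  then show ?case by (simp add: algebra_simps)
qed (use v in simp)

text \<open>Removing one root \<open>l\<close> from a shortest list leaves an eigenvector
  \<open>w \<noteq> 0\<close>, and \<open>l ^ n * w = 0\<close> forces \<open>l = 0\<close>. The
  polynomial is thus a power of the variable of degree at most \<open>d\<close>.\<close>

lemma orbit_zero_bound:
  fixes A :: "nat \<Rightarrow> nat \<Rightarrow> complex"
  assumes v: "supported d v" and zero: "(app d A ^^ n) v = (\<lambda>i. 0)"
  shows "\<exists>m\<le>d. (app d A ^^ m) v = (\<lambda>i. 0)"
proof -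
  obtain ls where ls: "length ls \<le> d" "shifts d A ls v = (\<lambda>i. 0)"
    and min: "\<And>ks. length ks < length ls \<Longrightarrow> shifts d A ks v \<noteq> (\<lambda>i. 0)"
    using minimal_shifts_exist[OF v] by blast
  have "l = 0" if l: "l \<in> set ls" for l
  proof -
    define w where "w = shifts d A (remove1 l ls) v"
    have "w \<noteq> (\<lambda>i. 0)"
      unfolding w_def using l length_pos_if_in_set[OF l] by (intro min) (simp add: length_remove1)
    moreover have "shift d A l w = (\<lambda>i. 0)"
      unfolding w_def using shifts_remove1[OF l, of d A v] ls(2) by simp
    then have "(app d A ^^ n) w = (\<lambda>i. l ^ n * w i)"
      by (intro app_funpow_eigen shift_eq_zeroD)
    moreover have "(app d A ^^ n) w = (\<lambda>i. 0)"
      unfolding w_def app_funpow_shifts zero by (rule shifts_zero)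
    ultimately show ?thesis by (auto simp: fun_eq_iff)
  qed
  then have "ls = replicate (length ls) 0" by (metis replicate_length_same)
  then have "(app d A ^^ length ls) v = (\<lambda>i. 0)" using ls(2) shifts_replicate_zero by metis
  then show ?thesis using ls(1) by blast
qed

text \<open>A sum in place of a maximum over the cases: \<open>d\<close> for the zero roots, then a
  conjugate pair with \<open>M * (d * M) ^ (d + 3)\<close> bounding the first four vectors after at
  most \<open>d\<close> steps, then a multiple root, then two different moduli.\<close>

definition orbit_bound :: "nat \<Rightarrow> nat \<Rightarrow> nat" where
  "orbit_bound d M = d + 25 + 10 * (2 * (M * (d * M) ^ (d + 3))\<^sup>2) ^ 4 +
     2 * upper_bound d M ^ 3 * (lower_bound d M)\<^sup>2 + upper_bound d M ^ 6 * lower_bound d M ^ 5"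

text \<open>Without a solution up to the bound, \<open>n\<close> exceeds every summand of
  \<open>orbit_bound\<close>, so each case is refuted by its own summand.\<close>

lemma integer_orbit_bound:
  fixes A :: "nat \<Rightarrow> nat \<Rightarrow> int" and x u :: "nat \<Rightarrow> int"
  assumes A: "\<And>i j. i < d \<Longrightarrow> j < d \<Longrightarrow> \<bar>A i j\<bar> \<le> int M"
    and x: "supported d x" "\<And>i. \<bar>x i\<bar> \<le> int M"
    and u: "supported d u" "\<And>i. \<bar>u i\<bar> \<le> int M" "i\<^sub>0 < d" "u i\<^sub>0 \<noteq> 0"
    and moduli: "\<And>l k. eig d A l \<Longrightarrow> eig d A k \<Longrightarrow> l \<noteq> k \<Longrightarrow> cmod l = cmod k \<Longrightarrow> k = cnj l"
    and sol: "par d ((app d A ^^ n) x) u"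
  shows "\<exists>n' \<le> orbit_bound d M. par d ((app d A ^^ n') x) u"
proof (rule ccontr)
  assume none: "\<not> ?thesis"
  define T where "T = upper_bound d M"
  define H where "H = lower_bound d M"
  have "1 \<le> d" using u(3) by simp
  have "1 \<le> M" using u(2)[of i\<^sub>0] u(4) by (cases M) auto
  have no: "\<not> par d ((app d A ^^ n') x) u" if "n' \<le> orbit_bound d M" for n' using none that by blast
  then have n: "orbit_bound d M < n" using sol not_less by blast
  define AC where "AC i j = complex_of_int (A i j)" for i j
  define X where "X i = complex_of_int (x i)" for i
  define U where "U i = complex_of_int (u i)" for i
  have F: "(app d AC ^^ k) X = (\<lambda>i. of_int ((app d A ^^ k) x i))" for k
    unfolding AC_def[abs_def] X_def[abs_def] by (rule of_int_app_funpow)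
  have par_iff: "par d ((app d AC ^^ k) X) U \<longleftrightarrow> par d ((app d A ^^ k) x) u" for k
    unfolding F par_def U_def by (simp only: of_int_eq_iff flip: of_int_mult)
  have sX: "supported d X" and sU: "supported d U" and U0: "U i\<^sub>0 \<noteq> 0"
    using x(1) u(1,4) by (auto simp: supported_def X_def U_def)
  obtain c where c: "(app d AC ^^ n) X = (\<lambda>i. c * U i)"
    using par_imp_multiple[OF _ supported_app_funpow[OF sX] sU u(3) U0] sol par_iff by blast
  obtain ls where ls: "length ls \<le> d" "shifts d AC ls X = (\<lambda>i. 0)"
    and min: "\<And>ks. length ks < length ls \<Longrightarrow> shifts d AC ks X \<noteq> (\<lambda>i. 0)"
    using minimal_shifts_exist[OF sX] by blast
  define v where "v l = shifts d AC (remove1 l ls) X" for l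
  have len: "length (remove1 l ls) < length ls" if "l \<in> set ls" for l
    using that length_pos_if_in_set[OF that] by (simp add: length_remove1)
  have v0: "v l \<noteq> (\<lambda>i. 0)" if "l \<in> set ls" for l
    unfolding v_def using min[OF len[OF that]] .
  have "shift d AC l (v l) = (\<lambda>i. 0)" if "l \<in> set ls" for l
    unfolding v_def using shifts_remove1[OF that, of d AC X] ls(2) by simp
  then have v_eig: "app d AC (v l) = (\<lambda>i. l * v l i)" if "l \<in> set ls" for l
    using that shift_eq_zeroD by blast
  have sv: "supported d (v l)" for l unfolding v_def by (rule supported_shifts[OF sX])
  have v_ex: "\<exists>i<d. v l i \<noteq> 0" if "l \<in> set ls" for l
  proof (rule ccontr)
    assume "\<not> (\<exists>i<d. v l i \<noteq> 0)"
    then have "v l i = 0" for i using sv[of l] unfolding supported_def by (cases "i < d") auto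
    then show False using v0[OF that] by auto
  qed
  have eig: "eig d A l" if "l \<in> set ls" for l
    unfolding eig_def
  proof (rule exI[of _ "v l"], intro conjI allI impI)
    show "\<exists>i<d. v l i \<noteq> 0" by (rule v_ex[OF that])
    fix i assume "i < d"
    then show "l * v l i = (\<Sum>j<d. of_int (A i j) * v l j)"
      using fun_cong[OF v_eig[OF that], of i] by (simp add: app_def AC_def)
  qed
  have tame_eig: "tame T H l" "tame T H (l * cnj l - k * cnj k)"
    if "l \<in> set ls" "k \<in> set ls" for l k
    unfolding T_def H_def
    by (rule tame_bounds(1)[of d A M ls], use A \<open>1 \<le> M\<close> \<open>1 \<le> d\<close> eig ls(1) that in auto)
      (rule tame_bounds(2)[of d A M ls], use A \<open>1 \<le> M\<close> \<open>1 \<le> d\<close> eig ls(1) that in auto)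
  have tame_int: "tame T H (shifts d AC G (\<lambda>i. of_int (w i)) i)"
    if "set G \<subseteq> set ls" "length G \<le> d" "\<And>i. \<bar>w i\<bar> \<le> int M" for G w i
    unfolding T_def H_def AC_def[abs_def]
    by (rule tame_bounds(3)[of d A M ls]) (use A \<open>1 \<le> M\<close> \<open>1 \<le> d\<close> eig ls(1) that in auto)
  have tame_shifts: "tame T H (shifts d AC G X i)" "tame T H (shifts d AC G U i)"
    if "set G \<subseteq> set ls" "length G \<le> d" for G i
    using tame_int[OF that, of x i] tame_int[OF that, of u i] x(2) u(2)
    unfolding X_def[abs_def] U_def[abs_def] by auto
  have G: "set (remove1 l ls) \<subseteq> set ls" "length (remove1 l ls) \<le> d" for l
    using ls(1) set_remove1_subset[of l ls] by (auto simp: length_remove1)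
  have key: "l ^ n * v l i = c * shifts d AC (remove1 l ls) U i" if "l \<in> set ls" for l i
  proof -
    have "(app d AC ^^ n) (v l) = shifts d AC (remove1 l ls) (\<lambda>i. c * U i)"
      unfolding v_def app_funpow_shifts c ..
    then show ?thesis
      unfolding app_funpow_eigen[OF v_eig[OF that]] shifts_scale by (rule fun_cong)
  qed
  have zeros: "par d ((app d A ^^ m) x) u" if "(app d AC ^^ m) X = (\<lambda>i. 0)" for m
    unfolding par_iff[symmetric] that by (simp add: par_def)
  \<comment> \<open>For \<open>c = 0\<close> the orbit reaches zero, hence does so within
    \<open>d\<close> steps, and zero is parallel to \<open>u\<close>.\<close>
  have c0: "c \<noteq> 0"
  proof
    assume "c = 0"
    then obtain m where "m \<le> d" "(app d AC ^^ m) X = (\<lambda>i. 0)"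
      using orbit_zero_bound[OF sX, where A = AC and n = n] c by auto
    then show False using zeros no[of m] by (simp add: orbit_bound_def)
  qed
  have same_norm: "norm l \<le> norm k" if lk: "l \<in> set ls" "k \<in> set ls" "k \<noteq> 0" for l k
  proof (rule ccontr)
    assume "\<not> norm l \<le> norm k"
    then have less: "norm k < norm l" by simp
    obtain i j where ij: "v l i \<noteq> 0" "v k j \<noteq> 0" using v_ex lk by blast
    have "n \<le> T ^ 6 * H ^ 5"
      by (rule distinct_modulus_bound[OF key[OF lk(1), of i] key[OF lk(2), of j] c0 ij lk(3) less])
        (auto simp: v_def intro!: tame_eig tame_shifts G lk eig)
    then show False using n by (simp add: orbit_bound_def T_def H_def)
  qed
  have simple: "l \<notin> set (remove1 l ls)" if l: "l \<in> set ls" "l \<noteq> 0" for l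
  proof
    assume l2: "l \<in> set (remove1 l ls)"
    define hs where "hs = remove1 l (remove1 l ls)"
    define w where "w = shifts d AC hs X"
    have vw: "v l = shift d AC l w"
      unfolding v_def w_def hs_def by (rule shifts_remove1[OF l2])
    have uw: "shifts d AC (remove1 l ls) U = shift d AC l (shifts d AC hs U)"
      unfolding hs_def by (rule shifts_remove1[OF l2])
    have app_w: "app d AC w i = l * w i + v l i" for i by (simp add: vw shift_def)
    \<comment> \<open>The closed form for a Jordan chain of length two, multiplied by
      \<open>l\<close> to avoid the exponent \<open>k - 1\<close>.\<close>
    have Aw: "l * (app d AC ^^ k) w i = l ^ k * (l * w i + of_nat k * v l i)" for k i
    proof (induction k arbitrary: i)
      case (Suc k)
      have "l * (app d AC ^^ Suc k) w i = app d AC (\<lambda>i. l * (app d AC ^^ k) w i) i"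
        by (simp add: app_scale)
      \<comment> \<open>The sum is written as a difference, the shape to which
        \<open>app_diff\<close> and \<open>app_scale\<close> apply.\<close>
      also have "\<dots> = app d AC (\<lambda>i. l ^ k * (l * w i - (- of_nat k) * v l i)) i"
        unfolding Suc by simp
      also have "\<dots> = l ^ k * (l * app d AC w i - (- of_nat k) * app d AC (v l) i)"
        unfolding app_scale app_diff ..
      also have "\<dots> = l ^ Suc k * (l * w i + of_nat (Suc k) * v l i)"
        by (simp add: app_w v_eig[OF l(1)] algebra_simps)
      finally show ?case .
    qed simp
    have hs: "set hs \<subseteq> set ls" "length hs \<le> d"
      unfolding hs_def using G[of l] set_remove1_subset[of l "remove1 l ls"]
      by (auto simp: length_remove1)
    obtain i where i: "v l i \<noteq> 0" using v_ex l by blast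
    have "(app d AC ^^ n) w i = c * shifts d AC hs U i"
      unfolding w_def app_funpow_shifts c shifts_scale ..
    then have eq: "l ^ n * (l * w i + of_nat n * v l i) = l * (c * shifts d AC hs U i)"
      using Aw[of n i] by simp
    have "n \<le> 2 * T ^ 3 * H\<^sup>2"
      by (rule jordan_block_bound[OF key[OF l(1), of i] eq l(2) i])
        (auto simp: v_def w_def intro!: tame_eig(1) tame_shifts G hs l eig)
    then show False using n by (simp add: orbit_bound_def T_def H_def)
  qed
  \<comment> \<open>The zero roots are used up by the first \<open>m\<close> steps of the orbit;
    \<open>y\<close> is killed by the nonzero roots alone.\<close>
  define Z where "Z = filter (\<lambda>l. l = 0) ls"
  define ns where "ns = filter (\<lambda>l. l \<noteq> 0) ls"
  define m where "m = length Z"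
  define y where "y = (app d AC ^^ m) X"
  have "Z = replicate m 0" unfolding m_def Z_def by (induction ls) auto
  then have yZ: "shifts d AC Z X = y" unfolding y_def by (simp only: shifts_replicate_zero)
  have "shifts d AC ns y = (\<lambda>i. 0)"
    using shifts_filter[of d AC ls X "\<lambda>l. l \<noteq> 0"] ls(2) yZ unfolding ns_def Z_def by simp
  have lens: "length ls = m + length ns"
    unfolding m_def Z_def ns_def using sum_length_filter_compl[of "\<lambda>l. l = 0" ls] by simp
  have m: "m \<le> d" using lens ls(1) by simp
  then have mn: "m < n" using n by (simp add: orbit_bound_def)
  have minns: "shifts d AC ks y \<noteq> (\<lambda>i. 0)" if "length ks < length ns" for ks
    using min[of "ks @ Z"] that lens unfolding m_def by (simp add: yZ)
  have nm: "(app d AC ^^ n) X = (app d AC ^^ (n - m)) y"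
  proof -
    have "(app d AC ^^ ((n - m) + m)) X = (app d AC ^^ (n - m)) y"
      unfolding y_def funpow_add comp_apply ..
    then show ?thesis using mn by simp
  qed
  have dist: "distinct ns"
  proof (rule ccontr)
    assume "\<not> distinct ns"
    then obtain as bs cs l where ns: "ns = as @ [l] @ bs @ [l] @ cs"
      using not_distinct_decomp by blast
    then have "l \<in> set ns" by simp
    then have l: "l \<in> set ls" "l \<noteq> 0" unfolding ns_def by auto
    have "2 \<le> count (mset ns) l" by (simp add: ns)
    also have "count (mset ns) l \<le> count (mset ls) l" by (simp add: ns_def)
    finally have "0 < count (mset (remove1 l ls)) l" by simp
    then have "l \<in># mset (remove1 l ls)" by (simp only: count_greater_zero_iff)
    then show False using simple[OF l] by (simp only: set_mset_mset)
  qed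
  have conj: "k = cnj l" if "l \<in> set ns" "k \<in> set ns" "l \<noteq> k" for l k
  proof (rule moduli)
    show "cmod l = cmod k" using that same_norm[of l k] same_norm[of k l] by (auto simp: ns_def)
  qed (use that eig in \<open>auto simp: ns_def\<close>)
  consider "ns = []" | l where "ns = [l]" | l where "ns = [l, cnj l]" "l \<noteq> cnj l"
  proof (cases ns)
    case (Cons l ks)
    show ?thesis
    proof (cases ks)
      case (Cons k js)
      have ns: "ns = l # k # js" using \<open>ns = l # ks\<close> Cons by simp
      have "js = []"
      proof (rule ccontr)
        assume "js \<noteq> []"
        then have hd: "hd js \<in> set js" by simp
        have "hd js \<noteq> l" "hd js \<noteq> k" "l \<noteq> k" using dist hd unfolding ns by auto
        moreover have "k = cnj l" by (rule conj) (use \<open>l \<noteq> k\<close> in \<open>auto simp: ns\<close>)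
        moreover have "hd js = cnj l" by (rule conj) (use \<open>hd js \<noteq> l\<close> hd in \<open>auto simp: ns\<close>)
        ultimately show False by simp
      qed
      then have ns': "ns = [l, k]" using ns by simp
      have "l \<noteq> k" using dist unfolding ns' by simp
      then have "k = cnj l" by (intro conj) (simp_all add: ns')
      then show ?thesis using ns' \<open>l \<noteq> k\<close> by (intro that(3)[of l]) simp_all
    qed (rule that(2)[of l], simp add: Cons)
  qed (rule that(1))
  then show False
  proof cases
    case 1
    then have "y = (\<lambda>i. 0)" using \<open>shifts d AC ns y = (\<lambda>i. 0)\<close> by simp
    then show False using zeros[of m] no[of m] m unfolding y_def by (simp add: orbit_bound_def)
  next
    case (2 l)
    then have "l \<in> set ns" by simp
    then have "l \<noteq> 0" unfolding ns_def by simp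
    \<comment> \<open>From \<open>y\<close> on the orbit is only scaled, so \<open>y\<close> is
      already a multiple of \<open>U\<close> and index \<open>m\<close> is a solution.\<close>
    have "shift d AC l y = (\<lambda>i. 0)" using \<open>shifts d AC ns y = (\<lambda>i. 0)\<close> 2 by simp
    then have "(app d AC ^^ (n - m)) y = (\<lambda>i. l ^ (n - m) * y i)"
      by (intro app_funpow_eigen shift_eq_zeroD)
    then have "l ^ (n - m) * y i = c * U i" for i using c nm by (simp add: fun_eq_iff)
    then have "y i = c / l ^ (n - m) * U i" for i using \<open>l \<noteq> 0\<close> by (simp add: field_simps)
    then have "par d y U" by (simp add: par_def)
    then show False using no[of m] m unfolding y_def par_iff by (simp add: orbit_bound_def)
  next
    case (3 l)
    define Y where "Y k = (app d A ^^ (m + k)) x" for k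
    have FY: "(app d AC ^^ k) y = (\<lambda>i. complex_of_int (Y k i))" for k
      unfolding y_def Y_def F[symmetric] by (simp add: funpow_add add.commute[of m])
    have "shift d AC l (shift d AC (cnj l) y) = (\<lambda>i. 0)"
      using \<open>shifts d AC ns y = (\<lambda>i. 0)\<close> 3 by simp
    then have "(app d AC ^^ k) (shift d AC l (shift d AC (cnj l) y)) = (\<lambda>i. 0)" for k
      using shifts_zero[of d AC] app_funpow_scale[where c = 0 and n = k and d = d and A = AC] by simp
    then have "shifts d AC [l, cnj l] ((app d AC ^^ k) y) = (\<lambda>i. 0)" for k
      unfolding app_funpow_shifts[symmetric] by simp
    then have rec0: "shifts d AC [l, cnj l] ((app d AC ^^ k) y) i = 0" for k i
      by (rule fun_cong)
    have rec: "real_of_int (Y (k + 2) i) = 2 * Re l * Y (k + 1) i - (cmod l)\<^sup>2 * Y k i" for k i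
    proof -
      have "shifts d AC [l, cnj l] w i = app d AC (app d AC w) i - (l + cnj l) * app d AC w i + l * cnj l * w i" for w
        unfolding foldr.simps comp_def id_def shift_def[abs_def] app_diff app_scale
        by (simp add: algebra_simps)
      from this[of "(app d AC ^^ k) y"] rec0[of k i]
      have "app d AC (app d AC ((app d AC ^^ k) y)) i - (l + cnj l) * app d AC ((app d AC ^^ k) y) i +
          l * cnj l * (app d AC ^^ k) y i = 0" by (simp only:)
      moreover have "app d AC ((app d AC ^^ k) y) = (app d AC ^^ (k + 1)) y"
        "app d AC ((app d AC ^^ (k + 1)) y) = (app d AC ^^ (k + 2)) y" by simp_all
      ultimately have "complex_of_int (Y (k + 2) i) - (l + cnj l) * Y (k + 1) i + l * cnj l * Y k i = 0"
        unfolding FY by (simp only:)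
      moreover have "a = b - c" if "a - b + c = 0" for a b c :: complex
        using that unfolding diff_add_eq right_minus_eq by (simp only: eq_diff_eq)
      ultimately have "complex_of_int (Y (k + 2) i) = (l + cnj l) * Y (k + 1) i - l * cnj l * Y k i"
        by blast
      also have "\<dots> = complex_of_real (2 * Re l * Y (k + 1) i - (cmod l)\<^sup>2 * Y k i)"
        by (simp add: complex_add_cnj complex_norm_square[symmetric])
      finally have "complex_of_real (Y (k + 2) i) = complex_of_real (2 * Re l * Y (k + 1) i - (cmod l)\<^sup>2 * Y k i)"
        by simp
      then show ?thesis by (simp only: of_real_eq_iff)
    qed
    have "Im l \<noteq> 0" using 3(2) by (simp add: complex_eq_iff)
    then have disc: "(2 * Re l)\<^sup>2 < 4 * (cmod l)\<^sup>2"
      by (simp add: cmod_power2 power_mult_distrib)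
    \<comment> \<open>Otherwise \<open>y\<close> would be an eigenvector, and one root would kill it
      where two are minimal.\<close>
    have "\<not> par d (app d AC y) y"
    proof
      assume p: "par d (app d AC y) y"
      have "y \<noteq> (\<lambda>i. 0)" using minns[of "[]"] 3 by simp
      then obtain a where "y a \<noteq> 0" by auto
      moreover have sy: "supported d y" unfolding y_def by (rule supported_app_funpow[OF sX])
      ultimately have "a < d" by (auto simp: supported_def not_le[symmetric])
      then obtain \<kappa> where \<kappa>: "app d AC y = (\<lambda>i. \<kappa> * y i)"
        using par_imp_multiple[OF p supported_app sy _ \<open>y a \<noteq> 0\<close>] by blast
      have sh: "shift d AC k y = (\<lambda>i. (\<kappa> - k) * y i)" for k
        by (rule ext) (simp add: shift_def \<kappa> algebra_simps)
      have "(\<kappa> - cnj l) * ((\<kappa> - l) * y a) = 0"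
        using rec0[of 0 a] by (simp add: sh shift_scale)
      then have "\<kappa> = l \<or> \<kappa> = cnj l" using \<open>y a \<noteq> 0\<close> by auto
      then have "shifts d AC [\<kappa>] y = (\<lambda>i. 0)" by (simp add: sh)
      then show False using minns[of "[\<kappa>]"] 3 by simp
    qed
    moreover have "app d AC y = (\<lambda>i. of_int (Y 1 i))" "y = (\<lambda>i. of_int (Y 0 i))"
      using FY[of 1] FY[of 0] by simp_all
    ultimately have "\<not> par d (Y 1) (Y 0)"
      unfolding par_def by (simp only: of_int_eq_iff not_False_eq_True flip: of_int_mult)
    then obtain i j where ij: "i < d" "j < d" "Y 1 i * Y 0 j \<noteq> Y 1 j * Y 0 i"
      unfolding par_def by blast
    \<comment> \<open>The exponent \<open>d + 3\<close> comes from \<open>Y k\<close> being the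
      orbit point \<open>m + k\<close> with \<open>m \<le> d\<close> and
      \<open>k \<le> 3\<close>.\<close>
    define V where "V = int (M * (d * M) ^ (d + 3))"
    have dM: "1 \<le> d * M" using \<open>1 \<le> d\<close> \<open>1 \<le> M\<close> by simp
    have V: "int (M * (d * M) ^ k) \<le> V" if "k \<le> d + 3" for k
      unfolding V_def of_nat_le_iff using dM that by (intro mult_le_mono power_increasing) auto
    have "\<exists>n' \<le> 25 + nat (10 * (2 * V\<^sup>2) ^ 4). par d (Y n') u"
    proof (rule quadratic_orbit_bound[OF rec disc ij])
      show "\<bar>Y k i\<bar> \<le> V" if "k \<le> 3" for k i
        unfolding Y_def using m that by (intro order_trans[OF app_funpow_bound[OF A x(2)] V]) auto
      show "\<bar>u i\<bar> \<le> V" for i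
        using u(2)[of i] V[of 0] by simp
      show "par d (Y (n - m)) u" using sol mn by (simp add: Y_def)
      have "(app d AC ^^ n) X i\<^sub>0 \<noteq> 0" using c c0 U0 by simp
      then show "Y (n - m) i\<^sub>0 \<noteq> 0" using mn by (simp add: Y_def F)
    qed (rule u(3))
    then obtain n' where n': "n' \<le> 25 + nat (10 * (2 * V\<^sup>2) ^ 4)" "par d (Y n') u" by blast
    have "nat (10 * (2 * V\<^sup>2) ^ 4) = 10 * (2 * (M * (d * M) ^ (d + 3))\<^sup>2) ^ 4"
    proof -
      have "10 * (2 * V\<^sup>2) ^ 4 = int (10 * (2 * (M * (d * M) ^ (d + 3))\<^sup>2) ^ 4)"
        unfolding V_def by simp
      then show ?thesis by (simp only: nat_int)
    qed
    then have "m + n' \<le> orbit_bound d M" using n'(1) m by (simp add: orbit_bound_def)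
    then show False using no n'(2) unfolding Y_def by blast
  qed
qed

section \<open>The decision procedure\<close>

text \<open>\<open>fact c * c\<close> bounds the entries of the instance after multiplication by the
  common denominator \<open>fact c\<close>.\<close>

definition instance_bound :: "nat \<Rightarrow> nat \<Rightarrow> nat" where
  "instance_bound c d = orbit_bound d (fact c * c)"

lemma computable_instance_bound [comp_intros]:
  "computable f \<Longrightarrow> computable g \<Longrightarrow> computable (\<lambda>x. instance_bound (f x) (g x))"
  unfolding instance_bound_def orbit_bound_def upper_bound_def lower_bound_def dim_bound_def
  by (intro comp_intros)

definition decide_orbit ::
    "nat \<Rightarrow> nat \<Rightarrow> (nat \<times> nat) list list \<Rightarrow> (nat \<times> nat) list \<Rightarrow> (nat \<times> nat) list list \<Rightarrow> bool" where
  "decide_orbit c d A x us = orbit_search (instance_bound c d)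
     (map (\<lambda>r. map (\<lambda>q. frac_of_code q) r) A) (map (\<lambda>q. frac_of_code q) x)
     (map (\<lambda>r. map (\<lambda>q. frac_of_code q) r) us)"

lemma computable_decide_orbit:
  "computable (\<lambda>t. decide_orbit (fst t) (fst (snd t)) (fst (snd (snd t)))
     (fst (snd (snd (snd t)))) (snd (snd (snd (snd t)))))"
  unfolding decide_orbit_def by (intro comp_intros)

abbreviation code_hd :: "nat list \<Rightarrow> nat" where
  "code_hd l \<equiv> (case l of [] \<Rightarrow> 0 | y # ys \<Rightarrow> y)"

abbreviation code_tl :: "nat list \<Rightarrow> nat list" where
  "code_tl l \<equiv> (case l of [] \<Rightarrow> [] | y # ys \<Rightarrow> ys)"

lemma computable_enc: "computable enc"
  by (rule computableI[of "\<lambda>n. n"]) (auto intro: rec_fn_proj)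

lemma decide_orbit_program:
  "\<exists>p. \<forall>c d A x us. c = list_encode [d, enc A, enc x, enc us] \<longrightarrow>
     eval_recf p [c] = Some (if decide_orbit c d A x us then 1 else 0)"
proof -
  \<comment> \<open>\<open>dec\<close> handles its four entries as plain numbers. Since
    \<open>enc\<close> fixes numbers, its result also has the code of the tuple of typed objects.
    The whole code is put in front because the bound depends on it.\<close>
  define dec where "dec l = (enc l, code_hd l, code_hd (code_tl l), code_hd (code_tl (code_tl l)),
    code_hd (code_tl (code_tl (code_tl l))))" for l :: "nat list"
  have "computable dec" unfolding dec_def[abs_def]
    by (intro comp_intros computable_comp[OF computable_enc])
  then obtain F where F: "\<And>k G. rec_fn k G \<Longrightarrow> rec_fn k (\<lambda>xs. F (G xs))" "\<And>l. F (enc l) = enc (dec l)"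
    using computableD by blast
  obtain S where S: "\<And>k G. rec_fn k G \<Longrightarrow> rec_fn k (\<lambda>xs. S (G xs))"
    "\<And>t. S (enc t) = enc (decide_orbit (fst t) (fst (snd t)) (fst (snd (snd t)))
      (fst (snd (snd (snd t)))) (snd (snd (snd (snd t)))))"
    using computableD[OF computable_decide_orbit] by blast
  have "rec_fn 1 (\<lambda>xs. S (F (xs ! 0)))" by (intro S F rec_fn_proj) simp
  then obtain p where "\<forall>xs. length xs = 1 \<longrightarrow> eval_recf p xs = Some (S (F (xs ! 0)))"
    unfolding rec_fn_def by blast
  then have p: "eval_recf p [c] = Some (S (F c))" for c by simp
  have "S (F c) = (if decide_orbit c d A x us then 1 else 0)"
    if c: "c = list_encode [d, enc A, enc x, enc us]" for c d A x us
  proof -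
    have "c = enc [d, enc A, enc x, enc us]" by (simp add: c enc_list_def)
    then have "F c = enc (dec [d, enc A, enc x, enc us])" by (simp only: F(2))
    also have "\<dots> = enc (c, d, A, x, us)" by (simp add: dec_def c)
    finally show ?thesis by (simp only: S(2) fst_conv snd_conv enc_bool_def)
  qed
  then show ?thesis using p by (intro exI[of _ p] allI impI) (simp only:)
qed

section \<open>Codes of instances and clearing of denominators\<close>

lemma rat_code_eq: "rat_code q = enc (code_of_rat q)"
  by (simp add: rat_code_def code_of_rat_def split: prod.splits)

lemma vec_code_eq: "vec_code v = enc (map code_of_rat (list_of_vec v))"
  by (simp add: vec_code_def enc_list_def rat_code_eq[abs_def] comp_def)

lemma mat_code_eq: "mat_code A = enc (map (map code_of_rat) (mat_to_list A))"
  by (simp add: mat_code_def enc_list_def rat_code_eq[abs_def] comp_def)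

lemma list_encode_ge: "x \<in> set xs \<Longrightarrow> x \<le> list_encode xs"
proof (induction xs)
  case (Cons y ys)
  then show ?case
    using le_prod_encode_1[of y "list_encode ys"] le_prod_encode_2[of "list_encode ys" y] by auto
qed simp

lemma rat_code_le_vec_code:
  assumes "v \<in> carrier_vec d" "i < d"
  shows "rat_code (v $ i) \<le> vec_code v"
  unfolding vec_code_def using assms
  by (intro list_encode_ge) (auto simp: set_conv_nth list_of_vec_index intro!: exI[of _ i])

lemma rat_code_le_mat_code:
  assumes A: "A \<in> carrier_mat d d" "i < d" "j < d"
  shows "rat_code (A $$ (i, j)) \<le> mat_code A"
proof -
  have row: "mat_to_list A ! i = list_of_vec (row A i)"
    using A by (auto simp: mat_to_list_def list_eq_iff_nth_eq list_of_vec_index)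
  have "rat_code (row A i $ j) \<le> vec_code (row A i)"
    using A by (intro rat_code_le_vec_code) auto
  also have "vec_code (row A i) \<le> mat_code A"
    unfolding mat_code_def vec_code_def row[symmetric] using A
    by (intro list_encode_ge) (auto simp: mat_to_list_def)
  finally show ?thesis using A by simp
qed

definition int_scale :: "nat \<Rightarrow> rat \<Rightarrow> int" where
  "int_scale c q = \<lfloor>of_nat (fact c) * q\<rfloor>"

text \<open>A code bounds the denominators that occur in it, so \<open>fact c\<close> is a common denominator.\<close>

lemma int_scale:
  assumes "rat_code q \<le> c"
  shows "of_int (int_scale c q) = of_nat (fact c) * q" "\<bar>int_scale c q\<bar> \<le> int (fact c * c)"
proof -
  obtain a b where q: "quotient_of q = (a, b)" by fastforce
  have b: "b > 0" and qab: "q = of_int a / of_int b"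
    using quotient_of_denom_pos[OF q] quotient_of_div[OF q] by auto
  have "rat_code q = prod_encode (int_encode a, nat b)" by (simp add: rat_code_def q)
  then have le: "int_encode a \<le> c" "nat b \<le> c"
    using assms le_prod_encode_1[of "int_encode a" "nat b"] le_prod_encode_2[of "nat b" "int_encode a"]
    by linarith+
  have "\<bar>a\<bar> \<le> int (int_encode a)" by (auto simp: int_encode_def sum_encode_def)
  then have a: "\<bar>a\<bar> \<le> int c" using le(1) by linarith
  have "nat b dvd fact c" using b le(2) by (intro dvd_fact) auto
  then obtain e where e: "fact c = nat b * e" by (rule dvdE)
  have "1 * e \<le> nat b * e" using b by (intro mult_right_mono) linarith+
  then have e': "e \<le> fact c" unfolding e by simp
  have "of_nat (fact c) * q = of_int b * of_nat e * q" unfolding e using b by simp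
  also have "\<dots> = of_int (int e * a)" using b by (simp add: qab)
  finally have eq: "of_nat (fact c) * q = of_int (int e * a)" .
  then have z: "int_scale c q = int e * a" unfolding int_scale_def by (simp only: floor_of_int)
  show "of_int (int_scale c q) = of_nat (fact c) * q" unfolding eq z ..
  have "\<bar>int_scale c q\<bar> = int e * \<bar>a\<bar>" by (simp add: z abs_mult)
  also have "\<dots> \<le> int (fact c) * int c" using a e' by (intro mult_mono) (simp_all del: of_nat_fact)
  finally show "\<bar>int_scale c q\<bar> \<le> int (fact c * c)" by (simp only: of_nat_mult)
qed

text \<open>Matrix and vectors are all scaled by \<open>F\<close>, so the orbit point
  \<open>k\<close> is scaled by \<open>F ^ Suc k\<close>. Vanishing and parallelism are not affected
  by nonzero factors.\<close>

lemma rational_orbit_bound: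
  assumes A: "A \<in> carrier_mat d d" and x: "x \<in> carrier_vec d"
    and codes: "mat_code A \<le> c" "vec_code x \<le> c"
  shows "(A ^\<^sub>m n) *\<^sub>v x = 0\<^sub>v d \<Longrightarrow> \<exists>n' \<le> instance_bound c d. (A ^\<^sub>m n') *\<^sub>v x = 0\<^sub>v d"
    and "distinct_moduli_up_to_cnj A \<Longrightarrow> u \<in> carrier_vec d \<Longrightarrow> vec_code u \<le> c \<Longrightarrow> u \<noteq> 0\<^sub>v d \<Longrightarrow>
      par d (($) ((A ^\<^sub>m n) *\<^sub>v x)) (($) u) \<Longrightarrow>
      \<exists>n' \<le> instance_bound c d. par d (($) ((A ^\<^sub>m n') *\<^sub>v x)) (($) u)"
proof -
  define F :: rat where "F = of_nat (fact c)"
  have F0: "F \<noteq> 0" by (simp add: F_def)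
  define Ai where "Ai i j = int_scale c (A $$ (i, j))" for i j
  define vi where "vi v i = (if i < d then int_scale c (v $ i) else 0)" for v :: "rat vec" and i
  have Ai: "of_int (Ai i j) = F * A $$ (i, j)" "\<bar>Ai i j\<bar> \<le> int (fact c * c)" if "i < d" "j < d" for i j
    unfolding Ai_def F_def using int_scale rat_code_le_mat_code[OF A that] codes(1) order_trans by blast+
  have vi: "i < d \<Longrightarrow> of_int (vi v i) = F * v $ i" "\<bar>vi v i\<bar> \<le> int (fact c * c)"
    if v: "v \<in> carrier_vec d" "vec_code v \<le> c" for v i
  proof -
    have "rat_code (v $ i) \<le> c" if "i < d"
      using rat_code_le_vec_code[OF v(1) that] v(2) by (rule order_trans)
    then show "i < d \<Longrightarrow> of_int (vi v i) = F * v $ i" "\<bar>vi v i\<bar> \<le> int (fact c * c)"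
      unfolding vi_def F_def using int_scale by auto
  qed
  have sup: "supported d (vi v)" for v by (simp add: supported_def vi_def)
  have pow: "of_int ((app d Ai ^^ k) (vi x) i) = F ^ Suc k * ((A ^\<^sub>m k) *\<^sub>v x) $ i" if "i < d" for k i
    using that
  proof (induction k arbitrary: i)
    case 0
    then show ?case using vi(1)[OF x codes(2)] A x by simp
  next
    case (Suc k)
    have "of_int ((app d Ai ^^ Suc k) (vi x) i) =
        (\<Sum>j<d. (F * A $$ (i, j)) * (F ^ Suc k * ((A ^\<^sub>m k) *\<^sub>v x) $ j))"
      using Suc.prems by (simp add: app_def Ai(1) Suc.IH del: power_Suc)
    also have "\<dots> = F ^ Suc (Suc k) * (\<Sum>j<d. A $$ (i, j) * ((A ^\<^sub>m k) *\<^sub>v x) $ j)"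
      by (simp add: sum_distrib_left mult_ac)
    also have "(\<Sum>j<d. A $$ (i, j) * ((A ^\<^sub>m k) *\<^sub>v x) $ j) = (A *\<^sub>v ((A ^\<^sub>m k) *\<^sub>v x)) $ i"
      using Suc.prems A by (simp add: scalar_prod_def atLeast0LessThan)
    finally show ?case by (simp only: pow_mat_Suc_mult_vec[OF A x])
  qed
  show "\<exists>n' \<le> instance_bound c d. (A ^\<^sub>m n') *\<^sub>v x = 0\<^sub>v d" if zero: "(A ^\<^sub>m n) *\<^sub>v x = 0\<^sub>v d"
  proof -
    have iff: "(A ^\<^sub>m k) *\<^sub>v x = 0\<^sub>v d \<longleftrightarrow>
        (app d (\<lambda>i j. complex_of_int (Ai i j)) ^^ k) (\<lambda>i. of_int (vi x i)) = (\<lambda>i. 0)" for k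
    proof -
      have "(app d (\<lambda>i j. complex_of_int (Ai i j)) ^^ k) (\<lambda>i. of_int (vi x i)) = (\<lambda>i. 0) \<longleftrightarrow>
          (\<forall>i<d. (app d Ai ^^ k) (vi x) i = 0)"
        unfolding of_int_app_funpow fun_eq_iff of_int_eq_0_iff
        using supported_app_funpow[OF sup[of x], where A = Ai and n = k] unfolding supported_def
        by (meson not_le)
      also have "\<dots> \<longleftrightarrow> (\<forall>i<d. ((A ^\<^sub>m k) *\<^sub>v x) $ i = 0)"
      proof -
        have "(app d Ai ^^ k) (vi x) i = 0 \<longleftrightarrow> ((A ^\<^sub>m k) *\<^sub>v x) $ i = 0" if "i < d" for i
          using pow[OF that, of k] F0 by (metis of_int_0_eq_iff mult_eq_0_iff power_not_zero)
        then show ?thesis by blast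
      qed
      also have "\<dots> \<longleftrightarrow> (A ^\<^sub>m k) *\<^sub>v x = 0\<^sub>v d" using A by (auto simp: vec_eq_iff)
      finally show ?thesis by blast
    qed
    have "supported d (\<lambda>i. complex_of_int (vi x i))" by (simp add: supported_def vi_def)
    from orbit_zero_bound[OF this] zero iff obtain m where "m \<le> d" "(A ^\<^sub>m m) *\<^sub>v x = 0\<^sub>v d"
      by blast
    then show ?thesis
      by (intro exI[of _ m]) (simp add: instance_bound_def orbit_bound_def)
  qed
  show "\<exists>n' \<le> instance_bound c d. par d (($) ((A ^\<^sub>m n') *\<^sub>v x)) (($) u)"
    if mod: "distinct_moduli_up_to_cnj A" and u: "u \<in> carrier_vec d" "vec_code u \<le> c" "u \<noteq> 0\<^sub>v d"
      and sol: "par d (($) ((A ^\<^sub>m n) *\<^sub>v x)) (($) u)"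
  proof -
    have iff: "par d ((app d Ai ^^ k) (vi x)) (vi u) \<longleftrightarrow> par d (($) ((A ^\<^sub>m k) *\<^sub>v x)) (($) u)" for k
    proof -
      have "(app d Ai ^^ k) (vi x) i * vi u j = (app d Ai ^^ k) (vi x) j * vi u i \<longleftrightarrow>
          ((A ^\<^sub>m k) *\<^sub>v x) $ i * u $ j = ((A ^\<^sub>m k) *\<^sub>v x) $ j * u $ i" if "i < d" "j < d" for i j
      proof -
        have "(app d Ai ^^ k) (vi x) i * vi u j = (app d Ai ^^ k) (vi x) j * vi u i \<longleftrightarrow>
            (of_int ((app d Ai ^^ k) (vi x) i) * of_int (vi u j) :: rat) =
            of_int ((app d Ai ^^ k) (vi x) j) * of_int (vi u i)"
          by (simp only: of_int_eq_iff flip: of_int_mult)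
        also have "\<dots> \<longleftrightarrow> (F ^ Suc k * F) * (((A ^\<^sub>m k) *\<^sub>v x) $ i * u $ j) =
            (F ^ Suc k * F) * (((A ^\<^sub>m k) *\<^sub>v x) $ j * u $ i)"
          by (simp only: pow[OF that(1)] pow[OF that(2)] vi(1)[OF u(1,2) that(1)]
              vi(1)[OF u(1,2) that(2)] mult_ac)
        also have "\<dots> \<longleftrightarrow> ((A ^\<^sub>m k) *\<^sub>v x) $ i * u $ j = ((A ^\<^sub>m k) *\<^sub>v x) $ j * u $ i"
          using F0 by simp
        finally show ?thesis .
      qed
      then show ?thesis unfolding par_def by blast
    qed
    have "\<exists>i<d. u $ i \<noteq> 0" using u(1,3) by (auto simp: vec_eq_iff)
    then obtain i where i: "i < d" "u $ i \<noteq> 0" by blast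
    then have ui: "vi u i \<noteq> 0" using vi(1)[OF u(1,2) i(1)] F0 by auto
    \<comment> \<open>Scaling multiplies the eigenvalues by the nonzero real number
      \<open>F\<close>, which preserves equality of moduli and conjugacy.\<close>
    have "eigenvalue (map_mat of_rat A) (l / of_rat F)" if "eig d Ai l" for l :: complex
    proof -
      obtain v where v: "\<exists>i<d. v i \<noteq> 0" "\<forall>i<d. l * v i = (\<Sum>j<d. of_int (Ai i j) * v j)"
        using \<open>eig d Ai l\<close> unfolding eig_def by blast
      have Ac: "complex_of_int (Ai i j) = of_rat F * of_rat (A $$ (i, j))" if "i < d" "j < d" for i j
        using arg_cong[OF Ai(1)[OF that], of "of_rat :: rat \<Rightarrow> complex"]
        by (simp add: of_rat_mult)
      have "eigenvector (map_mat of_rat A) (vec d v) (l / of_rat F)"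
        unfolding eigenvector_def
      proof (intro conjI)
        show "vec d v \<in> carrier_vec (dim_row (map_mat of_rat A))" using A by simp
        show "vec d v \<noteq> 0\<^sub>v (dim_row (map_mat of_rat A))" using v(1) A by (auto simp: vec_eq_iff)
        show "map_mat of_rat A *\<^sub>v vec d v = l / of_rat F \<cdot>\<^sub>v vec d v"
        proof (rule eq_vecI)
          fix i assume "i < dim_vec (l / of_rat F \<cdot>\<^sub>v vec d v)"
          then have i: "i < d" by simp
          have "l * v i = of_rat F * (\<Sum>j<d. of_rat (A $$ (i, j)) * v j)"
            using v(2) i by (simp add: Ac sum_distrib_left mult.assoc)
          then have "(\<Sum>j<d. of_rat (A $$ (i, j)) * v j) = l / of_rat F * v i"
            using F0 by (simp add: field_simps)
          then show "(map_mat of_rat A *\<^sub>v vec d v) $ i = (l / of_rat F \<cdot>\<^sub>v vec d v) $ i"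
            using A i by (simp add: scalar_prod_def atLeast0LessThan)
        qed (use A in simp)
      qed
      then show ?thesis unfolding eigenvalue_def by blast
    qed
    moreover have "cnj (of_rat F) = of_rat F"
      by (simp only: F_def of_rat_of_nat_eq complex_cnj_of_nat)
    ultimately have moduli: "k = cnj l"
      if "eig d Ai l" "eig d Ai k" "l \<noteq> k" "cmod l = cmod k" for l k
      using mod[unfolded distinct_moduli_up_to_cnj_def, rule_format, of "l / of_rat F" "k / of_rat F"]
        that F0 by (auto simp: norm_divide)
    have "\<exists>n' \<le> orbit_bound d (fact c * c). par d ((app d Ai ^^ n') (vi x)) (vi u)"
      by (rule integer_orbit_bound[OF Ai(2) sup vi(2)[OF x codes(2)] sup vi(2)[OF u(1,2)] i(1) ui moduli])
        (use sol iff in auto)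
    then show ?thesis unfolding iff instance_bound_def .
  qed
qed

section \<open>Subspaces of dimension at most one, and correctness of the search\<close>

lemma subspace_basis_cases:
  assumes U: "rat_subspace d U" "subspace_dim d U \<le> 1"
    and us: "distinct us" "subspace_basis d U (set us)"
  obtains "us = []" "U = {0\<^sub>v d}"
  | u where "us = [u]" "u \<in> carrier_vec d" "u \<noteq> 0\<^sub>v d" "U = range (\<lambda>k. k \<cdot>\<^sub>v u)"
proof -
  interpret vec_space "TYPE(rat)" d .
  have vs: "vectorspace class_ring (rat_space d\<lparr>carrier := U\<rparr>)" by (rule subspace_is_vs[OF U(1)])
  have sub: "submodule class_ring U (rat_space d)" using U(1) unfolding VectorSpace.subspace_def by blast
  then have UV: "U \<subseteq> carrier_vec d" unfolding submodule_def by (simp add: module_vec_simps)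
  note basis = us(2)[unfolded vectorspace.basis_def[OF vs]]
  have usU: "set us \<subseteq> U" using basis by simp
  \<comment> \<open>The basis property speaks of the structure with carrier \<open>U\<close>; span
    and independence are moved to the full space, where linear combinations can be computed by
    coordinates.\<close>
  have span: "span (set us) = U"
    using basis span_li_not_depend(1)[OF usU sub] by simp
  have li: "lin_indpt (set us)"
    using basis span_li_not_depend(2)[OF usU sub] by simp
  have "length us \<le> 1"
    using vectorspace.dim_basis[OF vs _ us(2)] U(2) distinct_card[OF us(1)] by simp
  then consider "us = []" | u where "us = [u]" by (cases us) auto
  then show ?thesis
  proof cases
    case 1
    then show ?thesis using that(1) span span_empty by (simp add: module_vec_simps)
  next
    case (2 u)
    have u: "u \<in> carrier_vec d" using usU UV 2 by auto
    have "(UNIV :: rat set) \<noteq> {0}" using one_neq_zero by blast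
    then have "u \<noteq> 0\<^sub>v d"
      using li zero_nin_lin_indpt[of "set us"] 2 u by (auto simp: module_vec_simps)
    moreover have "lincomb a {u} = a u \<cdot>\<^sub>v u" for a
    proof (rule eq_vecI)
      fix i assume "i < dim_vec (a u \<cdot>\<^sub>v u)"
      then show "lincomb a {u} $ i = (a u \<cdot>\<^sub>v u) $ i"
        using u lincomb_index[of i "{u}" a] by auto
    qed (use u lincomb_dim[of "{u}" a] in auto)
    then have "span {u} = range (\<lambda>k. k \<cdot>\<^sub>v u)"
      using finite_span[of "{u}"] u by (auto simp: module_vec_simps class_ring_simps intro!: exI[of _ "\<lambda>_. _"])
    ultimately show ?thesis using that(2)[of u] 2 u span by simp
  qed
qed

lemma mem_line_iff_par:
  assumes u: "u \<in> carrier_vec d" "u \<noteq> 0\<^sub>v d" and v: "v \<in> carrier_vec d"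
  shows "v \<in> range (\<lambda>k. k \<cdot>\<^sub>v u) \<longleftrightarrow> par d (($) v) (($) (u :: rat vec))"
proof
  assume "par d (($) v) (($) u)"
  moreover obtain i where "i < d" "u $ i \<noteq> 0" using u by (auto simp: vec_eq_iff)
  ultimately have "v = (v $ i / u $ i) \<cdot>\<^sub>v u"
    using u(1) v by (auto simp: vec_eq_iff par_def field_simps)
  then show "v \<in> range (\<lambda>k. k \<cdot>\<^sub>v u)" by blast
qed (use u in \<open>auto simp: par_def\<close>)

lemma frac_vec_rep_of_code: "frac_vec_rep (map (\<lambda>q. frac_of_code q) (map code_of_rat (list_of_vec v))) v"
  by (simp add: list_all2_conv_all_nth frac_rep_of_code)

text \<open>Exact fraction arithmetic makes each single test correct; the bound guarantees that a
  search up to \<open>instance_bound c d\<close> misses no solution.\<close>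

lemma decide_orbit_correct:
  assumes A: "A \<in> carrier_mat d d" and mod: "distinct_moduli_up_to_cnj A"
    and x: "x \<in> carrier_vec d" and U: "rat_subspace d U" "subspace_dim d U \<le> 1"
    and us: "distinct us" "subspace_basis d U (set us)"
    and c: "mat_code A \<le> c" "vec_code x \<le> c" "\<And>u. u \<in> set us \<Longrightarrow> vec_code u \<le> c"
  shows "decide_orbit c d (map (map code_of_rat) (mat_to_list A)) (map code_of_rat (list_of_vec x))
      (map (\<lambda>u. map code_of_rat (list_of_vec u)) us) \<longleftrightarrow> (\<exists>n. (A ^\<^sub>m n) *\<^sub>v x \<in> U)"
proof -
  define As where "As = map (\<lambda>r. map (\<lambda>q. frac_of_code q) r) (map (map code_of_rat) (mat_to_list A))"
  define xs where "xs = map (\<lambda>q. frac_of_code q) (map code_of_rat (list_of_vec x))"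
  define uss where "uss = map (\<lambda>r. map (\<lambda>q. frac_of_code q) r) (map (\<lambda>u. map code_of_rat (list_of_vec u)) us)"
  have As: "list_all2 (list_all2 frac_rep) As (mat_to_list A)"
    unfolding As_def by (simp add: list_all2_conv_all_nth frac_rep_of_code)
  have rep: "frac_vec_rep ((frac_mat_vec As ^^ n) xs) ((A ^\<^sub>m n) *\<^sub>v x)" for n
    by (rule frac_mat_vec_funpow_rep[OF A x As]) (simp only: xs_def frac_vec_rep_of_code)
  have car: "(A ^\<^sub>m n) *\<^sub>v x \<in> carrier_vec d" for n
    by (rule mult_mat_vec_carrier[OF pow_carrier_mat[OF A] x])
  have "frac_in_span ((frac_mat_vec As ^^ n) xs) uss \<longleftrightarrow> (A ^\<^sub>m n) *\<^sub>v x \<in> U" for n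
  proof (rule subspace_basis_cases[OF U us])
    assume "us = []" "U = {0\<^sub>v d}"
    then show ?thesis using frac_in_span_Nil_iff[OF rep car] by (simp add: uss_def)
  next
    fix u assume u: "us = [u]" "u \<in> carrier_vec d" "u \<noteq> 0\<^sub>v d" "U = range (\<lambda>k. k \<cdot>\<^sub>v u)"
    then show ?thesis
      using frac_in_span_Cons_iff[OF rep car frac_vec_rep_of_code u(2), of n "[]"] mem_line_iff_par[OF u(2,3) car]
      by (simp add: uss_def par_def)
  qed
  then have "decide_orbit c d (map (map code_of_rat) (mat_to_list A)) (map code_of_rat (list_of_vec x))
      (map (\<lambda>u. map code_of_rat (list_of_vec u)) us) \<longleftrightarrow>
      (\<exists>n\<le>instance_bound c d. (A ^\<^sub>m n) *\<^sub>v x \<in> U)"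
    unfolding decide_orbit_def orbit_search_iff As_def[symmetric] xs_def[symmetric] uss_def[symmetric]
    by blast
  also have "\<dots> \<longleftrightarrow> (\<exists>n. (A ^\<^sub>m n) *\<^sub>v x \<in> U)"
  proof (rule subspace_basis_cases[OF U us])
    assume "us = []" "U = {0\<^sub>v d}"
    then show ?thesis using rational_orbit_bound(1)[OF A x c(1,2)] by auto
  next
    fix u assume u: "us = [u]" "u \<in> carrier_vec d" "u \<noteq> 0\<^sub>v d" "U = range (\<lambda>k. k \<cdot>\<^sub>v u)"
    have "vec_code u \<le> c" using c(3) u(1) by simp
    from rational_orbit_bound(2)[OF A x c(1,2) mod u(2) this u(3)] show ?thesis
      unfolding u(4) mem_line_iff_par[OF u(2,3) car] by blast
  qed
  finally show ?thesis .
qed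

theorem theorem1p2:
  shows "decidable_on orbit_instance_code
    {(d, A, x, U).
       A \<in> carrier_mat d d \<and> distinct_moduli_up_to_cnj A \<and> x \<in> carrier_vec d \<and>
       rat_subspace d U \<and> subspace_dim d U \<le> 1}
    (\<lambda>(d, A, x, U). \<exists>n::nat. (A ^\<^sub>m n) *\<^sub>v x \<in> U)"
proof -
  obtain p where p: "\<And>c d A x us. c = list_encode [d, enc A, enc x, enc us] \<Longrightarrow>
     eval_recf p [c] = Some (if decide_orbit c d A x us then 1 else 0)"
    using decide_orbit_program by blast
  have "eval_recf p [c] = Some (if \<exists>n. (A ^\<^sub>m n) *\<^sub>v x \<in> U then 1 else 0)"
    if A: "A \<in> carrier_mat d d" "distinct_moduli_up_to_cnj A" "x \<in> carrier_vec d"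
        "rat_subspace d U" "subspace_dim d U \<le> 1"
      and us: "distinct us" "subspace_basis d U (set us)"
      and c: "c = list_encode [d, mat_code A, vec_code x, list_encode (map vec_code us)]"
    for d A x U us c
  proof -
    have "list_encode (map vec_code us) = enc (map (\<lambda>u. map code_of_rat (list_of_vec u)) us)"
      by (simp add: enc_list_def[of "map _ us"] vec_code_eq[abs_def] comp_def)
    then have "eval_recf p [c] = Some (if decide_orbit c d (map (map code_of_rat) (mat_to_list A))
        (map code_of_rat (list_of_vec x)) (map (\<lambda>u. map code_of_rat (list_of_vec u)) us) then 1 else 0)"
      using p c by (simp only: mat_code_eq vec_code_eq)
    moreover have "mat_code A \<le> c" "vec_code x \<le> c" "list_encode (map vec_code us) \<le> c"
      unfolding c by (rule list_encode_ge, simp)+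
    moreover from this(3) have "vec_code u \<le> c" if "u \<in> set us" for u
      using list_encode_ge[of "vec_code u" "map vec_code us"] that by simp
    ultimately show ?thesis using decide_orbit_correct[OF A us] by simp
  qed
  then show ?thesis unfolding decidable_on_def orbit_instance_code_def by (intro exI[of _ p]) auto
qed

end
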